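(* If the problem of deciding whether a cubic polynomial has any local minima is in P (resp. in NP), then the SDP Strict Feasibility Problem (SDPSF) is in P (resp. in NP).
   Context: A cubic polynomial is a real polynomial all of whose monomials have degree at most 3; in the decision problem, the input is a cubic polynomial in $n$ variables ($n$ part of the input) with rational coefficients. A point $\bar x\in\mathbb{R}^n$ is a local minimum of $p$ if there is $\epsilon>0$ such that $p(\bar x)\le p(y)$ for all $y$ with $\|y-\bar x\|\le\epsilon$. SDPSF is the decision problem: given $m\times m$ symmetric matrices $A_0,\ldots,A_n$ with rational entries, decide whether there exists $x\in\mathbb{R}^n$ such that $A_0+\sum_{i=1}^n x_iA_i\succ 0$ (positive definite). Complexity is in the Turing model with respect to the bit length of the input. *)

theory Defs
  imports
    "Jordan_Normal_Form.Matrix"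
    "HOL-Computational_Algebra.Polynomial"
begin

section \<open>Turing machines and the classes P and NP\<close>

text \<open>
  Machines have finitely many two-way infinite tapes over an alphabet of natural numbers, with
  \<open>0\<close> the blank. States and symbols are finite in number because the transition table is finite.
  A table entry \<open>(q, rs, q', ws, ms)\<close> means: in state \<open>q\<close>, scanning the symbols \<open>rs\<close> (one per
  tape), the machine may go to state \<open>q'\<close>, write \<open>ws\<close>, and then move the heads by \<open>ms\<close>.
\<close>

datatype move = Move_Left | Stay | Move_Right

type_synonym transition = "nat \<times> nat list \<times> nat \<times> nat list \<times> move list"

record machine =
  num_tapes :: nat
  start_state :: nat
  accept_state :: nat
  transitions :: "transition set"

definition machine_wf :: "machine \<Rightarrow> bool" where
  "machine_wf M \<longleftrightarrow> num_tapes M \<ge> 1 \<and> finite (transitions M) \<and>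
     (\<forall>(q, rs, q', ws, ms) \<in> transitions M.
        length rs = num_tapes M \<and> length ws = num_tapes M \<and> length ms = num_tapes M)"

definition deterministic :: "machine \<Rightarrow> bool" where
  "deterministic M \<longleftrightarrow>
     (\<forall>q rs a b. (q, rs, a) \<in> transitions M \<and> (q, rs, b) \<in> transitions M \<longrightarrow> a = b)"

text \<open>A tape is its contents together with the position of the head.\<close>

type_synonym tape = "(int \<Rightarrow> nat) \<times> int"
type_synonym config = "nat \<times> tape list"

definition read_tape :: "tape \<Rightarrow> nat" where
  "read_tape t = (case t of (c, h) \<Rightarrow> c h)"

fun move_head :: "move \<Rightarrow> int \<Rightarrow> int" where
  "move_head Move_Left h = h - 1"
| "move_head Stay h = h"
| "move_head Move_Right h = h + 1"

definition update_tape :: "nat \<Rightarrow> move \<Rightarrow> tape \<Rightarrow> tape" where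
  "update_tape s m t = (case t of (c, h) \<Rightarrow> (c(h := s), move_head m h))"

definition step :: "machine \<Rightarrow> config \<Rightarrow> config \<Rightarrow> bool" where
  "step M C C' \<longleftrightarrow> (\<exists>ws ms.
     (fst C, map read_tape (snd C), fst C', ws, ms) \<in> transitions M \<and>
     snd C' = map (\<lambda>(s, m, t). update_tape s m t) (zip ws (zip ms (snd C))))"

definition blank_tape :: tape where
  "blank_tape = (\<lambda>_. 0, 0)"

definition input_tape :: "bool list \<Rightarrow> tape" where
  "input_tape w =
     (\<lambda>i. if 0 \<le> i \<and> i < int (length w) then (if w ! nat i then 2 else 1) else 0, 0)"

definition init_config :: "machine \<Rightarrow> bool list \<Rightarrow> config" where
  "init_config M w = (start_state M, input_tape w # replicate (num_tapes M - 1) blank_tape)"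

definition accepts :: "machine \<Rightarrow> bool list \<Rightarrow> bool" where
  "accepts M w \<longleftrightarrow> (\<exists>C. (step M)\<^sup>*\<^sup>* (init_config M w) C \<and> fst C = accept_state M)"

text \<open>Every computation, on every branch, stops within polynomially many steps.\<close>

definition poly_time :: "machine \<Rightarrow> bool" where
  "poly_time M \<longleftrightarrow> (\<exists>p :: nat poly. \<forall>w k C.
     (step M ^^ k) (init_config M w) C \<longrightarrow> k \<le> poly p (length w))"

definition class_P :: "bool list set set" where
  "class_P = {L. \<exists>M. machine_wf M \<and> deterministic M \<and> poly_time M \<and>
                     (\<forall>w. w \<in> L \<longleftrightarrow> accepts M w)}"

definition class_NP :: "bool list set set" where
  "class_NP = {L. \<exists>M. machine_wf M \<and> poly_time M \<and> (\<forall>w. w \<in> L \<longleftrightarrow> accepts M w)}"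


section \<open>Binary encodings\<close>

text \<open>
  Structured data are written as bracketed bit sequences. Each of the four characters (the bits
  0 and 1 and the two brackets) takes two bits, so that words over \<open>{0, 1}\<close> result.
\<close>

datatype tree = Bit bool | Node "tree list"

fun serialize :: "tree \<Rightarrow> bool list" where
  "serialize (Bit b) = [False, b]"
| "serialize (Node ts) = [True, False] @ concat (map serialize ts) @ [True, True]"

text \<open>Least significant bit first, without superfluous zeros.\<close>

fun binary :: "nat \<Rightarrow> bool list" where
  "binary n = (if n = 0 then [] else odd n # binary (n div 2))"

declare binary.simps [simp del]

definition enc_nat :: "nat \<Rightarrow> tree" where
  "enc_nat n = Node (map Bit (binary n))"

definition enc_int :: "int \<Rightarrow> tree" where
  "enc_int z = Node (Bit (z < 0) # map Bit (binary (nat \<bar>z\<bar>)))"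

text \<open>
  Unary notation is used only for the number of variables of a polynomial and for the indices of
  variables. The number of variables counts towards the size of the input, and indices are bounded
  by it.
\<close>

definition enc_unary :: "nat \<Rightarrow> tree" where
  "enc_unary n = Node (replicate n (Bit True))"

text \<open>
  A rational number is given by a numerator and a positive denominator, written in binary and not
  necessarily in lowest terms.
\<close>

type_synonym frac = "int \<times> nat"

definition valid_frac :: "frac \<Rightarrow> bool" where
  "valid_frac c \<longleftrightarrow> snd c > 0"

definition frac_val :: "frac \<Rightarrow> real" where
  "frac_val c = real_of_int (fst c) / real (snd c)"

definition enc_frac :: "frac \<Rightarrow> tree" where
  "enc_frac c = Node [enc_int (fst c), enc_nat (snd c)]"


section \<open>Local minima of cubic polynomials\<close>

text \<open>
  An instance \<open>(n, ts)\<close> is a polynomial in the variables \<open>x\<^sub>0, \<dots>, x\<^bsub>n-1\<^esub>\<close> given as a sum of terms.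
  The term \<open>(c, [i, j, k])\<close> stands for \<open>c * x\<^sub>i * x\<^sub>j * x\<^sub>k\<close>, and shorter index lists give monomials
  of lower degree. The terms need not be collected.
\<close>

type_synonym cubic_inst = "nat \<times> (frac \<times> nat list) list"

definition valid_cubic :: "cubic_inst \<Rightarrow> bool" where
  "valid_cubic I \<longleftrightarrow> (case I of (n, ts) \<Rightarrow> n \<ge> 1 \<and>
     (\<forall>(c, vs) \<in> set ts. valid_frac c \<and> length vs \<le> 3 \<and> (\<forall>v \<in> set vs. v < n)))"

definition cubic_eval :: "cubic_inst \<Rightarrow> real vec \<Rightarrow> real" where
  "cubic_eval I x = (\<Sum>(c, vs) \<leftarrow> snd I. frac_val c * (\<Prod>v \<leftarrow> vs. x $ v))"

definition euclidean_norm :: "real vec \<Rightarrow> real" where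
  "euclidean_norm v = sqrt (v \<bullet> v)"

definition local_minimum :: "nat \<Rightarrow> (real vec \<Rightarrow> real) \<Rightarrow> real vec \<Rightarrow> bool" where
  "local_minimum n p x \<longleftrightarrow> x \<in> carrier_vec n \<and>
     (\<exists>\<epsilon>>0. \<forall>y \<in> carrier_vec n. euclidean_norm (y - x) \<le> \<epsilon> \<longrightarrow> p x \<le> p y)"

definition enc_cubic :: "cubic_inst \<Rightarrow> tree" where
  "enc_cubic I = (case I of (n, ts) \<Rightarrow> Node [enc_unary n,
     Node (map (\<lambda>(c, vs). Node [enc_frac c, Node (map enc_unary vs)]) ts)])"

definition CUBIC_LOCAL_MIN :: "bool list set" where
  "CUBIC_LOCAL_MIN = {serialize (enc_cubic I) | I.
     valid_cubic I \<and> (\<exists>x. local_minimum (fst I) (cubic_eval I) x)}"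


section \<open>Strict feasibility of semidefinite programs\<close>

text \<open>
  A symmetric matrix is given by the rows of its lower triangle, so that row \<open>i\<close> (counting from
  \<open>0\<close>) has \<open>i + 1\<close> entries. An instance is the list of the matrices \<open>A\<^sub>0, \<dots>, A\<^sub>n\<close>.
\<close>

type_synonym sym_inst = "frac list list"
type_synonym sdp_inst = "sym_inst list"

definition valid_sym :: "nat \<Rightarrow> sym_inst \<Rightarrow> bool" where
  "valid_sym m A \<longleftrightarrow> length A = m \<and>
     (\<forall>i<m. length (A ! i) = i + 1 \<and> (\<forall>c \<in> set (A ! i). valid_frac c))"

definition sym_mat :: "sym_inst \<Rightarrow> real mat" where
  "sym_mat A = mat (length A) (length A)
     (\<lambda>(i, j). frac_val (if j \<le> i then A ! i ! j else A ! j ! i))"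

definition valid_sdp :: "nat \<Rightarrow> nat \<Rightarrow> sdp_inst \<Rightarrow> bool" where
  "valid_sdp m n As \<longleftrightarrow> m \<ge> 1 \<and> n \<ge> 1 \<and> length As = n + 1 \<and> (\<forall>A \<in> set As. valid_sym m A)"

definition pos_definite :: "nat \<Rightarrow> real mat \<Rightarrow> bool" where
  "pos_definite m A \<longleftrightarrow> A \<in> carrier_mat m m \<and> transpose_mat A = A \<and>
     (\<forall>v \<in> carrier_vec m. v \<noteq> 0\<^sub>v m \<longrightarrow> v \<bullet> (A *\<^sub>v v) > 0)"

text \<open>The matrix \<open>A\<^sub>0 + x\<^sub>1 A\<^sub>1 + \<dots> + x\<^sub>n A\<^sub>n\<close>; the coordinates of the vector are numbered from \<open>0\<close>.\<close>

definition pencil :: "nat \<Rightarrow> nat \<Rightarrow> (nat \<Rightarrow> real mat) \<Rightarrow> real vec \<Rightarrow> real mat" where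
  "pencil m n A x = mat m m (\<lambda>(i, j). A 0 $$ (i, j) + (\<Sum>k=1..n. x $ (k - 1) * A k $$ (i, j)))"

definition enc_sdp :: "sdp_inst \<Rightarrow> tree" where
  "enc_sdp As = Node (map (\<lambda>A. Node (map (\<lambda>r. Node (map enc_frac r)) A)) As)"

definition SDPSF :: "bool list set" where
  "SDPSF = {serialize (enc_sdp As) | As m n. valid_sdp m n As \<and>
     (\<exists>x \<in> carrier_vec n. pos_definite m (pencil m n (\<lambda>k. sym_mat (As ! k)) x))}"


section \<open>The encodings are unambiguous\<close>

lemma serialize_prefix_free:
  "serialize t @ xs = serialize u @ ys \<Longrightarrow> t = u \<and> xs = ys"
proof (induction t arbitrary: u xs ys)
  case (Bit b)
  then show ?case by (cases u) auto
next
  case (Node ts)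
  then obtain us where u: "u = Node us" by (cases u) auto
  have nonterm: "\<not> (\<exists>zs. serialize t @ zs' = True # True # zs)" for t zs'
    by (cases t) auto
  have "concat (map serialize ts) @ [True, True] @ xs = concat (map serialize us) @ [True, True] @ ys
        \<Longrightarrow> ts = us \<and> xs = ys"
    using Node.IH
  proof (induction ts arbitrary: us)
    case Nil
    then show ?case using nonterm by (cases us) (simp_all, metis)
  next
    case (Cons t ts)
    show ?case
    proof (cases us)
      case Nil
      then show ?thesis using Cons.prems(1) nonterm by simp
    next
      case us: (Cons u' us')
      have "t = u' \<and> concat (map serialize ts) @ [True, True] @ xs =
              concat (map serialize us') @ [True, True] @ ys"
        using Cons.prems(2)[of t] Cons.prems(1) us by simp
      moreover have "ts = us' \<and> xs = ys"
      proof (rule Cons.IH)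
        show "concat (map serialize ts) @ [True, True] @ xs =
              concat (map serialize us') @ [True, True] @ ys"
          using calculation by simp
        show "a = v \<and> as = bs"
          if "a \<in> set ts" "serialize a @ as = serialize v @ bs" for a v as bs
          using Cons.prems(2)[of a as v bs] that by simp
      qed
      ultimately show ?thesis using us by simp
    qed
  qed
  then show ?case using Node.prems u by simp
qed

lemma inj_serialize: "inj serialize"
  by (rule injI) (metis append_Nil2 serialize_prefix_free)

lemma inj_binary: "inj binary"
proof (rule injI)
  show "binary m = binary n \<Longrightarrow> m = n" for m n
  proof (induction m arbitrary: n rule: less_induct)
    case (less m)
    show ?case
    proof (cases "m = 0 \<or> n = 0")
      case True
      then show ?thesis using less.prems by (auto simp: binary.simps[of m] binary.simps[of n]
        binary.simps[of 0] split: if_splits)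
    next
      case False
      then have "odd m = odd n" "binary (m div 2) = binary (n div 2)"
        using less.prems by (auto simp: binary.simps[of m] binary.simps[of n])
      moreover have "m div 2 = n div 2" using less.IH[of "m div 2" "n div 2"] calculation False by simp
      ultimately show ?thesis by (metis dvd_mult_div_cancel odd_two_times_div_two_succ)
    qed
  qed
qed

lemma inj_map_Bit: "inj (map Bit)"
  by (rule inj_mapI) (simp add: inj_def)

lemma inj_enc_nat: "inj enc_nat"
  using inj_binary inj_map_Bit by (auto simp: inj_def enc_nat_def)

lemma inj_enc_int: "inj enc_int"
proof (rule injI)
  fix a b assume "enc_int a = enc_int b"
  then have "(a < 0) = (b < 0)" "nat \<bar>a\<bar> = nat \<bar>b\<bar>"
    using inj_binary inj_map_Bit by (auto simp: inj_def enc_int_def)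
  then show "a = b" by (auto simp: abs_if split: if_splits)
qed

lemma inj_enc_unary: "inj enc_unary"
  by (auto simp: inj_def enc_unary_def)

lemma inj_enc_frac: "inj enc_frac"
  using inj_enc_nat inj_enc_int by (auto simp: inj_def enc_frac_def)

lemma inj_enc_cubic: "inj enc_cubic"
proof -
  have vs: "inj (map enc_unary)" using inj_enc_unary by (rule inj_mapI)
  have "inj (\<lambda>(c, vs). Node [enc_frac c, Node (map enc_unary vs)])"
    using inj_enc_frac vs by (auto simp: inj_def)
  then have "inj (map (\<lambda>(c, vs). Node [enc_frac c, Node (map enc_unary vs)]))"
    by (rule inj_mapI)
  then show ?thesis using inj_enc_unary by (auto simp: inj_def enc_cubic_def)
qed

lemma inj_enc_sdp: "inj enc_sdp"
proof -
  have "inj (\<lambda>r. Node (map enc_frac r))"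
    using inj_mapI[OF inj_enc_frac] by (auto simp: inj_def)
  then have "inj (\<lambda>A. Node (map (\<lambda>r. Node (map enc_frac r)) A))"
    using inj_mapI[of "\<lambda>r. Node (map enc_frac r)"] by (auto simp: inj_def)
  then show ?thesis
    using inj_mapI[of "\<lambda>A. Node (map (\<lambda>r. Node (map enc_frac r)) A)"]
    by (auto simp: inj_def enc_sdp_def)
qed

end

theory Submission
  imports Defs "HOL-Library.Countable" "HOL-Library.Sublist" "HOL-Analysis.Function_Topology"
begin

text \<open>
  Strict feasibility of \<open>A\<^sub>0 + \<Sum> x\<^sub>k A\<^sub>k\<close> is made homogeneous and closed: it holds iff
  \<open>\<Sum> x\<^sub>k A\<^sub>k \<succeq> 2 D\<close> for some \<open>x\<close> with \<open>x\<^sub>0 \<ge> 1\<close>, where \<open>D\<close> is a fixed positive diagonal matrix.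
  This in turn holds iff the cubic polynomial
  \<open>(x\<^sub>0 - 1) z\<^sup>2 + y\<^sup>T (\<Sum> x\<^sub>k A\<^sub>k) y / 2 - y\<^sup>T D y\<close>
  has a local minimum: at a local minimum the quadratic form in \<open>(z, y)\<close> is positive
  semidefinite by the parallelogram law, and conversely a large multiple of a strictly feasible
  \<open>x\<close>, together with \<open>z = 0\<close> and \<open>y = 0\<close>, is a local minimum since positive definiteness is
  stable under small perturbations of \<open>x\<close>.

  The reduction is carried out by a small program with counters that reads the input once from
  left to right after measuring its length. Such programs are simulated by a multitape machine
  which then starts the given machine on their output.
\<close>

section \<open>Counter programs and their simulation by machines\<close>

text \<open>The subtracted squares make a closed condition strict: a nonnegative form in
  \<open>(z, y)\<close> alone would give only semidefiniteness of the matrix. Because the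
  homogenised condition may be scaled, any positive \<open>D\<close> works, and it is chosen for
  ease of output: each entry in row \<open>i\<close> of a lower triangle contributes one
  \<open>- y_i^2\<close>. Row \<open>i\<close> has \<open>i + 1\<close> entries and there are
  \<open>n + 1\<close> matrices, hence the weights \<open>(n + 1) * (i + 1)\<close>. Every entry
  thus yields exactly two terms at the moment it is read, and no coefficient is ever stored.

  The output must start with its number of variables, whereas \<open>m\<close> and \<open>n\<close>
  become known only at the end of the parse. Therefore the length of the input takes that place, and
  the variables are interleaved (\<open>z\<close> at 0, \<open>y\<close> at odd and \<open>x\<close>
  at positive even indices), so that an index depends only on its own counter.

  Counters cannot hold binary numerals, which are just copied. Whether a numeral is canonical is
  left to the target language: a bad one spoils the output, and correctness has to recover valid
  input fractions from a valid output.\<close>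

datatype act = MvL | MvR | Out bool | Inc nat | Dec nat
datatype cond = Inp "nat list" | Pos nat
datatype com = Skip | Fail | Do act | Seq com com | Cond cond com com | While cond com

type_synonym astate = "int \<times> nat list \<times> bool list"
type_synonym aconf = "com list \<times> astate"

definition code :: "bool \<Rightarrow> nat" where
  "code b = (if b then 2 else 1)"

definition cells :: "bool list \<Rightarrow> int \<Rightarrow> nat" where
  "cells w i = (if 0 \<le> i \<and> i < int (length w) then code (w ! nat i) else 0)"

lemma input_tape_cells: "input_tape w = (cells w, 0)"
  by (auto simp: input_tape_def cells_def code_def fun_eq_iff)

fun perform :: "act \<Rightarrow> astate \<Rightarrow> astate" where
  "perform MvL (h, cs, out) = (h - 1, cs, out)"
| "perform MvR (h, cs, out) = (h + 1, cs, out)"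
| "perform (Out b) (h, cs, out) = (h, cs, out @ [b])"
| "perform (Inc i) (h, cs, out) = (h, cs[i := Suc (cs ! i)], out)"
| "perform (Dec i) (h, cs, out) = (h, cs[i := cs ! i - 1], out)"

fun holds :: "bool list \<Rightarrow> cond \<Rightarrow> astate \<Rightarrow> bool" where
  "holds w (Inp l) (h, cs, out) \<longleftrightarrow> cells w h \<in> set l"
| "holds w (Pos i) (h, cs, out) \<longleftrightarrow> i < length cs \<and> cs ! i > 0"

text \<open>A halt on the empty stack is success; a halt with \<open>Fail\<close> on top rejects the
  input.\<close>

fun astep :: "bool list \<Rightarrow> aconf \<Rightarrow> aconf option" where
  "astep w ([], s) = None"
| "astep w (Skip # K, s) = Some (K, s)"
| "astep w (Fail # K, s) = None"
| "astep w (Do a # K, s) = Some (K, perform a s)"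
| "astep w (Seq c d # K, s) = Some (c # d # K, s)"
| "astep w (Cond b c d # K, s) = Some ((if holds w b s then c else d) # K, s)"
| "astep w (While b c # K, s) = Some (if holds w b s then c # While b c # K else K, s)"

inductive reaches :: "bool list \<Rightarrow> nat \<Rightarrow> aconf \<Rightarrow> aconf \<Rightarrow> bool" for w where
  reaches_0: "reaches w 0 a a"
| reaches_Suc: "astep w a = Some b \<Longrightarrow> reaches w t b c \<Longrightarrow> reaches w (Suc t) a c"

text \<open>
  Since commands are executed with an explicit continuation, a control state is a stack of
  commands, and only finitely many stacks arise from a given program.
\<close>

fun stacks :: "com \<Rightarrow> com list \<Rightarrow> com list set" where
  "stacks Skip K = {Skip # K}"
| "stacks Fail K = {Fail # K}"
| "stacks (Do a) K = {Do a # K}"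
| "stacks (Seq c d) K = insert (Seq c d # K) (stacks c (d # K) \<union> stacks d K)"
| "stacks (Cond b c d) K = insert (Cond b c d # K) (stacks c K \<union> stacks d K)"
| "stacks (While b c) K = insert (While b c # K) (stacks c (While b c # K))"

lemma finite_stacks: "finite (stacks c K)"
  by (induction c arbitrary: K) auto

lemma stacks_top: "c # K \<in> stacks c K"
  by (cases c) auto

lemma stacks_closed:
  assumes "astep w (L, s) = Some (L', s')" "L \<in> stacks c K"
  shows "L' \<in> insert K (stacks c K)"
  using assms
proof (induction c arbitrary: K)
  case (Seq c d)
  then show ?case using stacks_top[of c "d # K"] stacks_top[of d K] by fastforce
next
  case (Cond b c d)
  then show ?case using stacks_top[of c K] stacks_top[of d K] by (fastforce split: if_splits)
next
  case (While b c)
  then show ?case using stacks_top[of c "While b c # K"] by (fastforce split: if_splits)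
qed auto

section \<open>Actions on lists of tapes\<close>

definition apply_ops :: "nat list \<Rightarrow> move list \<Rightarrow> tape list \<Rightarrow> tape list" where
  "apply_ops ws ms ts = map (\<lambda>(s, m, t). update_tape s m t) (zip ws (zip ms ts))"

lemma update_tape_same: "update_tape (read_tape t) Stay t = t"
  by (cases t) (simp add: update_tape_def read_tape_def)

lemma apply_ops_stay: "n = length ts \<Longrightarrow> apply_ops (map read_tape ts) (replicate n Stay) ts = ts"
  unfolding apply_ops_def by (induction ts arbitrary: n) (auto simp: update_tape_same)

lemma apply_ops_append:
  "length ws = length ts \<Longrightarrow> length ms = length ts \<Longrightarrow>
   apply_ops (ws @ ws') (ms @ ms') (ts @ ts') = apply_ops ws ms ts @ apply_ops ws' ms' ts'"
  by (simp add: apply_ops_def)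

lemma length_apply_ops:
  "length ws = length ts \<Longrightarrow> length ms = length ts \<Longrightarrow> length (apply_ops ws ms ts) = length ts"
  by (simp add: apply_ops_def)

text \<open>Rewriting the scanned symbol without moving is the identity on a tape, so a machine step
  that concerns one tape becomes a list update.\<close>

lemma apply_ops_single:
  "apply_ops ((map read_tape ts)[p := s]) ((replicate (length ts) Stay)[p := m]) ts =
         ts[p := update_tape s m (ts ! p)]"
proof (rule nth_equalityI)
  fix i assume "i < length (apply_ops ((map read_tape ts)[p := s]) ((replicate (length ts) Stay)[p := m]) ts)"
  then have "i < length ts" by (simp add: apply_ops_def)
  then show "apply_ops ((map read_tape ts)[p := s]) ((replicate (length ts) Stay)[p := m]) ts ! i =
      ts[p := update_tape s m (ts ! p)] ! i"
    by (cases "i = p") (simp_all add: apply_ops_def update_tape_same)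
qed (simp add: apply_ops_def)

text \<open>
  The composed machine carries the input tape, one tape per counter, and then the tapes of the
  given machine, whose first tape receives the output of the program. A counter tape has a mark
  in cell 0, and its head position is the value of the counter, so that no cell of it is ever
  rewritten and testing for zero means reading the mark.
\<close>

datatype phase = Init | Run "com list" | Rewind | Sim nat

instance act :: countable
  by countable_datatype
instance cond :: countable
  by countable_datatype
instance com :: countable
  by countable_datatype
instance phase :: countable
  by countable_datatype

text \<open>The result is the one tape affected, the symbol written and the move. Reading 0 on a
  counter tape means that the head is off its mark, that is, the counter is positive. At the mark
  \<open>Dec\<close> does nothing, in agreement with truncated subtraction in
  \<open>perform\<close>.\<close>

fun act_op :: "nat \<Rightarrow> act \<Rightarrow> nat list \<Rightarrow> nat \<times> nat \<times> move" where
  "act_op r MvL rs = (0, rs ! 0, Move_Left)"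
| "act_op r MvR rs = (0, rs ! 0, Move_Right)"
| "act_op r (Out b) rs = (Suc r, code b, Move_Right)"
| "act_op r (Inc i) rs = (if i < r then (Suc i, rs ! Suc i, Move_Right) else (0, rs ! 0, Stay))"
| "act_op r (Dec i) rs = (if i < r \<and> rs ! Suc i = 0 then (Suc i, rs ! Suc i, Move_Left)
                          else (0, rs ! 0, Stay))"

fun sym_holds :: "nat \<Rightarrow> cond \<Rightarrow> nat list \<Rightarrow> bool" where
  "sym_holds r (Inp l) rs \<longleftrightarrow> rs ! 0 \<in> set l"
| "sym_holds r (Pos i) rs \<longleftrightarrow> i < r \<and> rs ! Suc i = 0"

text \<open>When the stack is empty, the output head stands one cell past the output.
  \<open>Rewind\<close> walks left to the blank in cell -1 and returns to cell 0, where the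
  simulated machine expects to start.\<close>

fun delta :: "nat \<Rightarrow> nat \<Rightarrow> phase \<Rightarrow> nat list \<Rightarrow> (phase \<times> nat \<times> nat \<times> move) option" where
  "delta r q0 (Run []) rs = Some (Rewind, Suc r, rs ! Suc r, Move_Left)"
| "delta r q0 (Run (Skip # K)) rs = Some (Run K, 0, rs ! 0, Stay)"
| "delta r q0 (Run (Fail # K)) rs = None"
| "delta r q0 (Run (Do a # K)) rs = Some (Run K, act_op r a rs)"
| "delta r q0 (Run (Seq c d # K)) rs = Some (Run (c # d # K), 0, rs ! 0, Stay)"
| "delta r q0 (Run (Cond b c d # K)) rs =
     Some (Run ((if sym_holds r b rs then c else d) # K), 0, rs ! 0, Stay)"
| "delta r q0 (Run (While b c # K)) rs =
     Some (Run (if sym_holds r b rs then c # While b c # K else K), 0, rs ! 0, Stay)"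
| "delta r q0 Rewind rs =
     (if rs ! Suc r = 0 then Some (Sim q0, Suc r, 0, Move_Right)
      else Some (Rewind, Suc r, rs ! Suc r, Move_Left))"
| "delta r q0 _ rs = None"

text \<open>Before the simulation starts, all tapes carry only these three symbols, and the work
  tapes do so throughout; this keeps the transition table finite.\<close>

definition words :: "nat \<Rightarrow> nat list set" where
  "words n = {rs. set rs \<subseteq> {0, 1, 2} \<and> length rs = n}"

lemma finite_words: "finite (words n)"
  unfolding words_def by (rule finite_lists_length_eq) simp

text \<open>All tapes but the first start out blank, so a single step has to put the marks into cell
  0 of the counter tapes.\<close>

definition init_trans :: "com \<Rightarrow> nat \<Rightarrow> nat \<Rightarrow> transition set" where
  "init_trans c r k = (\<lambda>a. (to_nat Init, a # replicate (r + k) 0, to_nat (Run [c]),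
      a # replicate r 1 @ replicate k 0, replicate (Suc (r + k)) Stay)) ` {0, 1, 2}"

definition run_trans :: "com \<Rightarrow> nat \<Rightarrow> nat \<Rightarrow> nat \<Rightarrow> transition set" where
  "run_trans c r k q0 = {(to_nat q, rs, to_nat q', rs[p := s], (replicate (Suc (r + k)) Stay)[p := m]) |
      q rs q' p s m. q \<in> insert Rewind (Run ` insert [] (stacks c [])) \<and> rs \<in> words (Suc (r + k)) \<and>
      delta r q0 q rs = Some (q', p, s, m)}"

definition sim_trans :: "machine \<Rightarrow> nat \<Rightarrow> transition set" where
  "sim_trans M r = (\<lambda>(us, q, rs, q', ws, ms).
      (to_nat (Sim q), us @ rs, to_nat (Sim q'), us @ ws, replicate (Suc r) Stay @ ms)) `
      (words (Suc r) \<times> transitions M)"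

definition compose_machine :: "com \<Rightarrow> nat \<Rightarrow> machine \<Rightarrow> machine" where
  "compose_machine c r M = \<lparr>num_tapes = Suc r + num_tapes M, start_state = to_nat Init,
     accept_state = to_nat (Sim (accept_state M)),
     transitions = init_trans c r (num_tapes M) \<union> run_trans c r (num_tapes M) (start_state M) \<union>
                   sim_trans M r\<rparr>"

lemma to_nat_phase_eq [simp]: "to_nat (p :: phase) = to_nat q \<longleftrightarrow> p = q"
  using inj_to_nat by (auto simp: inj_def)

lemma finite_run_trans: "finite (run_trans c r k q0)"
proof -
  let ?Q = "insert Rewind (Run ` insert [] (stacks c []))"
  let ?n = "Suc (r + k)"
  have "run_trans c r k q0 \<subseteq> (\<lambda>(q, rs). case delta r q0 q rs of Some (q', p, s, m) \<Rightarrow>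
      (to_nat q, rs, to_nat q', rs[p := s], (replicate ?n Stay)[p := m])) ` (?Q \<times> words ?n)"
  proof
    fix t assume "t \<in> run_trans c r k q0"
    then obtain q rs q' p s m where t: "q \<in> ?Q" "rs \<in> words ?n" "delta r q0 q rs = Some (q', p, s, m)"
      "t = (to_nat q, rs, to_nat q', rs[p := s], (replicate ?n Stay)[p := m])"
      unfolding run_trans_def by blast
    show "t \<in> (\<lambda>(q, rs). case delta r q0 q rs of Some (q', p, s, m) \<Rightarrow>
      (to_nat q, rs, to_nat q', rs[p := s], (replicate ?n Stay)[p := m])) ` (?Q \<times> words ?n)"
      by (rule image_eqI[of _ _ "(q, rs)"]) (use t in simp_all)
  qed
  moreover have "finite (?Q \<times> words ?n)"
    using finite_words finite_stacks by auto
  ultimately show ?thesis using finite_surj by blast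
qed

lemma init_trans_iff:
  "(q, rs, q', ws, ms) \<in> init_trans c r k \<longleftrightarrow> (\<exists>a \<in> {0, 1, 2}. q = to_nat Init \<and>
     rs = a # replicate (r + k) 0 \<and> q' = to_nat (Run [c]) \<and>
     ws = a # replicate r 1 @ replicate k 0 \<and> ms = replicate (Suc (r + k)) Stay)"
  by (auto simp: init_trans_def)

lemma run_trans_iff:
  "(q, rs, q', ws, ms) \<in> run_trans c r k q0 \<longleftrightarrow> (\<exists>f f' p s m.
     f \<in> insert Rewind (Run ` insert [] (stacks c [])) \<and> q = to_nat f \<and> rs \<in> words (Suc (r + k)) \<and>
     delta r q0 f rs = Some (f', p, s, m) \<and> q' = to_nat f' \<and> ws = rs[p := s] \<and>
     ms = (replicate (Suc (r + k)) Stay)[p := m])"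
  unfolding run_trans_def by blast

lemma sim_trans_iff:
  "(q, rs, q', ws, ms) \<in> sim_trans M r \<longleftrightarrow> (\<exists>us f vs f' ws' ms'. us \<in> words (Suc r) \<and>
     (f, vs, f', ws', ms') \<in> transitions M \<and> q = to_nat (Sim f) \<and> rs = us @ vs \<and>
     q' = to_nat (Sim f') \<and> ws = us @ ws' \<and> ms = replicate (Suc r) Stay @ ms')"
  unfolding sim_trans_def image_iff by (auto simp: Bex_def)

lemma compose_simps [simp]:
  "num_tapes (compose_machine c r M) = Suc r + num_tapes M"
  "start_state (compose_machine c r M) = to_nat Init"
  "accept_state (compose_machine c r M) = to_nat (Sim (accept_state M))"
  by (simp_all add: compose_machine_def)

lemma transitions_compose:
  "t \<in> transitions (compose_machine c r M) \<longleftrightarrow> t \<in> init_trans c r (num_tapes M) \<or>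
     t \<in> run_trans c r (num_tapes M) (start_state M) \<or> t \<in> sim_trans M r"
  by (simp add: compose_machine_def)

lemma compose_wf:
  assumes "machine_wf M"
  shows "machine_wf (compose_machine c r M)"
proof -
  let ?n = "Suc (r + num_tapes M)"
  have M: "length rs = num_tapes M \<and> length ws = num_tapes M \<and> length ms = num_tapes M"
    if "(q, rs, q', ws, ms) \<in> transitions M" for q rs q' ws ms
    using assms that by (auto simp: machine_wf_def)
  have "finite (transitions M)" using assms by (simp add: machine_wf_def)
  then have "finite (transitions (compose_machine c r M))"
    using finite_run_trans finite_words by (simp add: compose_machine_def init_trans_def sim_trans_def)
  moreover have "length rs = ?n \<and> length ws = ?n \<and> length ms = ?n"
    if "(q, rs, q', ws, ms) \<in> transitions (compose_machine c r M)" for q rs q' ws ms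
    using that unfolding transitions_compose
  proof (elim disjE)
    assume "(q, rs, q', ws, ms) \<in> sim_trans M r"
    then show ?thesis unfolding sim_trans_iff words_def using M by fastforce
  qed (auto simp: init_trans_iff run_trans_iff words_def split: nat.split)
  ultimately show ?thesis unfolding machine_wf_def by auto
qed

text \<open>The three groups of transitions leave from disjoint states, as \<open>to_nat\<close> is
  injective on phases. In the simulation phase the work part of the scanned word has fixed length,
  so the word splits in only one way.\<close>

lemma compose_deterministic:
  assumes "deterministic M"
  shows "deterministic (compose_machine c r M)"
  unfolding deterministic_def
proof (intro allI impI; elim conjE)
  fix q rs a b
  assume a: "(q, rs, a) \<in> transitions (compose_machine c r M)"
    and b: "(q, rs, b) \<in> transitions (compose_machine c r M)"
  obtain q1 ws1 ms1 where a': "a = (q1, ws1, ms1)" by (cases a)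
  obtain q2 ws2 ms2 where b': "b = (q2, ws2, ms2)" by (cases b)
  have M: "x = y" if "(p, s, x) \<in> transitions M" "(p, s, y) \<in> transitions M" for p s x y
    using assms that unfolding deterministic_def by blast
  have u: "us = us' \<and> rs = rs'" if "us @ rs = us' @ rs'" "us \<in> words (Suc r)" "us' \<in> words (Suc r)"
    for us us' rs rs' using that by (auto simp: words_def)
  show "a = b"
    using a unfolding transitions_compose
  proof (elim disjE)
    assume a1: "(q, rs, a) \<in> init_trans c r (num_tapes M)"
    then have "(q, rs, b) \<in> init_trans c r (num_tapes M)"
      using b unfolding transitions_compose
      by (auto simp: a' b' init_trans_iff run_trans_iff sim_trans_iff)
    with a1 show ?thesis by (auto simp: a' b' init_trans_iff)
  next
    assume a1: "(q, rs, a) \<in> run_trans c r (num_tapes M) (start_state M)"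
    then have "(q, rs, b) \<in> run_trans c r (num_tapes M) (start_state M)"
      using b unfolding transitions_compose
      by (auto simp: a' b' init_trans_iff run_trans_iff sim_trans_iff)
    with a1 show ?thesis unfolding a' b' run_trans_iff by fastforce
  next
    assume a1: "(q, rs, a) \<in> sim_trans M r"
    then have b1: "(q, rs, b) \<in> sim_trans M r"
      using b unfolding transitions_compose
      by (auto simp: a' b' init_trans_iff run_trans_iff sim_trans_iff)
    obtain us f vs f' ws' ms' where 1: "us \<in> words (Suc r)" "(f, vs, f', ws', ms') \<in> transitions M"
      "q = to_nat (Sim f)" "rs = us @ vs" "a = (to_nat (Sim f'), us @ ws', replicate (Suc r) Stay @ ms')"
      using a1 unfolding a' sim_trans_iff by blast
    obtain vs' us' g g' ws'' ms'' where 2: "us' \<in> words (Suc r)" "(g, vs', g', ws'', ms'') \<in> transitions M"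
      "q = to_nat (Sim g)" "rs = us' @ vs'" "b = (to_nat (Sim g'), us' @ ws'', replicate (Suc r) Stay @ ms'')"
      using b1 unfolding b' sim_trans_iff by blast
    have "us = us' \<and> vs = vs'" using u 1 2 by metis
    moreover have "f = g" using 1 2 by simp
    ultimately show ?thesis using M 1 2 by fastforce
  qed
qed

lemma transitions_phase:
  "(to_nat f, rs, q', ws, ms) \<in> transitions (compose_machine c r M) \<longleftrightarrow>
     (case f of Init \<Rightarrow> (to_nat f, rs, q', ws, ms) \<in> init_trans c r (num_tapes M)
      | Sim q \<Rightarrow> (to_nat f, rs, q', ws, ms) \<in> sim_trans M r
      | _ \<Rightarrow> (to_nat f, rs, q', ws, ms) \<in> run_trans c r (num_tapes M) (start_state M))"
  unfolding transitions_compose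
  by (cases f) (auto simp: init_trans_iff run_trans_iff sim_trans_iff)

lemma step_iff:
  "step M (q, ts) C \<longleftrightarrow> (\<exists>q' ws ms. (q, map read_tape ts, q', ws, ms) \<in> transitions M \<and>
     C = (q', apply_ops ws ms ts))"
  by (cases C) (auto simp: step_def apply_ops_def)

lemma step_run:
  assumes "f \<in> insert Rewind (Run ` insert [] (stacks c []))"
    and "map read_tape ts \<in> words (Suc (r + num_tapes M))"
  shows "step (compose_machine c r M) (to_nat f, ts) C \<longleftrightarrow>
    (\<exists>f' p s m. delta r (start_state M) f (map read_tape ts) = Some (f', p, s, m) \<and>
       C = (to_nat f', ts[p := update_tape s m (ts ! p)]))"
proof -
  let ?rs = "map read_tape ts"
  have len: "Suc (r + num_tapes M) = length ts"
    using assms(2) by (simp add: words_def)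
  have "(to_nat f, ?rs, q', ws, ms) \<in> transitions (compose_machine c r M) \<longleftrightarrow>
      (to_nat f, ?rs, q', ws, ms) \<in> run_trans c r (num_tapes M) (start_state M)" for q' ws ms
    using assms(1) by (auto simp: transitions_phase)
  then show ?thesis
    using assms unfolding step_iff run_trans_iff len
    by (auto simp: apply_ops_single simp del: delta.simps)
qed

section \<open>Program states represented by tapes\<close>

definition mark :: "int \<Rightarrow> nat" where
  "mark i = (if i = 0 then 1 else 0)"

definition work_tapes :: "bool list \<Rightarrow> int \<Rightarrow> nat list \<Rightarrow> tape list" where
  "work_tapes w h cs = (cells w, h) # map (\<lambda>n. (mark, int n)) cs"

fun tapes :: "bool list \<Rightarrow> nat \<Rightarrow> astate \<Rightarrow> tape list" where
  "tapes w k (h, cs, out) =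
     work_tapes w h cs @ (cells out, int (length out)) # replicate k blank_tape"

lemma length_work_tapes [simp]: "length (work_tapes w h cs) = Suc (length cs)"
  by (simp add: work_tapes_def)

lemma read_tape_Pair [simp]: "read_tape (c, h) = c h"
  by (simp add: read_tape_def)

lemma read_blank [simp]: "read_tape blank_tape = 0"
  by (simp add: read_tape_def blank_tape_def)

lemma cells_words: "cells w h \<in> {0, 1, 2}"
  by (auto simp: cells_def code_def)

lemma read_work_tapes:
  "map read_tape (work_tapes w h cs) = cells w h # map (\<lambda>n. if n = 0 then 1 else 0) cs"
  by (simp add: work_tapes_def read_tape_def mark_def)

lemma read_tapes:
  "map read_tape (tapes w k (h, cs, out)) =
     cells w h # map (\<lambda>n. if n = 0 then 1 else 0) cs @ replicate (Suc k) 0"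
  by (simp add: read_work_tapes) (simp add: read_tape_def cells_def)

lemma read_work_tapes_words: "map read_tape (work_tapes w h cs) \<in> words (Suc (length cs))"
  unfolding read_work_tapes words_def using cells_words[of w h] by auto

lemma read_tapes_words:
  "map read_tape (tapes w k (h, cs, out)) \<in> words (Suc (length cs + Suc k))"
  unfolding read_tapes words_def using cells_words[of w h] by auto

lemma cells_snoc: "(cells out)(int (length out) := code b) = cells (out @ [b])"
proof
  fix i
  show "((cells out)(int (length out) := code b)) i = cells (out @ [b]) i"
    by (cases "i = int (length out)") (auto simp: cells_def nth_append)
qed

lemma mark_update: "i \<noteq> 0 \<Longrightarrow> mark(i := 0) = mark" "mark(0 := Suc 0) = mark"
  by (auto simp: mark_def)

text \<open>Counter tapes keep their contents, since the head writes back what it reads; only its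
  position changes. An action on a missing counter and a decrement of zero do nothing on either
  side.\<close>

lemma tapes_perform:
  assumes "act_op (length cs) a (map read_tape (tapes w k (h, cs, out))) = (p, s, m)"
  shows "(tapes w k (h, cs, out))[p := update_tape s m (tapes w k (h, cs, out) ! p)] =
         tapes w k (perform a (h, cs, out))"
proof (cases a)
  case (Out b)
  then show ?thesis
    using assms by (auto simp: list_update_append nth_append update_tape_def cells_snoc)
next
  case (Inc i)
  show ?thesis
  proof (cases "i < length cs")
    case True
    then have "(map (\<lambda>n. (mark, int n)) cs)[i := (mark, 1 + int (cs ! i))] =
        map (\<lambda>n. (mark, int n)) (cs[i := Suc (cs ! i)])"
      by (simp add: map_update)
    then show ?thesis
      using assms True Inc unfolding read_tapes
      by (cases "cs ! i = 0")
        (auto simp: work_tapes_def list_update_append nth_append update_tape_def mark_update add.commute[of _ 1])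
  next
    case False
    then show ?thesis
      using assms Inc unfolding read_tapes
      by (auto simp: work_tapes_def update_tape_def list_update_beyond)
  qed
next
  case (Dec i)
  show ?thesis
  proof (cases "i < length cs \<and> cs ! i \<noteq> 0")
    case True
    then have "(map (\<lambda>n. (mark, int n)) cs)[i := (mark, int (cs ! i) - 1)] =
        map (\<lambda>n. (mark, int n)) (cs[i := cs ! i - 1])"
      by (simp add: map_update of_nat_diff)
    then show ?thesis
      using assms True Dec unfolding read_tapes
      by (auto simp: work_tapes_def list_update_append nth_append update_tape_def mark_update)
  next
    case False
    then have "cs[i := cs ! i - 1] = cs"
      by (cases "i < length cs") (simp_all add: list_update_beyond list_update_same_conv)
    then show ?thesis
      using assms Dec False unfolding read_tapes
      by (cases "i < length cs") (auto simp: work_tapes_def update_tape_def nth_append)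
  qed
qed (use assms read_tapes in \<open>auto simp: work_tapes_def update_tape_def\<close>)

lemma sym_holds_tapes:
  "sym_holds (length cs) b (map read_tape (tapes w k (h, cs, out))) \<longleftrightarrow> holds w b (h, cs, out)"
  unfolding read_tapes by (cases b) (auto simp: nth_append)

lemma tapes_idle:
  "(tapes w k s)[0 := update_tape (map read_tape (tapes w k s) ! 0) Stay (tapes w k s ! 0)] = tapes w k s"
  by (cases s) (simp add: work_tapes_def update_tape_def)

lemma step_astep:
  assumes K: "K \<in> stacks c []" and st: "astep w (K, h, cs, out) = Some (K', s')"
    and k: "num_tapes M = Suc k"
  shows "step (compose_machine c (length cs) M) (to_nat (Run K), tapes w k (h, cs, out)) C \<longleftrightarrow>
    C = (to_nat (Run K'), tapes w k s')"
proof -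
  define ts where "ts = tapes w k (h, cs, out)"
  have eq: "step (compose_machine c (length cs) M) (to_nat (Run K), ts) C \<longleftrightarrow>
    (\<exists>f' p u m. delta (length cs) (start_state M) (Run K) (map read_tape ts) = Some (f', p, u, m) \<and>
       C = (to_nat f', ts[p := update_tape u m (ts ! p)]))"
    using K read_tapes_words[of w k h cs out]
    by (intro step_run) (auto simp: k ts_def simp del: tapes.simps)
  have holds: "sym_holds (length cs) b (map read_tape ts) = holds w b (h, cs, out)" for b
    unfolding ts_def by (rule sym_holds_tapes)
  define x where "x = map read_tape ts ! 0"
  have idle: "ts[0 := update_tape x Stay (ts ! 0)] = ts"
    unfolding ts_def x_def by (rule tapes_idle)
  obtain c0 K0 where K0: "K = c0 # K0" using st by (cases K) auto
  show ?thesis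
  proof (cases "\<exists>a. c0 = Do a")
    case True
    then obtain a where Do: "c0 = Do a" by blast
    obtain p u m where act: "act_op (length cs) a (map read_tape ts) = (p, u, m)"
      by (metis prod_cases3)
    have "ts[p := update_tape u m (ts ! p)] = tapes w k (perform a (h, cs, out))"
      using act unfolding ts_def by (rule tapes_perform)
    then show ?thesis
      using st act unfolding ts_def[symmetric] eq unfolding K0 Do by auto
  next
    case False
    then show ?thesis
      using st unfolding ts_def[symmetric] eq unfolding K0
      by (cases c0) (auto simp: x_def[symmetric] idle holds ts_def[symmetric] simp del: tapes.simps)
  qed
qed

lemma no_step_Fail:
  assumes "K \<in> stacks c []" "astep w (K, h, cs, out) = None" "K \<noteq> []" "num_tapes M = Suc k"
  shows "\<not> step (compose_machine c (length cs) M) (to_nat (Run K), tapes w k (h, cs, out)) C"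
proof -
  let ?ts = "tapes w k (h, cs, out)"
  have eq: "step (compose_machine c (length cs) M) (to_nat (Run K), ?ts) C \<longleftrightarrow>
    (\<exists>f' p u m. delta (length cs) (start_state M) (Run K) (map read_tape ?ts) = Some (f', p, u, m) \<and>
       C = (to_nat f', ?ts[p := update_tape u m (?ts ! p)]))"
    using assms read_tapes_words[of w k h cs out]
    by (intro step_run) (auto simp del: tapes.simps)
  obtain c0 K0 where K0: "K = c0 # K0" using assms by (cases K) auto
  show ?thesis using assms(2) unfolding eq unfolding K0 by (cases c0) auto
qed

lemma length_perform:
  "length (fst (snd (perform a s))) = length (fst (snd s))"
  "length (snd (snd (perform a s))) \<le> Suc (length (snd (snd s)))"
  by (cases s; cases a; simp)+

text \<open>
  Runs whose steps are forced. Along such a prefix nondeterminism plays no role, so the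
  reduction serves P and NP alike.
\<close>

inductive chain :: "machine \<Rightarrow> nat \<Rightarrow> config \<Rightarrow> config \<Rightarrow> bool" for M where
  chain_0: "chain M 0 C C"
| chain_Suc: "fst C \<noteq> accept_state M \<Longrightarrow> (\<And>E. step M C E \<longleftrightarrow> E = D) \<Longrightarrow> chain M t D F \<Longrightarrow>
    chain M (Suc t) C F"

lemma chain_trans: "chain M s C D \<Longrightarrow> chain M t D E \<Longrightarrow> chain M (s + t) C E"
  by (induction rule: chain.induct) (auto intro: chain_Suc)

lemma chain_one: "fst C \<noteq> accept_state M \<Longrightarrow> (\<And>E. step M C E \<longleftrightarrow> E = D) \<Longrightarrow> chain M 1 C D"
  using chain_Suc[OF _ _ chain_0] by simp

lemma chain_rtranclp: "chain M t C D \<Longrightarrow> (step M)\<^sup>*\<^sup>* C D"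
  by (induction rule: chain.induct) (auto intro: converse_rtranclp_into_rtranclp)

text \<open>Forced steps leave no alternative: a computation from \<open>C\<close> is either still
  on the chain, hence not accepting, or has passed through \<open>D\<close>. This controls all
  branches of a nondeterministic machine at once.\<close>

lemma chain_relpowp:
  assumes "chain M t C D" "(step M ^^ k) C E"
  shows "(k < t \<and> fst E \<noteq> accept_state M) \<or> (\<exists>j. k = t + j \<and> (step M ^^ j) D E)"
  using assms
proof (induction arbitrary: k rule: chain.induct)
  case (chain_Suc C D t F)
  show ?case
  proof (cases k)
    case (Suc k')
    then have "(step M ^^ k') D E"
      using chain_Suc.prems chain_Suc.hyps(2) by (metis relpowp_Suc_D2)
    then show ?thesis using chain_Suc.IH Suc by fastforce
  qed (use chain_Suc in auto)
qed auto

lemma chain_reaches: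
  assumes "reaches w t a b" "fst a \<in> insert [] (stacks c [])" "length (fst (snd (snd a))) = r"
    and k: "num_tapes M = Suc k"
  shows "chain (compose_machine c r M) t (to_nat (Run (fst a)), tapes w k (snd a))
           (to_nat (Run (fst b)), tapes w k (snd b)) \<and>
         fst b \<in> insert [] (stacks c []) \<and> length (fst (snd (snd b))) = r \<and>
         length (snd (snd (snd b))) \<le> length (snd (snd (snd a))) + t"
  using assms(1-3)
proof (induction rule: reaches.induct)
  case (reaches_Suc a b t e)
  obtain K h cs out where a: "a = (K, h, cs, out)" by (cases a) auto
  obtain K' s' where b: "b = (K', s')" by (cases b)
  have ne: "K \<noteq> []" and K: "K \<in> stacks c []" using reaches_Suc.hyps reaches_Suc.prems a by auto
  obtain x L where x: "K = x # L" using ne by (cases K) auto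
  have r: "length cs = r" using reaches_Suc.prems(2) a by simp
  have st: "astep w (x # L, h, cs, out) = Some (K', s')" using reaches_Suc.hyps(1) a b x by simp
  have "s' = (h, cs, out) \<or> (\<exists>a. s' = perform a (h, cs, out))"
    using st by (cases x) auto
  then have s': "length (fst (snd s')) = r \<and> length (snd (snd s')) \<le> Suc (length out)"
    using length_perform[of _ "(h, cs, out)"] r by auto
  have "K' \<in> insert [] (stacks c [])" using stacks_closed[OF st] K x by blast
  then have IH: "chain (compose_machine c r M) t (to_nat (Run K'), tapes w k s')
           (to_nat (Run (fst e)), tapes w k (snd e)) \<and>
         fst e \<in> insert [] (stacks c []) \<and> length (fst (snd (snd e))) = r \<and>
         length (snd (snd (snd e))) \<le> length (snd (snd s')) + t"
    using reaches_Suc.IH s' b by simp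
  have "chain (compose_machine c r M) (Suc t) (to_nat (Run K), tapes w k (h, cs, out))
           (to_nat (Run (fst e)), tapes w k (snd e))"
  proof (rule chain_Suc)
    show "step (compose_machine c r M) (to_nat (Run K), tapes w k (h, cs, out)) E \<longleftrightarrow>
        E = (to_nat (Run K'), tapes w k s')" for E
      using step_astep[OF K st[folded x] k] r by simp
  qed (use IH in simp_all)
  then show ?case using IH s' a by simp
qed (auto intro: chain_0)

lemma chain_init:
  assumes "num_tapes M = Suc k"
  shows "chain (compose_machine c r M) 1 (init_config (compose_machine c r M) w)
    (to_nat (Run [c]), tapes w k (0, replicate r 0, []))"
proof (rule chain_one)
  fix E
  let ?ts = "(cells w, 0) # replicate (r + Suc k) blank_tape"
  have init: "init_config (compose_machine c r M) w = (to_nat Init, ?ts)"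
    using assms by (simp add: init_config_def input_tape_cells)
  have rs: "map read_tape ?ts = cells w 0 # replicate (r + Suc k) 0"
    by simp
  have blank: "update_tape 1 Stay blank_tape = (mark, 0)" "update_tape 0 Stay blank_tape = blank_tape"
    "(cells [], 0) = blank_tape"
    by (auto simp: update_tape_def blank_tape_def mark_def cells_def)
  have idle: "apply_ops (replicate n s) (replicate n Stay) (replicate n t) =
      replicate n (update_tape s Stay t)" for n s t
    by (simp add: apply_ops_def zip_replicate)
  have "apply_ops (cells w 0 # replicate r 1 @ replicate (Suc k) 0) (replicate (Suc (r + Suc k)) Stay) ?ts =
      update_tape (cells w 0) Stay (cells w, 0) # replicate r (mark, 0) @ replicate (Suc k) blank_tape"
    using apply_ops_append[of "replicate r 1" "replicate r blank_tape" "replicate r Stay"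
        "replicate (Suc k) 0" "replicate (Suc k) Stay" "replicate (Suc k) blank_tape"]
    by (simp only: idle length_replicate replicate_add[symmetric] blank) (simp add: apply_ops_def)
  also have "\<dots> = tapes w k (0, replicate r 0, [])"
    by (simp add: work_tapes_def blank update_tape_def)
  finally have ops: "apply_ops (cells w 0 # replicate r 1 @ replicate (Suc k) 0)
      (replicate (Suc (r + Suc k)) Stay) ?ts = tapes w k (0, replicate r 0, [])" .
  show "step (compose_machine c r M) (init_config (compose_machine c r M) w) E \<longleftrightarrow>
      E = (to_nat (Run [c]), tapes w k (0, replicate r 0, []))"
    unfolding init step_iff rs transitions_phase
    using cells_words[of w 0] ops assms by (auto simp: init_trans_iff)
qed (simp add: init_config_def)

text \<open>With the head at \<open>int n - 1\<close> the induction ends on the blank cell -1, and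
  one last step to cell 0 accounts for \<open>Suc n\<close>.\<close>

lemma chain_rewind:
  assumes k: "num_tapes M = Suc k" and R: "map read_tape R \<in> words (Suc r)"
    and "n \<le> length out"
  shows "chain (compose_machine c r M) (Suc n) (to_nat Rewind, R @ (cells out, int n - 1) # replicate k blank_tape)
    (to_nat (Sim (start_state M)), R @ (cells out, 0) # replicate k blank_tape)"
  using assms(3)
proof (induction n)
  case 0
  let ?ts = "R @ (cells out, - 1) # replicate k blank_tape"
  have R1: "length R = Suc r" using R by (auto simp: words_def)
  have rs: "map read_tape ?ts = map read_tape R @ replicate (Suc k) 0"
    by (simp add: cells_def)
  have "map read_tape ?ts \<in> words (Suc (r + num_tapes M))"
    using R unfolding rs by (auto simp: words_def k)
  moreover have "(map read_tape ?ts) ! Suc r = 0" using R1 by (simp add: nth_append cells_def)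
  moreover have "?ts[Suc r := update_tape 0 Move_Right (?ts ! Suc r)] = R @ (cells out, 0) # replicate k blank_tape"
    using R1 by (auto simp: list_update_append nth_append update_tape_def cells_def fun_eq_iff)
  ultimately show ?case
    using step_run[of Rewind c ?ts r M] by (intro chain_one[simplified]) auto
next
  case (Suc n)
  let ?ts = "R @ (cells out, int n) # replicate k blank_tape"
  let ?s = "cells out (int n)"
  have R1: "length R = Suc r" using R by (auto simp: words_def)
  have rs: "map read_tape ?ts = map read_tape R @ ?s # replicate k 0"
    by simp
  have "map read_tape ?ts \<in> words (Suc (r + num_tapes M))"
    using R cells_words[of out "int n"] unfolding rs by (auto simp: words_def k)
  moreover have "(map read_tape ?ts) ! Suc r = ?s" using R1 by (simp add: rs nth_append)
  moreover have "?s \<noteq> 0" using Suc.prems by (auto simp: cells_def code_def)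
  moreover have "?ts[Suc r := update_tape ?s Move_Left (?ts ! Suc r)] =
      R @ (cells out, int n - 1) # replicate k blank_tape"
    using R1 by (auto simp: list_update_append nth_append update_tape_def)
  ultimately have "step (compose_machine c r M) (to_nat Rewind, ?ts) E \<longleftrightarrow>
      E = (to_nat Rewind, R @ (cells out, int n - 1) # replicate k blank_tape)" for E
    using step_run[of Rewind c ?ts r M] by auto
  then have "chain (compose_machine c r M) (Suc (Suc n)) (to_nat Rewind, ?ts)
      (to_nat (Sim (start_state M)), R @ (cells out, 0) # replicate k blank_tape)"
    by (rule chain_Suc[rotated]) (use Suc in auto)
  then show ?case by simp
qed

section \<open>Simulation of the given machine\<close>

lemma step_Sim:
  assumes wf: "machine_wf M" and R: "map read_tape R \<in> words (Suc r)" and ts: "length ts = num_tapes M"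
  shows "step (compose_machine c r M) (to_nat (Sim q), R @ ts) C \<longleftrightarrow>
    (\<exists>q' ts'. step M (q, ts) (q', ts') \<and> C = (to_nat (Sim q'), R @ ts'))"
proof -
  have R1: "length R = Suc r" using R by (auto simp: words_def)
  have M: "length ws = num_tapes M \<and> length ms = num_tapes M"
    if "(q, rs, q', ws, ms) \<in> transitions M" for q rs q' ws ms
    using wf that by (auto simp: machine_wf_def)
  have tr: "(to_nat (Sim q), map read_tape R @ map read_tape ts, q', ws, ms) \<in> sim_trans M r \<longleftrightarrow>
    (\<exists>f ws' ms'. (q, map read_tape ts, f, ws', ms') \<in> transitions M \<and> q' = to_nat (Sim f) \<and>
       ws = map read_tape R @ ws' \<and> ms = replicate (Suc r) Stay @ ms')" for q' ws ms
  proof -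
    have "us = map read_tape R \<and> vs = map read_tape ts"
      if "map read_tape R @ map read_tape ts = us @ vs" "us \<in> words (Suc r)" for us vs
      using that R1 by (auto simp: words_def append_eq_append_conv)
    then show ?thesis using R unfolding sim_trans_iff by (auto; metis)
  qed
  have op: "apply_ops (map read_tape R @ ws) (replicate (Suc r) Stay @ ms) (R @ ts) = R @ apply_ops ws ms ts"
    if "(q, map read_tape ts, q', ws, ms) \<in> transitions M" for q' ws ms
    using M[OF that] ts R1 by (simp add: apply_ops_append apply_ops_stay del: replicate_Suc)
  have "step (compose_machine c r M) (to_nat (Sim q), R @ ts) (to_nat (Sim q'), R @ apply_ops ws ms ts)"
    if "(q, map read_tape ts, q', ws, ms) \<in> transitions M" for q' ws ms
    unfolding step_iff transitions_phase map_append phase.case tr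
    using that op[OF that] by (metis (no_types, lifting))
  moreover have "\<exists>q' ws ms. (q, map read_tape ts, q', ws, ms) \<in> transitions M \<and>
      C = (to_nat (Sim q'), R @ apply_ops ws ms ts)"
    if "step (compose_machine c r M) (to_nat (Sim q), R @ ts) C"
    using that op unfolding step_iff transitions_phase map_append phase.case tr by fastforce
  ultimately show ?thesis by (auto simp: step_iff)
qed

lemma step_length:
  assumes "machine_wf M" "length (snd C) = num_tapes M" "step M C D"
  shows "length (snd D) = num_tapes M"
  using assms by (cases C) (auto simp: step_iff machine_wf_def length_apply_ops)

lemma relpowp_Sim:
  assumes wf: "machine_wf M" and R: "map read_tape R \<in> words (Suc r)"
    and "(step (compose_machine c r M) ^^ j) (to_nat (Sim q), R @ ts) C" "length ts = num_tapes M"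
  shows "\<exists>q' ts'. (step M ^^ j) (q, ts) (q', ts') \<and> C = (to_nat (Sim q'), R @ ts')"
  using assms(3,4)
proof (induction j arbitrary: q ts)
  case (Suc j)
  then obtain D where D: "step (compose_machine c r M) (to_nat (Sim q), R @ ts) D"
    "(step (compose_machine c r M) ^^ j) D C" by (metis relpowp_Suc_D2)
  then obtain q1 ts1 where 1: "step M (q, ts) (q1, ts1)" "D = (to_nat (Sim q1), R @ ts1)"
    using step_Sim[OF wf R Suc.prems(2)] by blast
  have "length ts1 = num_tapes M" using step_length[OF wf _ 1(1)] Suc.prems(2) by simp
  then obtain q' ts' where "(step M ^^ j) (q1, ts1) (q', ts')" "C = (to_nat (Sim q'), R @ ts')"
    using Suc.IH D(2) 1(2) by blast
  then show ?case using 1(1) by (metis relpowp_Suc_I2)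
qed auto

lemma rtranclp_Sim:
  assumes wf: "machine_wf M" and R: "map read_tape R \<in> words (Suc r)"
    and "(step M)\<^sup>*\<^sup>* C D" "length (snd C) = num_tapes M"
  shows "(step (compose_machine c r M))\<^sup>*\<^sup>* (to_nat (Sim (fst C)), R @ snd C) (to_nat (Sim (fst D)), R @ snd D)"
  using assms(3,4)
proof (induction rule: converse_rtranclp_induct)
  case (step C E)
  have "step (compose_machine c r M) (to_nat (Sim (fst C)), R @ snd C) (to_nat (Sim (fst E)), R @ snd E)"
    using step_Sim[OF wf R step.prems] step.hyps(1) by (metis prod.collapse)
  then show ?case
    using step.IH step_length[OF wf step.prems step.hyps(1)]
    by (meson converse_rtranclp_into_rtranclp)
qed auto

lemma poly_nat_mono: "m \<le> n \<Longrightarrow> poly (p :: nat poly) m \<le> poly p n"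
  by (induction p) (auto intro!: add_mono mult_mono)

definition computes :: "com \<Rightarrow> nat \<Rightarrow> nat \<Rightarrow> bool list \<Rightarrow> bool list option \<Rightarrow> bool" where
  "computes c r T w res \<longleftrightarrow> (\<exists>t K s. t \<le> T \<and> reaches w t ([c], 0, replicate r 0, []) (K, s) \<and>
     astep w (K, s) = None \<and> res = (if K = [] then Some (snd (snd s)) else None))"

lemma compose_computes:
  assumes wf: "machine_wf M" and comp: "computes c r T w res"
    and bound: "\<And>v k C. (step M ^^ k) (init_config M v) C \<Longrightarrow> k \<le> poly p (length v)"
  shows "(accepts (compose_machine c r M) w \<longleftrightarrow> (\<exists>v. res = Some v \<and> accepts M v)) \<and>
    (\<forall>k C. (step (compose_machine c r M) ^^ k) (init_config (compose_machine c r M) w) C \<longrightarrow>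
       k \<le> 3 + 2 * T + poly p T)"
proof -
  let ?C = "compose_machine c r M"
  obtain k where k: "num_tapes M = Suc k"
    using wf unfolding machine_wf_def by (metis One_nat_def Suc_le_D)
  obtain t K h cs out where t: "t \<le> T" "reaches w t ([c], 0, replicate r 0, []) (K, h, cs, out)"
    and halt: "astep w (K, h, cs, out) = None" and res: "res = (if K = [] then Some out else None)"
    using comp unfolding computes_def by fastforce
  let ?D = "(to_nat (Run K), tapes w k (h, cs, out))"
  note ch = chain_reaches[OF t(2) _ _ k, of c r]
  have K: "K \<in> insert [] (stacks c [])" and cs: "length cs = r" and out: "length out \<le> t"
    using ch stacks_top[of c "[]"] by auto
  have run: "chain ?C (1 + t) (init_config ?C w) ?D"
    using chain_trans[OF chain_init[OF k]] ch stacks_top[of c "[]"] by (auto simp del: tapes.simps)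
  show ?thesis
  proof (cases "K = []")
    case False
    then have stuck: "\<not> step ?C ?D E" for E
      using no_step_Fail[OF _ halt False k] K cs by auto
    have 1: "j = 0 \<and> E = ?D" if "(step ?C ^^ j) ?D E" for j E
      using that stuck by (metis relpowp_E2)
    have 2: "j \<le> 1 + t \<and> fst E \<noteq> accept_state ?C" if "(step ?C ^^ j) (init_config ?C w) E" for j E
      using chain_relpowp[OF run that] 1 by fastforce
    have "\<not> accepts ?C w" unfolding accepts_def using 2 by (metis rtranclp_imp_relpowp)
    then show ?thesis using 2 False t(1) res by fastforce
  next
    case True
    let ?R = "work_tapes w h cs"
    let ?W = "(to_nat Rewind, ?R @ (cells out, int (length out) - 1) # replicate k blank_tape)"
    let ?S = "(to_nat (Sim (start_state M)), ?R @ (cells out, 0) # replicate k blank_tape)"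
    have R: "map read_tape ?R \<in> words (Suc r)" using read_work_tapes_words cs by blast
    have rt: "map read_tape (tapes w k (h, cs, out)) \<in> words (Suc (r + num_tapes M))"
      using read_tapes_words cs k by metis
    have z: "map read_tape (tapes w k (h, cs, out)) ! Suc r = 0"
      using cs by (simp add: nth_append cells_def)
    have upd: "(tapes w k (h, cs, out))[Suc r := update_tape 0 Move_Left (tapes w k (h, cs, out) ! Suc r)] =
        snd ?W"
      using cs by (auto simp: list_update_append nth_append update_tape_def cells_def fun_eq_iff)
    have "step ?C ?D E \<longleftrightarrow> E = ?W" for E
      unfolding True using step_run[OF _ rt, of "Run []" c E] upd z by (simp del: tapes.simps)
    then have "chain ?C 1 ?D ?W" using True by (intro chain_one) auto
    moreover have "chain ?C (Suc (length out)) ?W ?S"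
      using chain_rewind[OF k R, of "length out" out c] by simp
    ultimately have pre: "chain ?C (1 + t + (1 + Suc (length out))) (init_config ?C w) ?S"
      using chain_trans run by blast
    have ini: "init_config M out = (start_state M, (cells out, 0) # replicate k blank_tape)"
      by (simp add: init_config_def k input_tape_cells)
    have sim: "\<exists>q' ts'. (step M ^^ j) (init_config M out) (q', ts') \<and> E = (to_nat (Sim q'), ?R @ ts')"
      if "(step ?C ^^ j) ?S E" for j E
      using relpowp_Sim[OF wf R that] unfolding ini by (simp add: k)
    have le: "poly p (length out) \<le> poly p T" using out t(1) by (intro poly_nat_mono) simp
    \<comment> \<open>One step sets the marks, \<open>t\<close> steps run the program, one enters
      \<open>Rewind\<close>, and \<open>length out + 1\<close> steps rewind, where
      \<open>length out \<le> t\<close>.\<close>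
    have "n \<le> 3 + 2 * T + poly p T" if "(step ?C ^^ n) (init_config ?C w) E" for n E
      using chain_relpowp[OF pre that]
    proof (elim disjE exE conjE)
      fix j assume j: "n = 1 + t + (1 + Suc (length out)) + j" "(step ?C ^^ j) ?S E"
      then have "j \<le> poly p (length out)" using sim bound by blast
      then show ?thesis using j(1) out t(1) le by linarith
    qed (use out t(1) in simp)
    moreover have "accepts ?C w \<longleftrightarrow> accepts M out"
    proof
      assume "accepts ?C w"
      then obtain n E where n: "(step ?C ^^ n) (init_config ?C w) E" "fst E = accept_state ?C"
        unfolding accepts_def by (metis rtranclp_imp_relpowp)
      then obtain j where "(step ?C ^^ j) ?S E" using chain_relpowp[OF pre n(1)] by auto
      then obtain q' ts' where "(step M ^^ j) (init_config M out) (q', ts')" "E = (to_nat (Sim q'), ?R @ ts')"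
        using sim by blast
      then show "accepts M out" using n(2) unfolding accepts_def
        by (auto intro!: exI[of _ ts'] dest: relpowp_imp_rtranclp)
    next
      assume "accepts M out"
      then obtain E where E: "(step M)\<^sup>*\<^sup>* (init_config M out) E" "fst E = accept_state M"
        unfolding accepts_def by blast
      have "(step ?C)\<^sup>*\<^sup>* ?S (to_nat (Sim (fst E)), ?R @ snd E)"
        using rtranclp_Sim[OF wf R E(1)] unfolding ini by (simp add: k)
      then have "(step ?C)\<^sup>*\<^sup>* (init_config ?C w) (to_nat (Sim (fst E)), ?R @ snd E)"
        using chain_rtranclp[OF pre] by (rule rtranclp_trans[rotated])
      then show "accepts ?C w" unfolding accepts_def using E(2) by (metis fst_conv compose_simps(3))
    qed
    ultimately show ?thesis using True res by auto
  qed
qed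

text \<open>The value \<open>None\<close> rejects directly, so no fixed negative instance of
  \<open>B\<close> has to be produced for malformed inputs.\<close>

theorem many_one_reduction:
  fixes f :: "bool list \<Rightarrow> bool list option"
  assumes comp: "\<And>w. computes c r (poly q (length w)) w (f w)"
    and red: "\<And>w. w \<in> A \<longleftrightarrow> (\<exists>v. f w = Some v \<and> v \<in> B)"
  shows "B \<in> class_P \<Longrightarrow> A \<in> class_P" and "B \<in> class_NP \<Longrightarrow> A \<in> class_NP"
proof -
  have main: "machine_wf (compose_machine c r M) \<and> poly_time (compose_machine c r M) \<and>
      (\<forall>w. w \<in> A \<longleftrightarrow> accepts (compose_machine c r M) w)"
    if M: "machine_wf M" "poly_time M" "\<forall>w. w \<in> B \<longleftrightarrow> accepts M w" for M
  proof -
    obtain p where p: "\<And>v k C. (step M ^^ k) (init_config M v) C \<Longrightarrow> k \<le> poly p (length v)"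
      using M(2) unfolding poly_time_def by blast
    note * = compose_computes[OF M(1) comp p]
    \<comment> \<open>The output is no longer than the run that writes it, so the time bound
      \<open>p\<close> is evaluated at \<open>q\<close>.\<close>
    have "poly_time (compose_machine c r M)" unfolding poly_time_def
      using * by (intro exI[of _ "[:3:] + smult 2 q + pcompose p q"]) (simp add: poly_pcompose)
    then show ?thesis using * M(3) red compose_wf[OF M(1)] by simp
  qed
  show "A \<in> class_P" if "B \<in> class_P"
    using that main compose_deterministic unfolding class_P_def by blast
  show "A \<in> class_NP" if "B \<in> class_NP"
    using that main unfolding class_NP_def by blast
qed

section \<open>Verification of counter programs\<close>

text \<open>
  The output is never read, so a halting run cannot visit two configurations that agree up to the
  output. Hence polynomial bounds on the counters already bound the running time.
\<close>

fun control :: "aconf \<Rightarrow> com list \<times> int \<times> nat list" where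
  "control (K, h, cs, out) = (K, h, cs)"

lemma holds_control: "holds w b (h, cs, out) = holds w b (h, cs, out')"
  by (cases b) auto

lemma astep_control:
  assumes "control a = control b"
  shows "map_option control (astep w a) = map_option control (astep w b)"
proof -
  obtain K h cs out out' where ab: "a = (K, h, cs, out)" "b = (K, h, cs, out')"
    using assms by (cases a; cases b) auto
  show ?thesis
  proof (cases K)
    case (Cons c L)
    have "control (L, perform x (h, cs, out)) = control (L, perform x (h, cs, out'))" for x
      by (cases x) auto
    then show ?thesis unfolding ab Cons using holds_control[of w _ h cs out out']
      by (cases c) auto
  qed (simp add: ab)
qed

text \<open>Tests see only the control part, so the two runs proceed in lockstep. Hence the control
  determines the number of steps left.\<close>

lemma reaches_control:
  assumes "reaches w t a c" "astep w c = None" "reaches w t' b d" "astep w d = None"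
    "control a = control b"
  shows "t = t'"
  using assms
proof (induction arbitrary: t' b rule: reaches.induct)
  case (reaches_0 a)
  then have "astep w b = None" using astep_control by (metis option.map_disc_iff)
  then show ?case using reaches_0.prems(2) by (auto elim: reaches.cases)
next
  case (reaches_Suc a a1 t c)
  then have "astep w b \<noteq> None" using astep_control by (metis option.map_disc_iff option.simps(3))
  then obtain b1 t1 where b1: "astep w b = Some b1" "reaches w t1 b1 d" "t' = Suc t1"
    using reaches_Suc.prems by (auto elim: reaches.cases)
  then have "control a1 = control b1"
    using astep_control[OF reaches_Suc.prems(4), of w] reaches_Suc.hyps(1) by simp
  then show ?case using reaches_Suc.IH reaches_Suc.prems b1 by blast
qed

fun safe :: "bool list \<Rightarrow> nat \<Rightarrow> act \<Rightarrow> astate \<Rightarrow> bool" where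
  "safe w b MvL (h, cs, out) \<longleftrightarrow> 0 \<le> h"
| "safe w b MvR (h, cs, out) \<longleftrightarrow> h < int (length w)"
| "safe w b (Inc i) (h, cs, out) \<longleftrightarrow> i < length cs \<longrightarrow> cs ! i < b"
| "safe w b _ s \<longleftrightarrow> True"

text \<open>
  The predicate \<open>P\<close> receives \<open>None\<close> if the run gets stuck. Bounds on the counters (by \<open>b\<close>)
  and on the head are checked only by the commands that could violate them.
\<close>

inductive wp :: "bool list \<Rightarrow> nat \<Rightarrow> (bool list option \<Rightarrow> bool) \<Rightarrow> com list \<Rightarrow> astate \<Rightarrow> bool"
  for w b P where
  wp_halt: "astep w (K, s) = None \<Longrightarrow> P (if K = [] then Some (snd (snd s)) else None) \<Longrightarrow> wp w b P K s"
| wp_step: "astep w (c # K, s) = Some (K', s') \<Longrightarrow> (\<And>a. c = Do a \<Longrightarrow> safe w b a s) \<Longrightarrow>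
    wp w b P K' s' \<Longrightarrow> wp w b P (c # K) s"

definition bounded_controls :: "com \<Rightarrow> nat \<Rightarrow> nat \<Rightarrow> bool list \<Rightarrow> (com list \<times> int \<times> nat list) set" where
  "bounded_controls c r b w = insert [] (stacks c []) \<times> {- 1..int (length w)} \<times>
     {cs. set cs \<subseteq> {..b} \<and> length cs = r}"

lemma card_bounded:
  "finite (bounded_controls c r b w)"
  "card (bounded_controls c r b w) = card (insert [] (stacks c [])) * ((length w + 2) * (b + 1) ^ r)"
  using finite_stacks[of c "[]"]
  by (auto simp: bounded_controls_def card_cartesian_product card_lists_length_eq nat_add_distrib
      intro!: finite_lists_length_eq)

lemma bounded_step:
  assumes "control (c # K, s) \<in> bounded_controls p r b w" "astep w (c # K, s) = Some (K', s')"
    "\<And>a. c = Do a \<Longrightarrow> safe w b a s"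
  shows "control (K', s') \<in> bounded_controls p r b w"
proof -
  obtain h cs out where s: "s = (h, cs, out)" by (cases s)
  have in_s: "c # K \<in> stacks p []" and b: "- 1 \<le> h" "h \<le> int (length w)" "set cs \<subseteq> {..b}" "length cs = r"
    using assms(1) by (auto simp: bounded_controls_def s)
  have K': "K' \<in> insert [] (stacks p [])" using stacks_closed[OF assms(2) in_s] .
  have upd: "set (cs[i := n]) \<subseteq> {..b}" if "n \<le> b" for i n
    using set_update_subset_insert[of cs i n] b(3) that by auto
  have nth: "cs ! i - 1 \<le> b" if "i < length cs" for i
    using b(3) nth_mem[OF that] by auto
  show ?thesis
  proof (cases c)
    case (Do a)
    have "K' = K" "s' = perform a s" using assms(2) Do by auto
    moreover have "control (K, perform a s) \<in> insert [] (stacks p []) \<times> {- 1..int (length w)} \<times>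
        {cs. set cs \<subseteq> {..b} \<and> length cs = r}" if "K \<in> insert [] (stacks p [])"
    proof (cases a)
      case (Inc i)
      then show ?thesis using that b upd[of "Suc (cs ! i)" i] assms(3)[OF Do] s
        by (cases "i < length cs") (auto simp: list_update_beyond)
    next
      case (Dec i)
      then show ?thesis using that b upd[of "cs ! i - 1" i] nth[of i] s
        by (cases "i < length cs") (auto simp: list_update_beyond)
    qed (use that b assms(3)[OF Do] s in auto)
    ultimately show ?thesis using K' unfolding bounded_controls_def by simp
  qed (use assms(2) K' b s in \<open>auto simp: bounded_controls_def split: if_splits\<close>)
qed

text \<open>\<open>S\<close> collects the controls visited, each with at most \<open>t\<close> steps
  left. A preceding control has \<open>Suc t\<close> steps left and therefore is new, so that the
  cardinality of \<open>S\<close> counts the steps.\<close>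

lemma wp_reaches:
  assumes "wp w b P K s" "control (K, s) \<in> bounded_controls c r b w"
  shows "\<exists>t K' s' S. reaches w t (K, s) (K', s') \<and> astep w (K', s') = None \<and>
    P (if K' = [] then Some (snd (snd s')) else None) \<and>
    S \<subseteq> bounded_controls c r b w \<and> card S = Suc t \<and>
    (\<forall>x \<in> S. \<exists>j a. j \<le> t \<and> control a = x \<and> reaches w j a (K', s'))"
  using assms
proof (induction rule: wp.induct)
  case (wp_halt K s)
  have "reaches w 0 (K, s) (K, s)" by (rule reaches_0)
  moreover have "{control (K, s)} \<subseteq> bounded_controls c r b w" "card {control (K, s)} = Suc 0"
    using wp_halt.prems by simp_all
  moreover have "\<forall>x \<in> {control (K, s)}. \<exists>j a. j \<le> 0 \<and> control a = x \<and> reaches w j a (K, s)"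
    using reaches_0 by blast
  ultimately show ?case using wp_halt.hyps
    by (rule_tac exI[of _ 0], rule_tac exI[of _ K], rule_tac exI[of _ s],
        rule_tac exI[of _ "{control (K, s)}"], intro conjI) assumption+
next
  case (wp_step c0 K s K1 s1)
  have "control (K1, s1) \<in> bounded_controls c r b w"
    by (rule bounded_step[OF wp_step.prems wp_step.hyps(1)]) (rule wp_step.hyps(2))
  note IH = wp_step.IH[OF this]
  obtain t K' s' S where *: "reaches w t (K1, s1) (K', s')" "astep w (K', s') = None"
    "P (if K' = [] then Some (snd (snd s')) else None)"
    "S \<subseteq> bounded_controls c r b w" "card S = Suc t"
    "\<forall>x \<in> S. \<exists>j a. j \<le> t \<and> control a = x \<and> reaches w j a (K', s')"
    using IH by (elim exE conjE) (rule that)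
  let ?a = "(c0 # K, s)"
  have r: "reaches w (Suc t) ?a (K', s')" using wp_step.hyps(1) *(1) by (rule reaches_Suc)
  have "control ?a \<notin> S"
  proof
    assume "control ?a \<in> S"
    from *(6)[rule_format, OF this] obtain j a where
      j: "j \<le> t" "control a = control ?a" "reaches w j a (K', s')" by (elim exE conjE)
    then show False using reaches_control[OF j(3) *(2) r *(2) j(2)] j(1) by simp
  qed
  then have "card (insert (control ?a) S) = Suc (Suc t)"
    using *(5) finite_subset[OF *(4) card_bounded(1)] by simp
  moreover have "\<forall>x \<in> insert (control ?a) S. \<exists>j a. j \<le> Suc t \<and> control a = x \<and> reaches w j a (K', s')"
  proof
    fix x assume "x \<in> insert (control ?a) S"
    then show "\<exists>j a. j \<le> Suc t \<and> control a = x \<and> reaches w j a (K', s')"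
    proof
      assume "x = control ?a"
      then show ?thesis using r by (intro exI[of _ "Suc t"] exI[of _ ?a]) simp
    next
      assume "x \<in> S"
      from *(6)[rule_format, OF this] show ?thesis by (elim exE conjE) (intro exI conjI le_SucI)
    qed
  qed
  moreover have "insert (control ?a) S \<subseteq> bounded_controls c r b w"
    using *(4) wp_step.prems by (rule_tac insert_subsetI)
  ultimately show ?case using r *(2,3)
    by (rule_tac exI[of _ "Suc t"], rule_tac exI[of _ K'], rule_tac exI[of _ s'],
        rule_tac exI[of _ "insert (control ?a) S"], intro conjI) assumption+
qed

text \<open>Counters range over 0 to \<open>Suc (length w)\<close> and the head over -1 to
  \<open>length w\<close>. Both are \<open>length w + 2\<close> possibilities, hence the factors
  \<open>[:2, 1:]\<close>.\<close>

lemma wp_computes: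
  assumes "wp w (Suc (length w)) ((=) (f w)) [c] (0, replicate r 0, [])"
  shows "computes c r (poly ([:card (insert [] (stacks c [])):] * ([:2, 1:] * [:2, 1:] ^ r)) (length w)) w (f w)"
proof -
  have "control ([c], 0, replicate r 0, []) \<in> bounded_controls c r (Suc (length w)) w"
    using stacks_top[of c "[]"] by (auto simp: bounded_controls_def)
  from wp_reaches[OF assms this] obtain t K s S where *: "reaches w t ([c], 0, replicate r 0, []) (K, s)"
    "astep w (K, s) = None" "f w = (if K = [] then Some (snd (snd s)) else None)"
    "S \<subseteq> bounded_controls c r (Suc (length w)) w" "card S = Suc t"
    by (elim exE conjE) (rule that)
  have "Suc t \<le> card (bounded_controls c r (Suc (length w)) w)"
    using *(4,5) card_mono card_bounded(1) by metis
  then have "t \<le> poly ([:card (insert [] (stacks c [])):] * ([:2, 1:] * [:2, 1:] ^ r)) (length w)"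
    by (simp add: card_bounded(2) algebra_simps del: card_insert_disjoint)
  then show ?thesis unfolding computes_def using *(1-3) by blast
qed

section \<open>Rules for symbolic execution\<close>

lemma wp_Nil [simp]: "wp w b P [] s \<longleftrightarrow> P (Some (snd (snd s)))"
  by (subst wp.simps) (simp del: split_paired_Ex)

lemma wp_Fail [simp]: "wp w b P (Fail # K) s \<longleftrightarrow> P None"
  by (subst wp.simps) (simp del: split_paired_Ex)

lemma wp_Skip [simp]: "wp w b P (Skip # K) s \<longleftrightarrow> wp w b P K s"
  by (subst wp.simps) (simp del: split_paired_Ex)

lemma wp_Seq [simp]: "wp w b P (Seq c d # K) s \<longleftrightarrow> wp w b P (c # d # K) s"
  by (subst wp.simps) (simp del: split_paired_Ex)

lemma wp_Do [simp]: "wp w b P (Do a # K) s \<longleftrightarrow> safe w b a s \<and> wp w b P K (perform a s)"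
  by (subst wp.simps) (auto simp del: split_paired_Ex)

lemma wp_Cond [simp]:
  "wp w b P (Cond t c d # K) s \<longleftrightarrow> wp w b P ((if holds w t s then c else d) # K) s"
  by (subst wp.simps) (auto simp del: split_paired_Ex)

text \<open>As a simplification rule this would unfold forever; each loop is unfolded once by
  \<open>subst\<close> within an induction.\<close>

lemma wp_While:
  "wp w b P (While t c # K) s \<longleftrightarrow> wp w b P (if holds w t s then c # While t c # K else K) s"
  by (subst wp.simps) (auto simp del: split_paired_Ex)

definition seqs :: "com list \<Rightarrow> com" where
  "seqs cs = foldr Seq cs Skip"

lemma wp_seqs [simp]:
  "wp w b P (seqs [] # K) s \<longleftrightarrow> wp w b P K s"
  "wp w b P (seqs (c # cs) # K) s \<longleftrightarrow> wp w b P (c # seqs cs # K) s"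
  by (simp_all add: seqs_def)

definition emit :: "bool list \<Rightarrow> com" where
  "emit bs = seqs (map (\<lambda>c. Do (Out c)) bs)"

lemma wp_emit [simp]: "wp w b P (emit bs # K) (h, cs, out) \<longleftrightarrow> wp w b P K (h, cs, out @ bs)"
  unfolding emit_def by (induction bs arbitrary: out) simp_all

text \<open>The head position at which the suffix \<open>u\<close> of the input \<open>w\<close> remains to be read.\<close>

definition pos :: "bool list \<Rightarrow> bool list \<Rightarrow> int" where
  "pos w u = int (length w) - int (length u)"

lemma pos_simps:
  assumes "suffix (c # u) w"
  shows "pos w (c # u) + 1 = pos w u" "pos w u - 1 = pos w (c # u)" "pos w (c # u) < int (length w)" "0 < pos w u"
  using suffix_length_le[OF assms] by (auto simp: pos_def)

lemma cells_pos:
  assumes "suffix u w"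
  shows "cells w (pos w u) = (case u of [] \<Rightarrow> 0 | c # _ \<Rightarrow> code c)"
proof -
  obtain v where w: "w = v @ u" using assms by (auto simp: suffix_def)
  then have "pos w u = int (length v)" by (simp add: pos_def)
  then show ?thesis by (auto simp: cells_def w nth_append split: list.split)
qed

lemma code_cases: "(code c = code d) = (c = d)" "(code c = Suc 0) = (\<not> c)" "(code c = 2) = c" "code c \<noteq> 0"
  "(code c = 1) = (\<not> c)"
  by (auto simp: code_def)

definition expect :: "bool \<Rightarrow> com" where
  "expect c = Cond (Inp [code c]) (Do MvR) Fail"

lemma wp_expect:
  "suffix u w \<Longrightarrow> wp w b P (expect c # K) (pos w u, cs, out) \<longleftrightarrow>
     (case u of [] \<Rightarrow> P None | d # u' \<Rightarrow> if c = d then wp w b P K (pos w u', cs, out) else P None)"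
  by (cases u) (auto simp: expect_def cells_pos code_cases pos_simps)

definition expects :: "bool list \<Rightarrow> com" where
  "expects bs = seqs (map expect bs)"

text \<open>All parsing rules below have this shape: one premise for any way to split the expected
  part off the input, one for the case that no split exists. Uniqueness of the split, from
  prefix-freeness, is what lets failures of later parts be passed upwards.\<close>

lemma wp_expects:
  assumes "suffix u w"
    "\<And>r. u = bs @ r \<Longrightarrow> suffix r w \<Longrightarrow> wp w b P K (pos w r, cs, out)"
    "\<nexists>r. u = bs @ r \<Longrightarrow> P None"
  shows "wp w b P (expects bs # K) (pos w u, cs, out)"
  using assms unfolding expects_def
proof (induction bs arbitrary: u)
  case (Cons c bs)
  have "wp w b P (seqs (map expect bs) # K) (pos w u', cs, out)" if "u = c # u'" for u'
    using Cons.prems that by (intro Cons.IH) (auto dest: suffix_ConsD)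
  then show ?case using Cons.prems by (auto simp: wp_expect split: list.split)
qed simp

definition copy :: com where
  "copy = Cond (Inp [1]) (seqs [Do (Out False), Do MvR]) (Cond (Inp [2]) (seqs [Do (Out True), Do MvR]) Fail)"

lemma wp_copy:
  "suffix u w \<Longrightarrow> wp w b P (copy # K) (pos w u, cs, out) \<longleftrightarrow>
     (case u of [] \<Rightarrow> P None | c # u' \<Rightarrow> wp w b P K (pos w u', cs, out @ [c]))"
  by (cases u; cases "hd u") (auto simp: copy_def cells_pos code_cases pos_simps)

definition bits :: "bool list \<Rightarrow> bool list" where
  "bits a = concat (map (\<lambda>c. [False, c]) a)"

lemma bits_simps [simp]: "bits [] = []" "bits (c # a) = False # c # bits a"
  by (simp_all add: bits_def)

text \<open>A character starting with \<open>False\<close> is a bit and one starting with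
  \<open>True\<close> a bracket, so the first bracket ends the numeral.\<close>

lemma bits_unique: "bits a @ True # r = bits a' @ True # r' \<longleftrightarrow> a = a' \<and> r = r'"
proof
  show "bits a @ True # r = bits a' @ True # r' \<Longrightarrow> a = a' \<and> r = r'"
  proof (induction a arbitrary: a')
    case Nil
    then show ?case by (cases a') auto
  next
    case (Cons c a)
    then show ?case by (cases a') auto
  qed
qed auto

lemma bits_hd: "True # x = bits a @ True # y \<longleftrightarrow> a = [] \<and> x = y"
  by (cases a) auto

definition copy_number :: com where
  "copy_number = seqs [While (Inp [1]) (seqs [copy, copy]), expects [True, True], emit [True, True]]"

text \<open>A character takes two input bits, so the induction removes two at a time; the case of a
  single bit is a truncated character.\<close>

lemma wp_number:
  assumes "suffix u w"
    "\<And>a r. u = bits a @ True # True # r \<Longrightarrow> suffix r w \<Longrightarrow>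
       wp w b P K (pos w r, cs, out @ bits a @ [True, True])"
    "\<nexists>a r. u = bits a @ True # True # r \<Longrightarrow> P None"
  shows "wp w b P (copy_number # K) (pos w u, cs, out)"
proof -
  have "wp w b P (While (Inp [1]) (seqs [copy, copy]) # seqs [expects [True, True], emit [True, True]] # K)
      (pos w u, cs, out)"
    using assms
  proof (induction u arbitrary: out rule: induct_list012)
    case 1
    then have "P None" by simp
    then show ?case using 1 by (subst wp_While) (auto simp: cells_pos intro!: wp_expects)
  next
    case (2 c)
    have "P None" using 2(3) by (auto simp: Cons_eq_append_conv bits_def)
    then show ?case using 2(1)
      by (subst wp_While) (auto simp: cells_pos code_cases wp_copy dest: suffix_ConsD intro!: wp_expects)
  next
    case (3 c d u)
    show ?case
    proof (cases c)
      case True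
      have "wp w b P (expects [True, True] # seqs [emit [True, True]] # K) (pos w (c # d # u), cs, out)"
        using 3(3) 3(4)[of "[]"] 3(5)
        by (intro wp_expects) (auto simp: True bits_hd)
      then show ?thesis using 3(3) True by (subst wp_While) (auto simp: cells_pos code_cases)
    next
      case False
      have "wp w b P (While (Inp [1]) (seqs [copy, copy]) # seqs [expects [True, True], emit [True, True]] # K)
          (pos w u, cs, out @ [False, d])"
      proof (rule 3(1))
        show "P None" if "\<nexists>a r. u = bits a @ True # True # r"
        proof (rule 3(5), rule notI, elim exE)
          fix a r assume "c # d # u = bits a @ True # True # r"
          then show False using that False by (cases a) auto
        qed
      qed (use 3(3) 3(4)[of "d # _"] False in \<open>auto dest: suffix_ConsD\<close>)
      then show ?thesis using 3(3) False
        by (subst wp_While) (auto simp: cells_pos code_cases wp_copy dest: suffix_ConsD)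
    qed
  qed
  then show ?thesis by (simp add: copy_number_def)
qed

definition move :: "nat \<Rightarrow> nat \<Rightarrow> bool list \<Rightarrow> com" where
  "move i l bs = While (Pos i) (seqs [Do (Dec i), Do (Inc l), emit bs])"

lemma wp_move:
  assumes "i \<noteq> l" "i < length cs" "l < length cs" "cs ! i + cs ! l \<le> b"
  shows "wp w b P (move i l bs # K) (h, cs, out) \<longleftrightarrow>
    wp w b P K (h, cs[i := 0, l := cs ! l + cs ! i], out @ concat (replicate (cs ! i) bs))"
  using assms
proof (induction "cs ! i" arbitrary: cs out)
  case 0
  then have "cs[i := 0, l := cs ! l + cs ! i] = cs" by (metis add.right_neutral list_update_id)
  then show ?case using 0(1)[symmetric] unfolding move_def by (subst wp_While) simp
next
  case (Suc n)
  let ?cs = "cs[i := n, l := Suc (cs ! l)]"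
  have *: "?cs ! i = n" "?cs ! l = Suc (cs ! l)" "length ?cs = length cs" using Suc.prems by simp_all
  have "wp w b P (move i l bs # K) (h, cs, out) \<longleftrightarrow> wp w b P (move i l bs # K) (h, ?cs, out @ bs)"
    unfolding move_def
    using Suc.prems Suc.hyps(2)[symmetric] by (subst wp_While) simp
  also have "\<dots> \<longleftrightarrow> wp w b P K (h, ?cs[i := 0, l := ?cs ! l + ?cs ! i], (out @ bs) @ concat (replicate (?cs ! i) bs))"
    by (rule Suc.hyps(1)) (use * Suc in auto)
  also have "?cs[i := 0, l := ?cs ! l + ?cs ! i] = cs[i := 0, l := cs ! l + cs ! i]"
    using * Suc.hyps(2) Suc.prems by (auto simp: list_eq_iff_nth_eq nth_list_update)
  finally show ?case using *(1) unfolding Suc.hyps(2)[symmetric] by simp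
qed

section \<open>The reduction as a counter program\<close>

definition serialize_list :: "tree list \<Rightarrow> bool list" where
  "serialize_list ts = concat (map serialize ts)"

lemma serialize_list_simps [simp]:
  "serialize_list [] = []" "serialize_list (t # ts) = serialize t @ serialize_list ts"
  "serialize_list (ts @ us) = serialize_list ts @ serialize_list us"
  by (simp_all add: serialize_list_def)

lemma serialize_Node: "serialize (Node ts) = [True, False] @ serialize_list ts @ [True, True]"
  by (simp add: serialize_list_def)

lemma serialize_list_Bit [simp]: "serialize_list (map Bit a) = bits a"
  by (induction a) simp_all

definition ones :: "nat \<Rightarrow> bool list" where
  "ones n = concat (replicate n [False, True])"

lemma ones_simps [simp]: "ones 0 = []" "ones (Suc n) = False # True # ones n"
  by (simp_all add: ones_def)

lemma ones_add: "ones (m + n) = ones m @ ones n"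
  by (induction m) simp_all

lemma ones_double: "concat (replicate n [False, True, False, True]) = ones (2 * n)"
  by (induction n) simp_all

lemma serialize_unary: "serialize (enc_unary n) = [True, False] @ ones n @ [True, True]"
proof -
  have "serialize_list (replicate n (Bit True)) = ones n" by (induction n) simp_all
  then show ?thesis by (simp only: enc_unary_def serialize_Node)
qed

text \<open>Reading a counter destroys it, so its value passes through the scratch counter and back.
  The emitted block is two unary digits, which doubles the value.\<close>

definition say :: "nat \<Rightarrow> com" where
  "say i = seqs [move i 0 [False, True, False, True], move 0 i []]"

lemma wp_say:
  assumes "0 < i" "i < length cs" "cs ! 0 = 0" "cs ! i \<le> b"
  shows "wp w b P (say i # K) (h, cs, out) \<longleftrightarrow> wp w b P K (h, cs, out @ ones (2 * cs ! i))"
proof -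
  let ?cs = "cs[i := 0, 0 := cs ! i]"
  have "0 < length cs" using assms by linarith
  then have 0: "0 < length cs" "?cs ! 0 = cs ! i" "?cs ! i = 0" using assms by (auto simp: nth_list_update)
  have "wp w b P (say i # K) (h, cs, out) \<longleftrightarrow>
      wp w b P (move i 0 [False, True, False, True] # seqs [move 0 i []] # K) (h, cs, out)"
    by (simp add: say_def)
  also have "\<dots> \<longleftrightarrow> wp w b P (move 0 i [] # seqs [] # K) (h, ?cs, out @ ones (2 * cs ! i))"
    using assms 0 by (subst wp_move) (simp_all add: ones_double)
  also have "\<dots> \<longleftrightarrow> wp w b P K (h, ?cs[0 := 0, i := ?cs ! i + ?cs ! 0], out @ ones (2 * cs ! i))"
    using assms 0 by (subst wp_move) simp_all
  also have "?cs[0 := 0, i := ?cs ! i + ?cs ! 0] = cs"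
  proof (rule nth_equalityI)
    fix n assume "n < length (?cs[0 := 0, i := ?cs ! i + ?cs ! 0])"
    then show "?cs[0 := 0, i := ?cs ! i + ?cs ! 0] ! n = cs ! n"
      using assms 0 by (cases "n = 0"; cases "n = i") (simp_all add: nth_list_update)
  qed simp
  finally show ?thesis .
qed

text \<open>
  The counters are a scratch counter, the index \<open>k\<close> of the current matrix, the column \<open>j\<close>, the
  difference \<open>d\<close> between row and column, and the number of rows of the previous matrix. Thus the
  row index is \<open>j + d\<close>, and the diagonal is reached when \<open>d = 0\<close>.
\<close>

definition say_x :: com where
  "say_x = seqs [emit [True, False, False, True, False, True], say 1, emit [True, True]]"

definition say_row :: com where
  "say_row = seqs [emit [True, False, False, True], say 2, say 3, emit [True, True]]"

definition say_col :: com where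
  "say_col = seqs [emit [True, False, False, True], say 2, emit [True, True]]"

text \<open>Parity separates the two families of variables without knowledge of \<open>m\<close> and
  \<open>n\<close>. Index 0 remains for \<open>z\<close>.\<close>

definition x_index :: "nat \<Rightarrow> nat" where "x_index k = 2 * k + 2"
definition y_index :: "nat \<Rightarrow> nat" where "y_index i = 2 * i + 1"

lemma wp_say_index:
  "k \<le> b \<Longrightarrow> wp w b P (say_x # K) (h, [0, k, j, d, m], out) \<longleftrightarrow>
     wp w b P K (h, [0, k, j, d, m], out @ serialize (enc_unary (x_index k)))"
  "j \<le> b \<Longrightarrow> d \<le> b \<Longrightarrow> wp w b P (say_row # K) (h, [0, k, j, d, m], out) \<longleftrightarrow>
     wp w b P K (h, [0, k, j, d, m], out @ serialize (enc_unary (y_index (j + d))))"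
  "j \<le> b \<Longrightarrow> wp w b P (say_col # K) (h, [0, k, j, d, m], out) \<longleftrightarrow>
     wp w b P K (h, [0, k, j, d, m], out @ serialize (enc_unary (y_index j)))"
  by (simp_all add: say_x_def say_row_def say_col_def wp_say serialize_unary x_index_def y_index_def
      ones_add add_mult_distrib2 numeral_2_eq_2 del: serialize.simps)

text \<open>
  Fractions are copied without checking that their numerals are canonical: if they are not, the
  output is not the encoding of any polynomial, as it should be.
\<close>

type_synonym raw_frac = "bool list \<times> bool list"

definition raw_tree :: "raw_frac \<Rightarrow> tree" where
  "raw_tree e = Node [Node (map Bit (fst e)), Node (map Bit (snd e))]"

definition term_tree :: "tree \<Rightarrow> nat list \<Rightarrow> tree" where
  "term_tree t vs = Node [t, Node (map enc_unary vs)]"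

text \<open>
  The additional leading bit on the diagonal doubles the denominator, because numerals start with
  the least significant bit.
\<close>

definition entry_terms :: "nat \<Rightarrow> nat \<Rightarrow> nat \<Rightarrow> raw_frac \<Rightarrow> tree list" where
  "entry_terms k i j e =
     [term_tree (raw_tree (fst e, if i = j then False # snd e else snd e)) [x_index k, y_index i, y_index j],
      term_tree (enc_frac (- 1, 1)) [y_index i, y_index i]]"

text \<open>In the literals \<open>[True, False]\<close> opens and \<open>[True, True]\<close>
  closes a node. The program arrives here directly behind the denominator, with the fraction and its
  term still open.\<close>

definition finish_terms :: com where
  "finish_terms = seqs [emit [True, True, True, False], say_x, say_row, say_col,
     emit ([True, True, True, True, True, False] @ serialize (enc_frac (- 1, 1)) @ [True, False]),
     say_row, say_row, emit [True, True, True, True]]"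

definition read_denominator :: com where
  "read_denominator = seqs [Cond (Pos 3) Skip (emit [False, False]), copy_number, expects [True, True], finish_terms]"

definition read_entry :: com where
  "read_entry = seqs [expects [True, False, True, False], emit [True, False, True, False, True, False],
     copy_number, expects [True, False], emit [True, False], read_denominator]"

lemma serialize_raw: "serialize (raw_tree e) =
    [True, False, True, False] @ bits (fst e) @ [True, True, True, False] @ bits (snd e) @ [True, True, True, True]"
  by (simp add: raw_tree_def serialize_Node del: serialize.simps)

lemma wp_finish_terms:
  assumes "k \<le> b" "j \<le> b" "d \<le> b"
  shows "wp w b P (finish_terms # K) (h, [0, k, j, d, m], out) \<longleftrightarrow>
    wp w b P K (h, [0, k, j, d, m], out @ [True, True] @
      serialize (Node (map enc_unary [x_index k, y_index (j + d), y_index j])) @ [True, True] @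
      serialize (term_tree (enc_frac (- 1, 1)) [y_index (j + d), y_index (j + d)]))"
  using assms
  by (simp add: finish_terms_def wp_say_index term_tree_def serialize_Node del: serialize.simps)

lemma wp_entry:
  assumes u: "suffix u w" and b: "k \<le> b" "j \<le> b" "d \<le> b"
    and ok: "\<And>e r. u = serialize (raw_tree e) @ r \<Longrightarrow> suffix r w \<Longrightarrow>
       wp w b P K (pos w r, [0, k, j, d, m], out @ serialize_list (entry_terms k (j + d) j e))"
    and fail: "\<nexists>e r. u = serialize (raw_tree e) @ r \<Longrightarrow> P None"
  shows "wp w b P (read_entry # K) (pos w u, [0, k, j, d, m], out)"
  unfolding read_entry_def wp_seqs
proof (rule wp_expects[OF u]; (unfold wp_seqs wp_emit)?)
  fix u1 assume u1: "u = [True, False, True, False] @ u1" "suffix u1 w"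
  show "wp w b P (copy_number # seqs [expects [True, False], emit [True, False], read_denominator] # K)
    (pos w u1, [0, k, j, d, m], out @ [True, False, True, False, True, False])"
  proof (rule wp_number[OF u1(2)]; (unfold wp_seqs)?)
    fix a u2 assume a: "u1 = bits a @ True # True # u2" "suffix u2 w"
    show "wp w b P (expects [True, False] # seqs [emit [True, False], read_denominator] # K)
      (pos w u2, [0, k, j, d, m], (out @ [True, False, True, False, True, False]) @ bits a @ [True, True])"
    proof (rule wp_expects[OF a(2)]; (unfold wp_seqs wp_emit)?)
      fix u3 assume u3: "u2 = [True, False] @ u3" "suffix u3 w"
      define out' where "out' = (((out @ [True, False, True, False, True, False]) @ bits a @ [True, True]) @
        [True, False]) @ (if d = 0 then [False, False] else [])"
      have "wp w b P (copy_number # seqs [expects [True, True], finish_terms] # seqs [] # K) (pos w u3, [0, k, j, d, m], out')"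
      proof (rule wp_number[OF u3(2)]; (unfold wp_seqs)?)
        fix c u4 assume c: "u3 = bits c @ True # True # u4" "suffix u4 w"
        show "wp w b P (expects [True, True] # seqs [finish_terms] # seqs [] # K)
          (pos w u4, [0, k, j, d, m], out' @ bits c @ [True, True])"
        proof (rule wp_expects[OF c(2)]; (unfold wp_seqs)?)
          fix r assume r: "u4 = [True, True] @ r" "suffix r w"
          have "u = serialize (raw_tree (a, c)) @ r"
            using u1(1) a(1) u3(1) c(1) r(1) by (simp add: serialize_raw)
          from ok[OF this r(2)]
          show "wp w b P (finish_terms # seqs [] # seqs [] # K)
              (pos w r, [0, k, j, d, m], out' @ bits c @ [True, True])"
            unfolding wp_finish_terms[OF b] wp_seqs
            by (cases "d = 0") (simp_all add: entry_terms_def term_tree_def serialize_Node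
              serialize_raw out'_def del: serialize.simps)
        next
          assume no: "\<nexists>r. u4 = [True, True] @ r"
          show "P None"
            by (rule fail) (use no u1(1) a(1) u3(1) c(1) in \<open>auto simp: serialize_raw bits_unique\<close>)
        qed
      next
        assume no: "\<nexists>a r. u3 = bits a @ True # True # r"
        show "P None"
          by (rule fail) (use no u1(1) a(1) u3(1) in \<open>auto simp: serialize_raw bits_unique\<close>)
      qed
      then show "wp w b P (read_denominator # seqs [] # K) (pos w u3, [0, k, j, d, m],
          ((out @ [True, False, True, False, True, False]) @ bits a @ [True, True]) @ [True, False])"
        by (cases "d = 0") (simp_all add: read_denominator_def out'_def)
    next
      assume no: "\<nexists>r. u2 = [True, False] @ r"
      show "P None"
        by (rule fail) (use no u1(1) a(1) in \<open>auto simp: serialize_raw bits_unique\<close>)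
    qed
  next
    assume no: "\<nexists>a r. u1 = bits a @ True # True # r"
    show "P None"
      by (rule fail) (use no u1(1) in \<open>auto simp: serialize_raw\<close>)
  qed
next
  assume no: "\<nexists>r. u = [True, False, True, False] @ r"
  show "P None"
    by (rule fail) (use no in \<open>auto simp: serialize_raw\<close>)
qed

section \<open>Parsing of triangular matrices\<close>

fun row_terms :: "nat \<Rightarrow> nat \<Rightarrow> nat \<Rightarrow> raw_frac list \<Rightarrow> tree list" where
  "row_terms k i j [] = []"
| "row_terms k i j (e # es) = entry_terms k i j e @ row_terms k i (Suc j) es"

fun mat_terms :: "nat \<Rightarrow> nat \<Rightarrow> raw_frac list list \<Rightarrow> tree list" where
  "mat_terms k i [] = []"
| "mat_terms k i (es # A) = row_terms k i 0 es @ mat_terms k (Suc i) A"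

fun all_terms :: "nat \<Rightarrow> raw_frac list list list \<Rightarrow> tree list" where
  "all_terms k [] = []"
| "all_terms k (A # L) = mat_terms k 0 A @ all_terms (Suc k) L"

fun triangular :: "nat \<Rightarrow> 'a list list \<Rightarrow> bool" where
  "triangular i [] \<longleftrightarrow> True"
| "triangular i (es # A) \<longleftrightarrow> length es = Suc i \<and> triangular (Suc i) A"

text \<open>\<open>k\<close> is the index of the first matrix in the list and \<open>m\<close> the
  number of rows of its predecessor, mirroring the counters; equal sizes are checked between
  neighbours only.\<close>

fun matrices :: "nat \<Rightarrow> nat \<Rightarrow> 'a list list list \<Rightarrow> bool" where
  "matrices k m [] \<longleftrightarrow> True"
| "matrices k m (A # L) \<longleftrightarrow> A \<noteq> [] \<and> triangular 0 A \<and> (k = 0 \<or> length A = m) \<and>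
     matrices (Suc k) (length A) L"

definition row_tree :: "raw_frac list \<Rightarrow> tree" where
  "row_tree es = Node (map raw_tree es)"

definition mat_tree :: "raw_frac list list \<Rightarrow> tree" where
  "mat_tree A = Node (map row_tree A)"

definition sdp_tree :: "raw_frac list list list \<Rightarrow> tree" where
  "sdp_tree L = Node (map mat_tree L)"

lemma raw_tree_eq [simp]: "raw_tree e = raw_tree e' \<longleftrightarrow> e = e'"
  using inj_map_Bit by (auto simp: raw_tree_def inj_def prod_eq_iff)

lemma row_tree_eq [simp]: "row_tree a = row_tree b \<longleftrightarrow> a = b"
  using inj_mapI[of raw_tree] by (auto simp: row_tree_def inj_def)

lemma mat_tree_eq [simp]: "mat_tree a = mat_tree b \<longleftrightarrow> a = b"
  using inj_mapI[of row_tree] by (auto simp: mat_tree_def inj_def)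

lemma sdp_tree_eq [simp]: "sdp_tree a = sdp_tree b \<longleftrightarrow> a = b"
  using inj_mapI[of mat_tree] by (auto simp: sdp_tree_def inj_def)

lemma serialize_list_unique:
  "length ts = length us \<Longrightarrow> serialize_list ts @ r = serialize_list us @ r' \<Longrightarrow> ts = us \<and> r = r'"
  by (induction ts us rule: list_induct2) (auto dest: serialize_prefix_free)

text \<open>Each round keeps \<open>j + d\<close>, the row index, and \<open>d\<close> is the number
  of entries still due, so one pair of counters yields the indices and enforces the length of the
  row.\<close>

definition read_entries :: com where
  "read_entries = While (Pos 3) (seqs [Do (Dec 3), Do (Inc 2), read_entry])"

lemma wp_entries:
  assumes "suffix u w" "k \<le> b" "j + d \<le> b"
    and "\<And>es r. u = serialize_list (map raw_tree es) @ r \<Longrightarrow> length es = d \<Longrightarrow> suffix r w \<Longrightarrow>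
       wp w b P K (pos w r, [0, k, j + d, 0, m], out @ serialize_list (row_terms k (j + d) (Suc j) es))"
    and "\<nexists>es r. u = serialize_list (map raw_tree es) @ r \<and> length es = d \<Longrightarrow> P None"
  shows "wp w b P (read_entries # K) (pos w u, [0, k, j, d, m], out)"
  using assms
proof (induction d arbitrary: u j out)
  case 0
  then show ?case using 0(4)[of "[]" u] unfolding read_entries_def by (subst wp_While) simp
next
  case (Suc d)
  have "wp w b P (read_entry # seqs [] # read_entries # K) (pos w u, [0, k, Suc j, d, m], out)"
  proof (rule wp_entry[OF Suc.prems(1)])
    fix e u1 assume e: "u = serialize (raw_tree e) @ u1" "suffix u1 w"
    show "wp w b P (seqs [] # read_entries # K)
      (pos w u1, [0, k, Suc j, d, m], out @ serialize_list (entry_terms k (Suc j + d) (Suc j) e))"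
      unfolding wp_seqs
    proof (rule Suc.IH[OF e(2)])
      fix es r assume es: "u1 = serialize_list (map raw_tree es) @ r" "length es = d" "suffix r w"
      show "wp w b P K (pos w r, [0, k, Suc j + d, 0, m],
        (out @ serialize_list (entry_terms k (Suc j + d) (Suc j) e)) @
          serialize_list (row_terms k (Suc j + d) (Suc (Suc j)) es))"
        using Suc.prems(4)[of "e # es" r] e(1) es by simp
    next
      assume no: "\<nexists>es r. u1 = serialize_list (map raw_tree es) @ r \<and> length es = d"
      show "P None"
      proof (rule Suc.prems(5), rule notI, elim exE conjE)
        fix es r assume es: "u = serialize_list (map raw_tree es) @ r" "length es = Suc d"
        then obtain e' es' where "es = e' # es'" by (cases es) auto
        then show False using es e(1) no by (auto dest: serialize_prefix_free)
      qed
    qed (use Suc.prems in simp_all)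
  next
    assume no: "\<nexists>e r. u = serialize (raw_tree e) @ r"
    show "P None"
    proof (rule Suc.prems(5), rule notI, elim exE conjE)
      fix es r assume es: "u = serialize_list (map raw_tree es) @ r" "length es = Suc d"
      then obtain e' es' where "es = e' # es'" by (cases es) auto
      then show False using es no by (auto simp del: split_paired_Ex split_paired_All)
    qed
  qed (use Suc.prems in simp_all)
  then show ?case using Suc.prems(3) unfolding read_entries_def by (subst wp_While) simp
qed

text \<open>A row has one entry more than its index, so the entry in column 0 is read before the
  loop. At the end \<open>j\<close> equals the row index and is moved back to \<open>d\<close>,
  ready for the next row.\<close>

definition read_row :: com where
  "read_row = seqs [read_entry, read_entries, expects [True, True], move 2 3 [], Do (Inc 3)]"

lemma wp_row:
  assumes u: "suffix u w" and b: "k \<le> b" "i < b"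
    and ok: "\<And>es r. u = serialize_list (map raw_tree es) @ True # True # r \<Longrightarrow> length es = Suc i \<Longrightarrow>
       suffix r w \<Longrightarrow>
       wp w b P K (pos w r, [0, k, 0, Suc i, m], out @ serialize_list (row_terms k i 0 es))"
    and fail: "\<nexists>es r. u = serialize_list (map raw_tree es) @ True # True # r \<and> length es = Suc i \<Longrightarrow> P None"
  shows "wp w b P (read_row # K) (pos w u, [0, k, 0, i, m], out)"
  unfolding read_row_def wp_seqs
proof (rule wp_entry[OF u]; (unfold wp_seqs)?)
  fix e u1 assume e: "u = serialize (raw_tree e) @ u1" "suffix u1 w"
  show "wp w b P (read_entries # seqs [expects [True, True], move 2 3 [], Do (Inc 3)] # K)
      (pos w u1, [0, k, 0, i, m], out @ serialize_list (entry_terms k (0 + i) 0 e))"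
  proof (rule wp_entries[OF e(2)]; (unfold wp_seqs)?)
    fix es u2 assume es: "u1 = serialize_list (map raw_tree es) @ u2" "length es = i" "suffix u2 w"
    show "wp w b P (expects [True, True] # seqs [move 2 3 [], Do (Inc 3)] # K)
      (pos w u2, [0, k, 0 + i, 0, m], (out @ serialize_list (entry_terms k (0 + i) 0 e)) @
        serialize_list (row_terms k (0 + i) (Suc 0) es))"
    proof (rule wp_expects[OF es(3)])
      fix r assume r: "u2 = [True, True] @ r" "suffix r w"
      have "wp w b P K (pos w r, [0, k, 0, Suc i, m], out @ serialize_list (row_terms k i 0 (e # es)))"
        by (rule ok) (use e(1) es r in simp_all)
      then show "wp w b P (seqs [move 2 3 [], Do (Inc 3)] # K)
        (pos w r, [0, k, 0 + i, 0, m], (out @ serialize_list (entry_terms k (0 + i) 0 e)) @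
          serialize_list (row_terms k (0 + i) (Suc 0) es))"
        using b by (simp add: wp_move)
    next
      assume no: "\<nexists>r. u2 = [True, True] @ r"
      show "P None"
      proof (rule fail, rule notI, elim exE conjE)
        fix es' r assume es': "u = serialize_list (map raw_tree es') @ True # True # r" "length es' = Suc i"
        have "map raw_tree es' = map raw_tree (e # es) \<and> True # True # r = u2"
          by (rule serialize_list_unique) (use e es es' in simp_all)
        then show False using no by auto
      qed
    qed
  next
    assume no: "\<nexists>es r. u1 = serialize_list (map raw_tree es) @ r \<and> length es = i"
    show "P None"
    proof (rule fail, rule notI, elim exE conjE)
      fix es r assume es: "u = serialize_list (map raw_tree es) @ True # True # r" "length es = Suc i"
      then obtain e' es' where "es = e' # es'" by (cases es) auto
      then show False using es e(1) no by (auto dest: serialize_prefix_free)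
    qed
  qed (use b in simp_all)
next
  assume no: "\<nexists>e r. u = serialize (raw_tree e) @ r"
  show "P None"
  proof (rule fail, rule notI, elim exE conjE)
    fix es r assume es: "u = serialize_list (map raw_tree es) @ True # True # r" "length es = Suc i"
    then obtain e' es' where "es = e' # es'" by (cases es) auto
    then show False using es no by (auto simp del: split_paired_Ex split_paired_All)
  qed
qed (use b in simp_all)

text \<open>
  Both brackets begin with the bit 1. It has been consumed when the loop tests the second bit,
  which tells an opening bracket (0) from a closing one (1).
\<close>

definition read_rows :: com where
  "read_rows = While (Inp [1]) (seqs [Do MvR, read_row, expect True])"

lemma serialize_row: "serialize (row_tree es) = True # False # serialize_list (map raw_tree es) @ [True, True]"
  by (simp add: row_tree_def serialize_Node del: serialize.simps)

text \<open>\<open>True # u\<close> restores the bracket bit already consumed, and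
  \<open>expect True\<close> takes the second bit of the closing bracket. The bound on
  \<open>i + length u\<close> persists because every row consumes more input than it adds to the
  counter.\<close>

lemma wp_rows:
  assumes "suffix u w" "k \<le> b" "i + length u < b"
    and "\<And>A r. True # u = serialize_list (map row_tree A) @ True # True # r \<Longrightarrow> triangular i A \<Longrightarrow>
       suffix r w \<Longrightarrow>
       wp w b P (seqs cs # K) (pos w r, [0, k, 0, i + length A, m], out @ serialize_list (mat_terms k i A))"
    and "\<nexists>A r. True # u = serialize_list (map row_tree A) @ True # True # r \<and> triangular i A \<Longrightarrow> P None"
  shows "wp w b P (read_rows # seqs (expect True # cs) # K) (pos w u, [0, k, 0, i, m], out)"
  using assms
proof (induction "length u" arbitrary: u i out rule: less_induct)
  case less
  have hd: "A = []" if "True # u = serialize_list (map row_tree A) @ True # True # r" "u = [] \<or> hd u" for A r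
    using that by (cases A) (auto simp: serialize_row)
  show ?case
  proof (cases "u = [] \<or> hd u")
    case True
    have "wp w b P (seqs (expect True # cs) # K) (pos w u, [0, k, 0, i, m], out)"
    proof (cases u)
      case Nil
      then have "P None" using hd less.prems(5) by fastforce
      then show ?thesis using Nil less.prems(1) by (simp add: wp_expect)
    next
      case (Cons c u')
      then show ?thesis using True less.prems(1) less.prems(4)[of "[]" u']
        by (simp add: wp_expect suffix_ConsD)
    qed
    then show ?thesis using True less.prems(1) unfolding read_rows_def
      by (subst wp_While) (auto simp: cells_pos code_cases split: list.split)
  next
    case False
    then obtain u1 where u: "u = False # u1" by (cases u) auto
    have "wp w b P (read_row # seqs [expect True] # read_rows # seqs (expect True # cs) # K) (pos w u1, [0, k, 0, i, m], out)"
    proof (rule wp_row; (unfold wp_seqs)?)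
      fix es r assume es: "u1 = serialize_list (map raw_tree es) @ True # True # r"
        "length es = Suc i" "suffix r w"
      have Tu: "True # u = serialize (row_tree es) @ r" using u es(1) by (simp add: serialize_row)
      show "wp w b P (expect True # seqs [] # read_rows # seqs (expect True # cs) # K)
        (pos w r, [0, k, 0, Suc i, m], out @ serialize_list (row_terms k i 0 es))"
      proof (cases "r = [] \<or> \<not> hd r")
        case True
        have "P None"
        proof (rule less.prems(5), rule notI, elim exE conjE)
          fix A r' assume A: "True # u = serialize_list (map row_tree A) @ True # True # r'"
          then obtain es' A' where A': "A = es' # A'" using u by (cases A) auto
          then have "r = serialize_list (map row_tree A') @ True # True # r'"
            using A Tu serialize_prefix_free[of "row_tree es" r "row_tree es'"] by simp
          then show False using True by (cases A') (auto simp: serialize_row)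
        qed
        then show ?thesis using True es(3) by (cases r) (auto simp: wp_expect)
      next
        case False
        then obtain r2 where r2: "r = True # r2" by (cases r) auto
        have suf: "suffix r2 w" using es(3) r2 by (auto dest: suffix_ConsD)
        have "wp w b P (read_rows # seqs (expect True # cs) # K)
          (pos w r2, [0, k, 0, Suc i, m], out @ serialize_list (row_terms k i 0 es))"
        proof (rule less.hyps)
          fix A r' assume "True # r2 = serialize_list (map row_tree A) @ True # True # r'"
            "triangular (Suc i) A" "suffix r' w"
          then show "wp w b P (seqs cs # K) (pos w r', [0, k, 0, Suc i + length A, m],
            (out @ serialize_list (row_terms k i 0 es)) @ serialize_list (mat_terms k (Suc i) A))"
            using less.prems(4)[of "es # A" r'] Tu r2 es(2) by simp
        next
          assume no: "\<nexists>A r. True # r2 = serialize_list (map row_tree A) @ True # True # r \<and> triangular (Suc i) A"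
          show "P None"
          proof (rule less.prems(5), rule notI, elim exE conjE)
            fix A r' assume A: "True # u = serialize_list (map row_tree A) @ True # True # r'" "triangular i A"
            then obtain es' A' where A': "A = es' # A'" using u by (cases A) auto
            then have "r = serialize_list (map row_tree A') @ True # True # r'"
              using A Tu serialize_prefix_free[of "row_tree es" r "row_tree es'"] by simp
            then show False using no A(2) A' r2 by auto
          qed
        qed (use suf u es(1) r2 less.prems in simp_all)
        then show ?thesis using es(3) r2 by (simp add: wp_expect)
      qed
    next
      assume no: "\<nexists>es r. u1 = serialize_list (map raw_tree es) @ True # True # r \<and> length es = Suc i"
      show "P None"
      proof (rule less.prems(5), rule notI, elim exE conjE)
        fix A r' assume A: "True # u = serialize_list (map row_tree A) @ True # True # r'" "triangular i A"
        then obtain es' A' where A': "A = es' # A'" using u by (cases A) auto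
        then show False using A no u by (auto simp: serialize_row)
      qed
    qed (use less.prems u in \<open>auto dest: suffix_ConsD\<close>)
    then show ?thesis using less.prems(1) u pos_simps[of False u1 w] unfolding read_rows_def
      by (subst wp_While) (auto simp: cells_pos code_cases)
  qed
qed

text \<open>The scratch counter records the rounds, so the old row count can be restored. Running
  out of counter 4 means too many rows; a remainder in it, tested afterwards, means too few.\<close>

definition compare_loop :: com where
  "compare_loop = While (Pos 3) (seqs [Do (Dec 3), Cond (Pos 4) (Do (Dec 4)) Fail, Do (Inc 0)])"

lemma wp_compare_loop:
  "t + d \<le> b \<Longrightarrow> wp w b P (compare_loop # K) (h, [t, k, j, d, m], out) \<longleftrightarrow>
    (if d \<le> m then wp w b P K (h, [t + d, k, j, 0, m - d], out) else P None)"
proof (induction d arbitrary: t m)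
  case 0
  then show ?case unfolding compare_loop_def by (subst wp_While) simp
next
  case (Suc d)
  have "wp w b P (compare_loop # K) (h, [t, k, j, Suc d, m], out) \<longleftrightarrow>
    (if 0 < m then wp w b P (compare_loop # K) (h, [Suc t, k, j, d, m - 1], out) else P None)"
    using Suc.prems unfolding compare_loop_def by (subst wp_While) simp
  then show ?case using Suc.IH[of "Suc t" "m - 1"] Suc.prems by auto
qed

definition compare :: com where
  "compare = seqs [compare_loop, Cond (Pos 4) Fail Skip, move 0 4 []]"

lemma wp_compare:
  "d \<le> b \<Longrightarrow> wp w b P (compare # K) (h, [0, k, 0, d, m], out) \<longleftrightarrow>
    (if d = m then wp w b P K (h, [0, k, 0, 0, m], out) else P None)"
  by (auto simp: compare_def wp_compare_loop wp_move)

definition read_matrix :: com where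
  "read_matrix = seqs [expect True, read_rows, expect True, Cond (Pos 3) Skip Fail,
     Cond (Pos 1) compare (move 3 4 []), Do (Inc 1)]"

lemma length_serialize_list: "2 * length ts \<le> length (serialize_list ts)"
proof (induction ts)
  case (Cons t ts)
  have "2 \<le> length (serialize t)" by (cases t) simp_all
  then show ?case using Cons by simp
qed simp

lemma serialize_mat: "serialize (mat_tree A) = True # False # serialize_list (map row_tree A) @ [True, True]"
  by (simp add: mat_tree_def serialize_Node del: serialize.simps)

lemma wp_matrix:
  assumes u: "suffix u w" and b: "k + length u < b" and m: "k = 0 \<longrightarrow> m = 0"
    and ok: "\<And>A r. u = serialize_list (map row_tree A) @ True # True # r \<Longrightarrow> triangular 0 A \<Longrightarrow>
       A \<noteq> [] \<Longrightarrow> k = 0 \<or> length A = m \<Longrightarrow> suffix r w \<Longrightarrow>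
       wp w b P K (pos w r, [0, Suc k, 0, 0, length A], out @ serialize_list (mat_terms k 0 A))"
    and fail: "\<nexists>A r. u = serialize_list (map row_tree A) @ True # True # r \<and> triangular 0 A \<and>
       A \<noteq> [] \<and> (k = 0 \<or> length A = m) \<Longrightarrow> P None"
  shows "wp w b P (read_matrix # K) (pos w u, [0, k, 0, 0, m], out)"
proof (cases "u = [] \<or> \<not> hd u")
  case True
  have "P None"
  proof (rule fail, rule notI, elim exE conjE)
    fix A r assume "u = serialize_list (map row_tree A) @ True # True # r"
    then show False using True by (cases A) (auto simp: serialize_row)
  qed
  then show ?thesis using True u by (cases u) (auto simp: read_matrix_def wp_expect)
next
  case False
  then obtain u1 where u1: "u = True # u1" by (cases u) auto
  let ?cs = "[Cond (Pos 3) Skip Fail, Cond (Pos 1) compare (move 3 4 []), Do (Inc 1)]"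
  have suf: "suffix u1 w" using u u1 by (auto dest: suffix_ConsD)
  have "wp w b P (read_rows # seqs (expect True # ?cs) # K) (pos w u1, [0, k, 0, 0, m], out)"
  proof (rule wp_rows[OF suf])
    fix A r assume A: "True # u1 = serialize_list (map row_tree A) @ True # True # r"
      "triangular 0 A" "suffix r w"
    \<comment> \<open>Every serialised tree has at least two bits, so the row count stays within the
      bound on the counters.\<close>
    have "2 * length A \<le> length (serialize_list (map row_tree A))"
      using length_serialize_list[of "map row_tree A"] by simp
    then have "length A \<le> length u"
      using arg_cong[OF A(1), of length] u1 by simp
    then have le: "length A \<le> b" using b by simp
    show "wp w b P (seqs ?cs # K) (pos w r, [0, k, 0, 0 + length A, m], out @ serialize_list (mat_terms k 0 A))"
    proof (cases "A \<noteq> [] \<and> (k = 0 \<or> length A = m)")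
      case True
      have len: "0 < length A" "k < b" using True b by auto
      have "wp w b P K (pos w r, [0, Suc k, 0, 0, length A], out @ serialize_list (mat_terms k 0 A))"
        by (rule ok) (use True A u1 in simp_all)
      then show ?thesis
        using True m le len by (cases "k = 0") (simp_all add: wp_compare wp_move)
    next
      case False
      have "P None"
      proof (rule fail, rule notI, elim exE conjE)
        fix A' r' assume A': "u = serialize_list (map row_tree A') @ True # True # r'"
          "A' \<noteq> []" "k = 0 \<or> length A' = m"
        have "serialize (mat_tree A) @ r = serialize (mat_tree A') @ r'"
          using A(1) A'(1) u1 by (simp add: serialize_mat)
        then have "A = A'" using serialize_prefix_free by fastforce
        then show False using A' False by simp
      qed
      then show ?thesis using False le by (cases "A = []"; cases "k = 0") (simp_all add: wp_compare)
    qed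
  next
    assume no: "\<nexists>A r. True # u1 = serialize_list (map row_tree A) @ True # True # r \<and> triangular 0 A"
    show "P None" by (rule fail) (use no u1 in auto)
  qed (use b u1 in simp_all)
  then show ?thesis using u u1 by (simp add: read_matrix_def wp_expect)
qed

definition read_matrices :: com where
  "read_matrices = While (Inp [1]) (seqs [Do MvR, read_matrix, expect True])"

lemma wp_mats:
  assumes "suffix u w" "k + length u < b" "k = 0 \<longrightarrow> m = 0"
    and "\<And>L r m'. True # u = serialize_list (map mat_tree L) @ True # True # r \<Longrightarrow> matrices k m L \<Longrightarrow>
       suffix r w \<Longrightarrow>
       wp w b P (seqs cs # K) (pos w r, [0, k + length L, 0, 0, m'], out @ serialize_list (all_terms k L))"
    and "\<nexists>L r. True # u = serialize_list (map mat_tree L) @ True # True # r \<and> matrices k m L \<Longrightarrow> P None"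
  shows "wp w b P (read_matrices # seqs (expect True # cs) # K) (pos w u, [0, k, 0, 0, m], out)"
  using assms
proof (induction "length u" arbitrary: u k m out rule: less_induct)
  case less
  have hd: "L = []" if "True # u = serialize_list (map mat_tree L) @ True # True # r" "u = [] \<or> hd u" for L r
    using that by (cases L) (auto simp: serialize_mat)
  show ?case
  proof (cases "u = [] \<or> hd u")
    case True
    have "wp w b P (seqs (expect True # cs) # K) (pos w u, [0, k, 0, 0, m], out)"
    proof (cases u)
      case Nil
      then have "P None" using hd less.prems(5) by fastforce
      then show ?thesis using Nil less.prems(1) by (simp add: wp_expect)
    next
      case (Cons c u')
      then show ?thesis using True less.prems(1) less.prems(4)[of "[]" u']
        by (simp add: wp_expect suffix_ConsD)
    qed
    then show ?thesis using True less.prems(1) unfolding read_matrices_def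
      by (subst wp_While) (auto simp: cells_pos code_cases split: list.split)
  next
    case False
    then obtain u1 where u: "u = False # u1" by (cases u) auto
    have "wp w b P (read_matrix # seqs [expect True] # read_matrices # seqs (expect True # cs) # K)
      (pos w u1, [0, k, 0, 0, m], out)"
    proof (rule wp_matrix; (unfold wp_seqs)?)
      fix A r assume A: "u1 = serialize_list (map row_tree A) @ True # True # r"
        "triangular 0 A" "A \<noteq> []" "k = 0 \<or> length A = m" "suffix r w"
      have Tu: "True # u = serialize (mat_tree A) @ r" using u A(1) by (simp add: serialize_mat)
      show "wp w b P (expect True # seqs [] # read_matrices # seqs (expect True # cs) # K)
        (pos w r, [0, Suc k, 0, 0, length A], out @ serialize_list (mat_terms k 0 A))"
      proof (cases "r = [] \<or> \<not> hd r")
        case True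
        have "P None"
        proof (rule less.prems(5), rule notI, elim exE conjE)
          fix L r' assume L: "True # u = serialize_list (map mat_tree L) @ True # True # r'"
          then obtain A' L' where L': "L = A' # L'" using u by (cases L) auto
          then have "r = serialize_list (map mat_tree L') @ True # True # r'"
            using L Tu serialize_prefix_free[of "mat_tree A" r "mat_tree A'"] by simp
          then show False using True by (cases L') (auto simp: serialize_mat)
        qed
        then show ?thesis using True A(5) by (cases r) (auto simp: wp_expect)
      next
        case False
        then obtain r2 where r2: "r = True # r2" by (cases r) auto
        have suf: "suffix r2 w" using A(5) r2 by (auto dest: suffix_ConsD)
        have "wp w b P (read_matrices # seqs (expect True # cs) # K)
          (pos w r2, [0, Suc k, 0, 0, length A], out @ serialize_list (mat_terms k 0 A))"
        proof (rule less.hyps)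
          fix L r' m' assume "True # r2 = serialize_list (map mat_tree L) @ True # True # r'"
            "matrices (Suc k) (length A) L" "suffix r' w"
          then show "wp w b P (seqs cs # K) (pos w r', [0, Suc k + length L, 0, 0, m'],
            (out @ serialize_list (mat_terms k 0 A)) @ serialize_list (all_terms (Suc k) L))"
            using less.prems(4)[of "A # L" r' m'] Tu r2 A(2-4) by simp
        next
          assume no: "\<nexists>L r. True # r2 = serialize_list (map mat_tree L) @ True # True # r \<and>
            matrices (Suc k) (length A) L"
          show "P None"
          proof (rule less.prems(5), rule notI, elim exE conjE)
            fix L r' assume L: "True # u = serialize_list (map mat_tree L) @ True # True # r'" "matrices k m L"
            then obtain A' L' where L': "L = A' # L'" using u by (cases L) auto
            then have "A = A'" "r = serialize_list (map mat_tree L') @ True # True # r'"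
              using L Tu serialize_prefix_free[of "mat_tree A" r "mat_tree A'"] by simp_all
            then show False using no L(2) L' r2 by auto
          qed
        qed (use suf u A(1) r2 less.prems in simp_all)
        then show ?thesis using A(5) r2 by (simp add: wp_expect)
      qed
    next
      assume no: "\<nexists>A r. u1 = serialize_list (map row_tree A) @ True # True # r \<and> triangular 0 A \<and>
        A \<noteq> [] \<and> (k = 0 \<or> length A = m)"
      show "P None"
      proof (rule less.prems(5), rule notI, elim exE conjE)
        fix L r' assume L: "True # u = serialize_list (map mat_tree L) @ True # True # r'" "matrices k m L"
        then obtain A' L' where "L = A' # L'" using u by (cases L) auto
        then show False using L no u by (auto simp: serialize_mat)
      qed
    qed (use less.prems u in \<open>auto dest: suffix_ConsD\<close>)
    then show ?thesis using less.prems(1) u pos_simps[of False u1 w] unfolding read_matrices_def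
      by (subst wp_While) (auto simp: cells_pos code_cases)
  qed
qed

section \<open>The complete program and the function it computes\<close>

definition scan :: com where
  "scan = While (Inp [1, 2]) (seqs [emit [False, True], Do (Inc 0), Do MvR])"

lemma wp_scan:
  "suffix u w \<Longrightarrow> t + length u \<le> b \<Longrightarrow>
    wp w b P (scan # K) (pos w u, [t, 0, 0, 0, 0], out) \<longleftrightarrow>
    wp w b P K (pos w [], [t + length u, 0, 0, 0, 0], out @ ones (length u))"
proof (induction u arbitrary: t out)
  case Nil
  then show ?case unfolding scan_def by (subst wp_While) (simp add: cells_pos)
next
  case (Cons c u)
  have "cells w (pos w (c # u)) = 1 \<or> cells w (pos w (c # u)) = 2"
    using cells_pos[OF Cons.prems(1)] by (simp add: code_def)
  then have "wp w b P (scan # K) (pos w (c # u), [t, 0, 0, 0, 0], out) \<longleftrightarrow>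
    wp w b P (scan # K) (pos w u, [Suc t, 0, 0, 0, 0], out @ [False, True])"
    using Cons.prems(2) unfolding scan_def
    by (subst wp_While) (auto simp: pos_simps(1,3)[OF Cons.prems(1)])
  then show ?case using Cons.IH[of "Suc t" "out @ [False, True]"] Cons.prems by (simp add: suffix_ConsD)
qed

definition rewind :: com where
  "rewind = While (Pos 0) (seqs [Do (Dec 0), Do MvL])"

lemma wp_rewind:
  "length v = t \<Longrightarrow> wp (v @ u) b P (rewind # K) (pos (v @ u) u, [t, 0, 0, 0, 0], out) \<longleftrightarrow>
    wp (v @ u) b P K (0, [0, 0, 0, 0, 0], out)"
proof (induction t arbitrary: v u)
  case 0
  then show ?case unfolding rewind_def by (subst wp_While) (simp add: pos_def)
next
  case (Suc t)
  then obtain v' c where v: "v = v' @ [c]" by (cases v rule: rev_cases) auto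
  have "suffix (c # u) (v' @ c # u)" by (simp add: suffix_def)
  note pos = pos_simps[OF this]
  have "wp (v @ u) b P (rewind # K) (pos (v @ u) u, [Suc t, 0, 0, 0, 0], out) \<longleftrightarrow>
    wp (v' @ c # u) b P (rewind # K) (pos (v' @ c # u) (c # u), [t, 0, 0, 0, 0], out)"
    using pos(2,4) unfolding rewind_def v by (subst wp_While) simp
  then show ?case using Suc v by simp
qed

definition z_terms :: "tree list" where
  "z_terms = [term_tree (enc_frac (1, 1)) [x_index 0, 0, 0], term_tree (enc_frac (- 1, 1)) [0, 0]]"

definition out_tree :: "nat \<Rightarrow> raw_frac list list list \<Rightarrow> tree" where
  "out_tree n L = Node [enc_unary n, Node (z_terms @ all_terms 0 L)]"

text \<open>
  The length of the input serves as the number of variables. It exceeds all indices that are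
  used, and superfluous variables do no harm.
\<close>

definition reduction :: com where
  "reduction = seqs [emit [True, False, True, False], scan,
     emit ([True, True, True, False] @ serialize_list z_terms), rewind, expects [True, False, True],
     read_matrices, expect True, Do (Dec 1), Cond (Pos 1) Skip Fail, Cond (Inp [0]) Skip Fail,
     emit [True, True, True, True]]"

text \<open>Only the shape is checked; numerals are arbitrary lists of bits.\<close>

definition parsed :: "bool list \<Rightarrow> raw_frac list list list \<Rightarrow> bool" where
  "parsed w L \<longleftrightarrow> w = serialize (sdp_tree L) \<and> matrices 0 0 L \<and> 2 \<le> length L"

definition reduction_fun :: "bool list \<Rightarrow> bool list option" where
  "reduction_fun w = (if \<exists>L. parsed w L then Some (serialize (out_tree (length w) (SOME L. parsed w L))) else None)"

lemma parsed_unique: "parsed w L \<Longrightarrow> parsed w L' \<Longrightarrow> L = L'"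
  unfolding parsed_def using injD[OF inj_serialize] by fastforce

lemma reduction_fun_eq: "parsed w L \<Longrightarrow> reduction_fun w = Some (serialize (out_tree (length w) L))"
  unfolding reduction_fun_def using parsed_unique by (metis someI)

lemma serialize_sdp: "serialize (sdp_tree L) = True # False # serialize_list (map mat_tree L) @ [True, True]"
  by (simp add: sdp_tree_def serialize_Node del: serialize.simps)

lemma wp_reduction:
  "wp w (Suc (length w)) ((=) (reduction_fun w)) [reduction] (0, replicate 5 0, [])"
proof -
  let ?P = "(=) (reduction_fun w)" and ?b = "Suc (length w)"
  let ?o = "[True, False, True, False] @ ones (length w) @ [True, True, True, False] @ serialize_list z_terms"
  \<comment> \<open>After the decrement counter 1 is positive iff there were at least two matrices.
    Reading the blank confirms that the input is exhausted.\<close>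
  let ?cs = "[Do (Dec 1), Cond (Pos 1) Skip Fail, Cond (Inp [0]) Skip Fail, emit [True, True, True, True]]"
  have start: "0 = pos w w" by (simp add: pos_def)
  have fail: "?P None" if "\<And>L. \<not> parsed w L"
    using that by (simp add: reduction_fun_def)
  \<comment> \<open>The three bits are the outer opening bracket and the first bit of the bracket
    after it, which the matrix loop presupposes as consumed.\<close>
  have "wp w ?b ?P (expects [True, False, True] # seqs (read_matrices # expect True # ?cs) # []) (pos w w, [0, 0, 0, 0, 0], ?o)"
  proof (rule wp_expects; (unfold wp_seqs)?)
    fix u assume u: "w = [True, False, True] @ u" "suffix u w"
    show "wp w ?b ?P (read_matrices # seqs (expect True # ?cs) # []) (pos w u, [0, 0, 0, 0, 0], ?o)"
    proof (rule wp_mats[OF u(2)])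
      fix L r m assume L: "True # u = serialize_list (map mat_tree L) @ True # True # r"
        "matrices 0 0 L" "suffix r w"
      have w: "w = serialize (sdp_tree L) @ r" using u(1) L(1) by (simp add: serialize_sdp)
      show "wp w ?b ?P (seqs ?cs # []) (pos w r, [0, 0 + length L, 0, 0, m], ?o @ serialize_list (all_terms 0 L))"
      proof (cases "2 \<le> length L \<and> r = []")
        case True
        then have "reduction_fun w = Some (serialize (out_tree (length w) L))"
          using w L(2) by (intro reduction_fun_eq) (simp add: parsed_def)
        then show ?thesis using True
          by (simp add: cells_pos out_tree_def serialize_Node serialize_unary del: serialize.simps)
      next
        case False
        have "?P None"
        proof (rule fail, rule notI)
          fix L' assume L': "parsed w L'"
          then have "serialize (sdp_tree L) @ r = serialize (sdp_tree L') @ []"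
            using w by (simp add: parsed_def)
          then have "sdp_tree L = sdp_tree L' \<and> r = []" by (rule serialize_prefix_free)
          then show False using L' False by (simp add: parsed_def)
        qed
        then show ?thesis using False L(3)
          by (cases r) (auto simp: cells_pos code_cases)
      qed
    next
      assume no: "\<nexists>L r. True # u = serialize_list (map mat_tree L) @ True # True # r \<and> matrices 0 0 L"
      show "?P None"
      proof (rule fail, rule notI)
        fix L assume L: "parsed w L"
        then have "w = True # False # serialize_list (map mat_tree L) @ [True, True]"
          by (simp only: parsed_def serialize_sdp)
        then have "True # u = serialize_list (map mat_tree L) @ True # True # []" using u(1) by simp
        then show False using no L unfolding parsed_def by blast
      qed
    qed (use u in simp_all)
  next
    assume no: "\<nexists>r. w = [True, False, True] @ r"
    show "?P None"
    proof (rule fail, rule notI)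
      fix L assume L: "parsed w L"
      then have "w = True # False # serialize_list (map mat_tree L) @ [True, True]"
        by (simp only: parsed_def serialize_sdp)
      then show False using no by (cases L) (auto simp: serialize_mat)
    qed
  qed simp
  then have "wp w ?b ?P (rewind # seqs [expects [True, False, True], read_matrices, expect True, Do (Dec 1),
      Cond (Pos 1) Skip Fail, Cond (Inp [0]) Skip Fail, emit [True, True, True, True]] # [])
      (pos w [], [length w, 0, 0, 0, 0], ?o)"
    using wp_rewind[of w "length w" "[]"] start by simp
  moreover have "replicate 5 (0 :: nat) = [0, 0, 0, 0, 0]" by (simp add: eval_nat_numeral)
  ultimately show ?thesis
    using wp_scan[of w w 0 ?b ?P] start by (simp add: reduction_def)
qed

section \<open>Quadratic forms and local minima\<close>

definition quad :: "nat \<Rightarrow> (nat \<Rightarrow> nat \<Rightarrow> real) \<Rightarrow> (nat \<Rightarrow> real) \<Rightarrow> real" where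
  "quad m a y = (\<Sum>i<m. \<Sum>j<m. a i j * y i * y j)"

lemma quad_cong: "(\<And>i. i < m \<Longrightarrow> y i = y' i) \<Longrightarrow> quad m a y = quad m a y'"
  by (simp add: quad_def)

lemma quad_scale: "quad m a (\<lambda>i. s * y i) = s\<^sup>2 * quad m a y"
  by (simp add: quad_def sum_distrib_left power2_eq_square algebra_simps)

lemma quad_parallelogram:
  "quad m a (\<lambda>i. y i + s * u i) + quad m a (\<lambda>i. y i - s * u i) = 2 * quad m a y + 2 * s\<^sup>2 * quad m a u"
  by (simp add: quad_def sum_distrib_left sum.distrib[symmetric] power2_eq_square algebra_simps)

lemma quad_sum: "(\<Sum>k\<in>K. c k * quad m (a k) y) = quad m (\<lambda>i j. \<Sum>k\<in>K. c k * a k i j) y"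
proof -
  have "(\<Sum>k\<in>K. c k * quad m (a k) y) = (\<Sum>k\<in>K. \<Sum>i<m. \<Sum>j<m. c k * a k i j * y i * y j)"
    by (simp add: quad_def sum_distrib_left mult.assoc)
  also have "\<dots> = (\<Sum>i<m. \<Sum>j<m. \<Sum>k\<in>K. c k * a k i j * y i * y j)"
    by (subst sum.swap) (rule sum.cong[OF refl], rule sum.swap)
  finally show ?thesis by (simp add: quad_def sum_distrib_right)
qed

lemma quad_bound: "\<bar>quad m a y\<bar> \<le> (\<Sum>i<m. \<Sum>j<m. \<bar>a i j\<bar>) * (\<Sum>i<m. (y i)\<^sup>2)"
proof -
  let ?s = "\<Sum>i<m. (y i)\<^sup>2"
  have "\<bar>y i * y j\<bar> \<le> ?s" if "i < m" "j < m" for i j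
  proof -
    have 1: "(y i)\<^sup>2 \<le> ?s" "(y j)\<^sup>2 \<le> ?s" using that by (auto intro!: member_le_sum)
    have "2 * \<bar>y i * y j\<bar> \<le> (y i)\<^sup>2 + (y j)\<^sup>2"
      using sum_squares_bound[of "\<bar>y i\<bar>" "\<bar>y j\<bar>"] by (simp add: abs_mult mult.assoc)
    then show ?thesis using 1 by linarith
  qed
  then have "\<bar>a i j * y i * y j\<bar> \<le> \<bar>a i j\<bar> * ?s" if "i < m" "j < m" for i j
    using that by (simp add: abs_mult mult.assoc mult_left_mono)
  then have "\<bar>quad m a y\<bar> \<le> (\<Sum>i<m. \<Sum>j<m. \<bar>a i j\<bar> * ?s)"
    unfolding quad_def by (intro order_trans[OF sum_abs] sum_mono) (auto intro!: order_trans[OF sum_abs] sum_mono)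
  then show ?thesis by (simp add: sum_distrib_right)
qed

section \<open>Compactness and coercivity\<close>

lemma continuous_on_coordinate: "continuous_on S (\<lambda>y :: nat \<Rightarrow> real. y i)"
  by (rule continuous_on_subset[OF continuous_on_product_coordinates]) simp

text \<open>Vectors are functions on all of \<open>nat\<close>; pinning the coordinates from
  \<open>m\<close> on to 0 gives a product of compact sets, compact by Tychonoff's theorem.\<close>

lemma compact_cube: "compact {y :: nat \<Rightarrow> real. \<forall>i. y i \<in> (if i < m then {- 1..1} else {0})}"
proof -
  let ?S = "\<lambda>i. if i < m then {- 1..1 :: real} else {0}"
  have "compactin (product_topology (\<lambda>i. euclidean) UNIV) (PiE UNIV ?S)"
    by (auto simp: compactin_PiE)
  moreover have "PiE UNIV ?S = {y. \<forall>i. y i \<in> ?S i}" by (simp add: PiE_def Pi_def)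
  ultimately show ?thesis by (simp add: euclidean_product_topology)
qed

text \<open>The form attains a positive minimum on the compact unit sphere, and homogeneity of
  degree two carries this bound to all vectors.\<close>

lemma quad_coercive:
  assumes pos: "\<And>y. \<exists>i<m. y i \<noteq> 0 \<Longrightarrow> quad m a y > 0"
  shows "\<exists>c>0. \<forall>y. c * (\<Sum>i<m. (y i)\<^sup>2) \<le> quad m a y"
proof (cases "m = 0")
  case True
  then show ?thesis by (intro exI[of _ 1]) (simp add: quad_def)
next
  case False
  define cube where "cube = {y :: nat \<Rightarrow> real. \<forall>i. y i \<in> (if i < m then {- 1..1} else {0})}"
  define S where "S = cube \<inter> {y. (\<Sum>i<m. (y i)\<^sup>2) = 1}"
  have "closed {y :: nat \<Rightarrow> real. (\<Sum>i<m. (y i)\<^sup>2) = 1}"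
    by (intro closed_Collect_eq continuous_intros continuous_on_coordinate)
  then have "compact S" using compact_cube unfolding S_def cube_def by (intro compact_Int_closed)
  moreover have "S \<noteq> {}"
  proof -
    have "(\<Sum>i<m. (if i = 0 then 1 else 0 :: real)\<^sup>2) = (\<Sum>i<m. if i = 0 then 1 else 0)"
      by (rule sum.cong) auto
    then have "(\<lambda>i. if i = 0 then 1 else 0) \<in> S"
      using False by (auto simp: S_def cube_def)
    then show ?thesis by blast
  qed
  moreover have "continuous_on S (quad m a)"
    unfolding quad_def[abs_def]
    by (intro continuous_on_sum continuous_on_mult continuous_on_const continuous_on_coordinate)
  ultimately obtain y0 where y0: "y0 \<in> S" "\<And>y. y \<in> S \<Longrightarrow> quad m a y0 \<le> quad m a y"
    using continuous_attains_inf[of S "quad m a"] by auto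
  have "\<exists>i<m. y0 i \<noteq> 0"
  proof (rule ccontr)
    assume "\<not> ?thesis"
    then have "(\<Sum>i<m. (y0 i)\<^sup>2) = 0" by simp
    then show False using y0(1) by (simp add: S_def)
  qed
  then have c: "quad m a y0 > 0" by (rule pos)
  have "quad m a y0 * (\<Sum>i<m. (y i)\<^sup>2) \<le> quad m a y" for y
  proof (cases "\<exists>i<m. y i \<noteq> 0")
    case False
    then show ?thesis by (simp add: quad_def)
  next
    case True
    define r where "r = sqrt (\<Sum>i<m. (y i)\<^sup>2)"
    have r2: "r\<^sup>2 = (\<Sum>i<m. (y i)\<^sup>2)" unfolding r_def by (simp add: sum_nonneg)
    have "(\<Sum>i<m. (y i)\<^sup>2) \<noteq> 0" using True by (subst sum_nonneg_eq_0_iff) auto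
    then have r: "r > 0" unfolding r_def by (simp add: sum_nonneg order.not_eq_order_implies_strict)
    define u where "u = (\<lambda>i. if i < m then y i / r else 0)"
    have "(u i)\<^sup>2 = (y i)\<^sup>2 / r\<^sup>2" if "i < m" for i using that by (simp add: u_def power_divide)
    then have "(\<Sum>i<m. (u i)\<^sup>2) = (\<Sum>i<m. (y i)\<^sup>2 / r\<^sup>2)" by simp
    also have "\<dots> = r\<^sup>2 / r\<^sup>2" unfolding r2 by (rule sum_divide_distrib[symmetric])
    finally have sum1: "(\<Sum>i<m. (u i)\<^sup>2) = 1" using r by simp
    have "u i \<in> {- 1..1}" if "i < m" for i
    proof -
      have "(u i)\<^sup>2 \<le> (\<Sum>i<m. (u i)\<^sup>2)" using that by (intro member_le_sum) auto
      then have "(u i)\<^sup>2 \<le> 1" by (simp add: sum1)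
      then have "\<bar>u i\<bar> \<le> 1" by (simp add: abs_square_le_1)
      then show ?thesis by auto
    qed
    then have "u \<in> S" using sum1 by (auto simp: S_def cube_def u_def)
    then have "r\<^sup>2 * quad m a y0 \<le> r\<^sup>2 * quad m a u" using y0(2) by (intro mult_left_mono) auto
    also have "\<dots> = quad m a (\<lambda>i. r * u i)" by (simp add: quad_scale)
    also have "\<dots> = quad m a y" using r by (intro quad_cong) (simp add: u_def)
    finally show ?thesis by (simp add: r2 mult.commute)
  qed
  then show ?thesis using c by blast
qed

section \<open>The cubic form and its sign\<close>

definition cubic_form :: "nat \<Rightarrow> nat \<Rightarrow> (nat \<Rightarrow> nat \<Rightarrow> nat \<Rightarrow> real) \<Rightarrow> (nat \<Rightarrow> real) \<Rightarrow>
    (nat \<Rightarrow> real) \<Rightarrow> real \<Rightarrow> (nat \<Rightarrow> real) \<Rightarrow> real" where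
  "cubic_form m N a d x z y =
     (x 0 - 1) * z\<^sup>2 + (\<Sum>k<N. x k * quad m (a k) y) / 2 - (\<Sum>i<m. d i * (y i)\<^sup>2)"

text \<open>For fixed \<open>x\<close> this is a quadratic form in \<open>(z, y)\<close>. The
  identity replaces derivatives: if both shifted values are at least the central one, the form is
  nonnegative at \<open>(v, u)\<close>.\<close>

lemma cubic_form_parallelogram:
  "cubic_form m N a d x (z + s * v) (\<lambda>i. y i + s * u i) + cubic_form m N a d x (z - s * v) (\<lambda>i. y i - s * u i) =
   2 * cubic_form m N a d x z y + 2 * s\<^sup>2 * cubic_form m N a d x v u"
proof -
  have "(\<Sum>k<N. x k * quad m (a k) (\<lambda>i. y i + s * u i)) + (\<Sum>k<N. x k * quad m (a k) (\<lambda>i. y i - s * u i)) =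
      (\<Sum>k<N. x k * (2 * quad m (a k) y + 2 * s\<^sup>2 * quad m (a k) u))"
    by (simp add: sum.distrib[symmetric] distrib_left[symmetric] quad_parallelogram)
  also have "\<dots> = 2 * (\<Sum>k<N. x k * quad m (a k) y) + 2 * s\<^sup>2 * (\<Sum>k<N. x k * quad m (a k) u)"
    by (simp add: sum_distrib_left sum.distrib distrib_left algebra_simps)
  finally have 1: "(\<Sum>k<N. x k * quad m (a k) (\<lambda>i. y i + s * u i)) + (\<Sum>k<N. x k * quad m (a k) (\<lambda>i. y i - s * u i)) = \<dots>" .
  have 2: "(\<Sum>i<m. d i * (y i + s * u i)\<^sup>2) + (\<Sum>i<m. d i * (y i - s * u i)\<^sup>2) =
      2 * (\<Sum>i<m. d i * (y i)\<^sup>2) + 2 * s\<^sup>2 * (\<Sum>i<m. d i * (u i)\<^sup>2)"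
    by (simp add: sum_distrib_left sum.distrib[symmetric] power2_eq_square algebra_simps)
  have 3: "(x 0 - 1) * (z + s * v)\<^sup>2 + (x 0 - 1) * (z - s * v)\<^sup>2 =
      2 * ((x 0 - 1) * z\<^sup>2) + 2 * s\<^sup>2 * ((x 0 - 1) * v\<^sup>2)"
    by (simp add: power2_eq_square algebra_simps)
  show ?thesis unfolding cubic_form_def using 1 2 3 by (simp add: algebra_simps add_divide_distrib)
qed

text \<open>The vector \<open>(1, 0)\<close> isolates the coefficient \<open>x 0 - 1\<close>. On
  \<open>(0, u)\<close> the subtracted positive squares make the remaining inequality
  strict.\<close>

lemma feasible_if_cubic_form_nonneg:
  assumes nonneg: "\<And>v u. 0 \<le> cubic_form m N a d x v u" and d: "\<And>i. i < m \<Longrightarrow> 0 < d i"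
  shows "1 \<le> x 0 \<and> (\<forall>u :: nat \<Rightarrow> real. (\<exists>i<m. u i \<noteq> 0) \<longrightarrow> 0 < (\<Sum>k<N. x k * quad m (a k) u))"
proof (intro conjI allI impI)
  show "1 \<le> x 0" using nonneg[of 1 "\<lambda>_. 0"] by (simp add: cubic_form_def quad_def)
next
  fix u :: "nat \<Rightarrow> real" assume u: "\<exists>i<m. u i \<noteq> 0"
  then obtain i where i: "i < m" "u i \<noteq> 0" by blast
  have "0 < (\<Sum>i<m. d i * (u i)\<^sup>2)"
    by (rule sum_pos2[of _ i]) (use i d in \<open>auto intro!: mult_nonneg_nonneg less_imp_le[OF d]\<close>)
  then show "0 < (\<Sum>k<N. x k * quad m (a k) u)"
    using nonneg[of 0 u] by (simp add: cubic_form_def)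
qed

text \<open>Multiplication by a large \<open>t\<close> lets the coercive form dominate the fixed
  weights \<open>d\<close> with a margin that also covers small changes of all coefficients.\<close>

lemma cubic_form_nonneg_near:
  assumes pos: "\<And>y. \<exists>i<m. y i \<noteq> 0 \<Longrightarrow> 0 < (\<Sum>k<N. x k * quad m (a k) y)" and x0: "x 0 = 1"
    and N: "0 < N"
  shows "\<exists>t \<epsilon>. 0 < \<epsilon> \<and> (\<forall>x' z y. (\<forall>k<N. \<bar>x' k - t * x k\<bar> \<le> \<epsilon>) \<longrightarrow> 0 \<le> cubic_form m N a d x' z y)"
proof -
  let ?s = "\<lambda>y. \<Sum>i<m. (y i)\<^sup>2"
  obtain c where c: "c > 0" "\<And>y. c * ?s y \<le> (\<Sum>k<N. x k * quad m (a k) y)"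
    using quad_coercive[of m "\<lambda>i j. \<Sum>k<N. x k * a k i j"] pos unfolding quad_sum by blast
  define b where "b = (\<Sum>k<N. \<Sum>i<m. \<Sum>j<m. \<bar>a k i j\<bar>)"
  define e where "e = (\<Sum>i<m. \<bar>d i\<bar>)"
  \<comment> \<open>\<open>t \<ge> 2\<close> together with \<open>\<epsilon> \<le> 1\<close> keeps
    \<open>x' 0 - 1\<close> nonnegative. In \<open>t * c \<ge> 2 * (e + 1)\<close> the 2 offsets the
    halving of the form, \<open>e\<close> pays for the weights and 1 for the perturbation, which
    \<open>\<epsilon> * b \<le> 1\<close> bounds by the sum of squares.\<close>
  define t where "t = 2 + 2 * (e + 1) / c"
  define \<epsilon> where "\<epsilon> = 1 / (1 + b)"
  have b: "0 \<le> b" and e: "0 \<le> e" by (auto simp: b_def e_def intro!: sum_nonneg)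
  have \<epsilon>: "0 < \<epsilon>" "\<epsilon> \<le> 1" "\<epsilon> * b \<le> 1" using b by (auto simp: \<epsilon>_def field_simps)
  have t: "2 \<le> t" "2 * (e + 1) \<le> t * c" using c(1) e by (auto simp: t_def field_simps)
  have "0 \<le> cubic_form m N a d x' z y" if near: "\<forall>k<N. \<bar>x' k - t * x k\<bar> \<le> \<epsilon>" for x' z y
  proof -
    have s: "0 \<le> ?s y" by (simp add: sum_nonneg)
    have "t - 1 \<le> x' 0" using near N x0 \<epsilon>(2) by fastforce
    then have 1: "0 \<le> (x' 0 - 1) * z\<^sup>2" using t(1) by simp
    have "\<bar>\<Sum>k<N. (x' k - t * x k) * quad m (a k) y\<bar> \<le> (\<Sum>k<N. \<epsilon> * ((\<Sum>i<m. \<Sum>j<m. \<bar>a k i j\<bar>) * ?s y))"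
      using near quad_bound[of m _ y] \<epsilon>(1)
      by (intro order_trans[OF sum_abs] sum_mono) (auto simp: abs_mult intro!: mult_mono)
    also have "\<dots> = (\<epsilon> * b) * ?s y"
      unfolding b_def by (simp add: mult.assoc flip: sum_distrib_left sum_distrib_right)
    also have "\<dots> \<le> 1 * ?s y" using \<epsilon>(3) s by (intro mult_right_mono)
    finally have 2: "- ?s y \<le> (\<Sum>k<N. (x' k - t * x k) * quad m (a k) y)" by linarith
    have "(2 * (e + 1)) * ?s y \<le> (t * c) * ?s y" using t(2) s by (intro mult_right_mono)
    also have "\<dots> \<le> t * (\<Sum>k<N. x k * quad m (a k) y)"
      using c(2)[of y] t(1) by (simp add: mult.assoc mult_left_mono)
    finally have 3: "2 * (e * ?s y) + 2 * ?s y \<le> t * (\<Sum>k<N. x k * quad m (a k) y)"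
      by (simp add: algebra_simps)
    have "(\<Sum>k<N. x' k * quad m (a k) y) =
        t * (\<Sum>k<N. x k * quad m (a k) y) + (\<Sum>k<N. (x' k - t * x k) * quad m (a k) y)"
      by (simp add: sum_distrib_left sum.distrib[symmetric] algebra_simps)
    moreover have "(\<Sum>i<m. d i * (y i)\<^sup>2) \<le> (\<Sum>i<m. e * (y i)\<^sup>2)"
    proof (intro sum_mono mult_right_mono)
      fix i assume "i \<in> {..<m}"
      then have "\<bar>d i\<bar> \<le> e" unfolding e_def by (intro member_le_sum) auto
      then show "d i \<le> e" by simp
    qed simp
    then have "(\<Sum>i<m. d i * (y i)\<^sup>2) \<le> e * ?s y" by (simp add: sum_distrib_left)
    ultimately show ?thesis unfolding cubic_form_def using 1 2 3 s by (simp add: field_simps)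
  qed
  then show ?thesis using \<epsilon>(1) by blast
qed

section \<open>Correctness of the reduction\<close>

definition raw :: "frac \<Rightarrow> raw_frac" where
  "raw c = ((fst c < 0) # binary (nat \<bar>fst c\<bar>), binary (snd c))"

lemma enc_frac_raw: "enc_frac c = raw_tree (raw c)"
  by (simp add: enc_frac_def raw_tree_def raw_def enc_int_def enc_nat_def)

lemma enc_sdp_raw: "enc_sdp As = sdp_tree (map (map (map raw)) As)"
  by (simp add: enc_sdp_def sdp_tree_def mat_tree_def row_tree_def enc_frac_raw comp_def)

lemma binary_double: "0 < n \<Longrightarrow> binary (2 * n) = False # binary n"
  by (subst binary.simps) simp

text \<open>This undoes the doubling of a diagonal denominator. A denominator 0 would have become
  \<open>[False]\<close>, which is the numeral of no number.\<close>

lemma binary_halve: "binary n = False # a \<Longrightarrow> 0 < n \<and> even n \<and> binary (n div 2) = a"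
  by (subst (asm) binary.simps) (auto split: if_splits)

definition enc_term :: "frac \<times> nat list \<Rightarrow> tree" where
  "enc_term t = term_tree (enc_frac (fst t)) (snd t)"

lemma enc_cubic_eq: "enc_cubic (n, ts) = Node [enc_unary n, Node (map enc_term ts)]"
  by (simp add: enc_cubic_def enc_term_def[abs_def] term_tree_def case_prod_unfold)

definition entry_monomials :: "nat \<Rightarrow> nat \<Rightarrow> nat \<Rightarrow> frac \<Rightarrow> (frac \<times> nat list) list" where
  "entry_monomials k i j c =
     [((fst c, if i = j then 2 * snd c else snd c), [x_index k, y_index i, y_index j]),
      ((- 1, 1), [y_index i, y_index i])]"

fun row_monomials :: "nat \<Rightarrow> nat \<Rightarrow> nat \<Rightarrow> frac list \<Rightarrow> (frac \<times> nat list) list" where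
  "row_monomials k i j [] = []"
| "row_monomials k i j (c # cs) = entry_monomials k i j c @ row_monomials k i (Suc j) cs"

fun mat_monomials :: "nat \<Rightarrow> nat \<Rightarrow> sym_inst \<Rightarrow> (frac \<times> nat list) list" where
  "mat_monomials k i [] = []"
| "mat_monomials k i (cs # A) = row_monomials k i 0 cs @ mat_monomials k (Suc i) A"

fun all_monomials :: "nat \<Rightarrow> sdp_inst \<Rightarrow> (frac \<times> nat list) list" where
  "all_monomials k [] = []"
| "all_monomials k (A # As) = mat_monomials k 0 A @ all_monomials (Suc k) As"

definition cubic_of :: "nat \<Rightarrow> sdp_inst \<Rightarrow> cubic_inst" where
  "cubic_of n As = (n, [((1, 1), [x_index 0, 0, 0]), ((- 1, 1), [0, 0])] @ all_monomials 0 As)"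

lemma enc_entry: "valid_frac c \<Longrightarrow> map enc_term (entry_monomials k i j c) = entry_terms k i j (raw c)"
  by (simp add: entry_monomials_def entry_terms_def enc_term_def enc_frac_raw raw_def binary_double valid_frac_def)

lemma enc_row: "\<forall>c \<in> set cs. valid_frac c \<Longrightarrow>
    map enc_term (row_monomials k i j cs) = row_terms k i j (map raw cs)"
  by (induction cs arbitrary: j) (simp_all add: enc_entry)

lemma enc_mat: "\<forall>cs \<in> set A. \<forall>c \<in> set cs. valid_frac c \<Longrightarrow>
    map enc_term (mat_monomials k i A) = mat_terms k i (map (map raw) A)"
  by (induction A arbitrary: i) (simp_all add: enc_row)

lemma enc_all: "\<forall>A \<in> set As. \<forall>cs \<in> set A. \<forall>c \<in> set cs. valid_frac c \<Longrightarrow>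
    map enc_term (all_monomials k As) = all_terms k (map (map (map raw)) As)"
  by (induction As arbitrary: k) (simp_all add: enc_mat)

lemma out_tree_eq: "\<forall>A \<in> set As. \<forall>cs \<in> set A. \<forall>c \<in> set cs. valid_frac c \<Longrightarrow>
    out_tree n (map (map (map raw)) As) = enc_cubic (cubic_of n As)"
  by (simp add: out_tree_def cubic_of_def enc_cubic_eq enc_all z_terms_def enc_term_def)

definition good_term :: "tree \<Rightarrow> bool" where
  "good_term t \<longleftrightarrow> (\<exists>c vs. valid_frac c \<and> t = term_tree (enc_frac c) vs)"

text \<open>Off the diagonal the output contains the input fraction literally; on it, a canonical
  even denominator is halved.\<close>

lemma good_entry:
  assumes "\<forall>t \<in> set (entry_terms k i j e). good_term t"
  shows "\<exists>c. valid_frac c \<and> e = raw c"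
proof -
  obtain c where c: "valid_frac c" "raw c = (fst e, if i = j then False # snd e else snd e)"
    using assms by (auto simp: entry_terms_def good_term_def term_tree_def enc_frac_raw)
  show ?thesis
  proof (cases "i = j")
    case True
    then have "binary (snd c) = False # snd e" using c(2) by (simp add: raw_def)
    then have "0 < snd c \<and> even (snd c) \<and> binary (snd c div 2) = snd e" by (rule binary_halve)
    then have "valid_frac (fst c, snd c div 2) \<and> e = raw (fst c, snd c div 2)"
      using c(2) by (auto simp: valid_frac_def raw_def prod_eq_iff elim!: evenE)
    then show ?thesis by blast
  next
    case False
    then have "e = raw c" using c(2) by (simp add: prod_eq_iff)
    then show ?thesis using c(1) by blast
  qed
qed

lemma good_row: "\<forall>t \<in> set (row_terms k i j es). good_term t \<Longrightarrow> \<exists>cs. (\<forall>c \<in> set cs. valid_frac c) \<and> es = map raw cs"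
proof (induction es arbitrary: j)
  case (Cons e es)
  then obtain cs where "\<forall>c \<in> set cs. valid_frac c" "es = map raw cs" by fastforce
  moreover obtain c where "valid_frac c" "e = raw c" using good_entry[of k i j e] Cons.prems by auto
  ultimately show ?case by (intro exI[of _ "c # cs"]) simp
qed simp

lemma good_mat: "\<forall>t \<in> set (mat_terms k i A). good_term t \<Longrightarrow>
    \<exists>B. (\<forall>cs \<in> set B. \<forall>c \<in> set cs. valid_frac c) \<and> A = map (map raw) B"
proof (induction A arbitrary: i)
  case (Cons es A)
  then obtain B where "\<forall>cs \<in> set B. \<forall>c \<in> set cs. valid_frac c" "A = map (map raw) B" by fastforce
  moreover obtain cs where "\<forall>c \<in> set cs. valid_frac c" "es = map raw cs"
    using good_row[of k i 0 es] Cons.prems by auto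
  ultimately show ?case by (intro exI[of _ "cs # B"]) simp
qed simp

lemma good_all: "\<forall>t \<in> set (all_terms k L). good_term t \<Longrightarrow>
    \<exists>As. (\<forall>A \<in> set As. \<forall>cs \<in> set A. \<forall>c \<in> set cs. valid_frac c) \<and> L = map (map (map raw)) As"
proof (induction L arbitrary: k)
  case (Cons A L)
  then obtain As where "\<forall>A \<in> set As. \<forall>cs \<in> set A. \<forall>c \<in> set cs. valid_frac c" "L = map (map (map raw)) As"
    by fastforce
  moreover obtain B where "\<forall>cs \<in> set B. \<forall>c \<in> set cs. valid_frac c" "A = map (map raw) B"
    using good_mat[of k 0 A] Cons.prems by auto
  ultimately show ?case by (intro exI[of _ "B # As"]) simp
qed simp

lemma triangular_map: "triangular i (map (map f) A) = triangular i A"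
  by (induction A arbitrary: i) simp_all

lemma matrices_map: "matrices k m (map (map (map f)) As) = matrices k m As"
  by (induction As arbitrary: k m) (simp_all add: triangular_map)

lemma triangular_iff: "triangular i A \<longleftrightarrow> (\<forall>r < length A. length (A ! r) = Suc (i + r))"
  by (induction A arbitrary: i) (auto simp: nth_Cons All_less_Suc2 split: nat.split)

lemma matrices_Suc: "matrices (Suc k) m As \<longleftrightarrow> (\<forall>A \<in> set As. A \<noteq> [] \<and> triangular 0 A \<and> length A = m)"
  by (induction As arbitrary: k m) auto

lemma matrices_0: "As \<noteq> [] \<Longrightarrow> matrices 0 0 As \<longleftrightarrow>
    (\<exists>m \<ge> 1. \<forall>A \<in> set As. length A = m \<and> triangular 0 A)"
  by (cases As) (auto simp: matrices_Suc Suc_le_eq)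

lemma valid_sym_iff: "valid_sym m A \<longleftrightarrow>
    length A = m \<and> triangular 0 A \<and> (\<forall>cs \<in> set A. \<forall>c \<in> set cs. valid_frac c)"
  by (auto simp: valid_sym_def triangular_iff all_set_conv_all_nth)

lemma valid_sdp_iff: "(\<exists>m n. valid_sdp m n As) \<longleftrightarrow>
    2 \<le> length As \<and> matrices 0 0 As \<and> (\<forall>A \<in> set As. \<forall>cs \<in> set A. \<forall>c \<in> set cs. valid_frac c)"
proof
  assume "\<exists>m n. valid_sdp m n As"
  then obtain m n where v: "m \<ge> 1" "n \<ge> 1" "length As = n + 1" "\<forall>A \<in> set As. valid_sym m A"
    unfolding valid_sdp_def by blast
  then have "As \<noteq> []" by auto
  then show "2 \<le> length As \<and> matrices 0 0 As \<and> (\<forall>A \<in> set As. \<forall>cs \<in> set A. \<forall>c \<in> set cs. valid_frac c)"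
    using v by (auto simp: matrices_0 valid_sym_iff)
next
  assume *: "2 \<le> length As \<and> matrices 0 0 As \<and> (\<forall>A \<in> set As. \<forall>cs \<in> set A. \<forall>c \<in> set cs. valid_frac c)"
  then have "As \<noteq> []" by auto
  then obtain m where "m \<ge> 1" "\<forall>A \<in> set As. length A = m \<and> triangular 0 A" using * matrices_0 by blast
  then have "valid_sdp m (length As - 1) As" using * by (auto simp: valid_sdp_def valid_sym_iff)
  then show "\<exists>m n. valid_sdp m n As" by blast
qed

text \<open>This justifies copying numerals unchecked: an output that encodes a valid polynomial can
  only come from canonical input fractions, and injectivity of the encoding then identifies the
  polynomial.\<close>

lemma SDPSF_parsed:
  assumes "parsed w L" "out_tree (length w) L = enc_cubic I" "valid_cubic I"
  shows "\<exists>As m n. valid_sdp m n As \<and> w = serialize (enc_sdp As) \<and> I = cubic_of (length w) As"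
proof -
  obtain n ts where I: "I = (n, ts)" by (cases I)
  have ts: "map enc_term ts = z_terms @ all_terms 0 L"
    using assms(2) by (simp add: I enc_cubic_eq out_tree_def)
  have "\<forall>t \<in> set (map enc_term ts). good_term t"
  proof
    fix t assume "t \<in> set (map enc_term ts)"
    then obtain c vs where "(c, vs) \<in> set ts" "t = term_tree (enc_frac c) vs"
      by (auto simp: enc_term_def)
    moreover from this have "valid_frac c" using assms(3) by (auto simp: valid_cubic_def I)
    ultimately show "good_term t" unfolding good_term_def by blast
  qed
  then have "\<forall>t \<in> set (all_terms 0 L). good_term t" unfolding ts by simp
  then obtain As where As: "\<forall>A \<in> set As. \<forall>cs \<in> set A. \<forall>c \<in> set cs. valid_frac c" "L = map (map (map raw)) As"
    using good_all by blast
  have "w = serialize (enc_sdp As)" using assms(1) As(2) by (simp add: parsed_def enc_sdp_raw)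
  moreover have "\<exists>m n. valid_sdp m n As"
    using assms(1) As by (auto simp: valid_sdp_iff parsed_def matrices_map)
  moreover have "I = cubic_of (length w) As"
    using assms(2) As inj_enc_cubic by (metis out_tree_eq injD)
  ultimately show ?thesis by blast
qed

lemma parsed_sdp: "valid_sdp m n As \<Longrightarrow> parsed (serialize (enc_sdp As)) (map (map (map raw)) As)"
  using valid_sdp_iff[of As] by (auto simp: parsed_def enc_sdp_raw matrices_map)

section \<open>Validity of the output polynomial\<close>

definition valid_monomial :: "nat \<Rightarrow> frac \<times> nat list \<Rightarrow> bool" where
  "valid_monomial N t \<longleftrightarrow> valid_frac (fst t) \<and> length (snd t) \<le> 3 \<and> (\<forall>v \<in> set (snd t). v < N)"

lemma valid_entry_monomials:
  "valid_frac c \<Longrightarrow> x_index k < N \<Longrightarrow> y_index i < N \<Longrightarrow> y_index j < N \<Longrightarrow>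
   \<forall>t \<in> set (entry_monomials k i j c). valid_monomial N t"
  by (simp add: entry_monomials_def valid_frac_def valid_monomial_def)

lemma valid_row_monomials:
  "\<forall>c \<in> set cs. valid_frac c \<Longrightarrow> x_index k < N \<Longrightarrow> y_index i < N \<Longrightarrow> \<forall>l < j + length cs. y_index l < N \<Longrightarrow>
   \<forall>t \<in> set (row_monomials k i j cs). valid_monomial N t"
proof (induction cs arbitrary: j)
  case (Cons d cs)
  have "y_index j < N" "\<forall>l < Suc j + length cs. y_index l < N" using Cons.prems(4) by simp_all
  then have "\<forall>t \<in> set (entry_monomials k i j d). valid_monomial N t"
    "\<forall>t \<in> set (row_monomials k i (Suc j) cs). valid_monomial N t"
    using Cons.prems(1-3) by (intro valid_entry_monomials Cons.IH; simp)+
  then show ?case by auto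
qed simp

lemma valid_mat_monomials:
  "\<forall>cs \<in> set A. \<forall>c \<in> set cs. valid_frac c \<Longrightarrow> x_index k < N \<Longrightarrow> triangular i A \<Longrightarrow>
   \<forall>l < i + length A. y_index l < N \<Longrightarrow> \<forall>t \<in> set (mat_monomials k i A). valid_monomial N t"
proof (induction A arbitrary: i)
  case (Cons cs A)
  have len: "length cs = Suc i" and tri: "triangular (Suc i) A" using Cons.prems(3) by simp_all
  have "y_index i < N" "\<forall>l < 0 + length cs. y_index l < N" "\<forall>l < Suc i + length A. y_index l < N"
    using Cons.prems(4) len by simp_all
  then have "\<forall>t \<in> set (row_monomials k i 0 cs). valid_monomial N t"
    "\<forall>t \<in> set (mat_monomials k (Suc i) A). valid_monomial N t"
    using Cons.prems(1,2) tri by (intro valid_row_monomials Cons.IH; simp)+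
  then show ?case by auto
qed simp

lemma valid_all_monomials:
  "\<forall>A \<in> set As. \<forall>cs \<in> set A. \<forall>c \<in> set cs. valid_frac c \<Longrightarrow> \<forall>l < k + length As. x_index l < N \<Longrightarrow>
   \<forall>A \<in> set As. triangular 0 A \<and> (\<forall>l < length A. y_index l < N) \<Longrightarrow>
   \<forall>t \<in> set (all_monomials k As). valid_monomial N t"
proof (induction As arbitrary: k)
  case (Cons A As)
  have "x_index k < N" "\<forall>l < Suc k + length As. x_index l < N" using Cons.prems(2) by simp_all
  then have "\<forall>t \<in> set (mat_monomials k 0 A). valid_monomial N t"
    "\<forall>t \<in> set (all_monomials (Suc k) As). valid_monomial N t"
    using Cons.prems(1,3) by (intro valid_mat_monomials Cons.IH; simp)+
  then show ?case by auto
qed simp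

text \<open>Each matrix, and each row of the first matrix, takes at least two bits, and the brackets
  around them account for the constant offsets. So the input is longer than every index.\<close>

lemma index_bounds:
  assumes v: "valid_sdp m n As" and N: "N = length (serialize (enc_sdp As))"
  shows "k \<le> n \<Longrightarrow> x_index k < N" "i < m \<Longrightarrow> y_index i < N"
proof -
  let ?L = "map (map (map raw)) As"
  have N': "N = 4 + length (serialize_list (map mat_tree ?L))"
    unfolding N enc_sdp_raw serialize_sdp by simp
  have "2 * length As \<le> length (serialize_list (map mat_tree ?L))"
    using length_serialize_list[of "map mat_tree ?L"] by simp
  then show "k \<le> n \<Longrightarrow> x_index k < N" using v N' by (simp add: valid_sdp_def x_index_def)
  obtain A As' where As: "As = A # As'" using v by (cases As) (auto simp: valid_sdp_def)
  have "length A = m" using v As by (simp add: valid_sdp_def valid_sym_def)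
  moreover have "2 * length A \<le> length (serialize_list (map row_tree (map (map raw) A)))"
    using length_serialize_list[of "map row_tree (map (map raw) A)"] by simp
  ultimately have "2 * m \<le> N" unfolding N' As by (simp add: serialize_mat)
  moreover have "2 * m \<noteq> N"
    using \<open>length A = m\<close> length_serialize_list[of "map row_tree (map (map raw) A)"]
    unfolding N' As by (simp add: serialize_mat)
  ultimately show "i < m \<Longrightarrow> y_index i < N" by (simp add: y_index_def)
qed

lemma valid_cubic_of:
  assumes v: "valid_sdp m n As" and N: "N = length (serialize (enc_sdp As))"
  shows "valid_cubic (cubic_of N As)"
proof -
  note b = index_bounds[OF v N]
  have "0 < N" using b(1)[of 0] by simp
  moreover have "\<forall>t \<in> set (all_monomials 0 As). valid_monomial N t"
    by (rule valid_all_monomials) (use v b in \<open>auto simp: valid_sdp_def valid_sym_iff\<close>)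
  ultimately have "\<forall>t \<in> set (snd (cubic_of N As)). valid_monomial N t"
    using b(1)[of 0] by (simp add: cubic_of_def valid_monomial_def valid_frac_def)
  then show ?thesis
    using \<open>0 < N\<close> by (auto simp: valid_cubic_def cubic_of_def valid_monomial_def Suc_le_eq)
qed

section \<open>Value of the output polynomial\<close>

definition monomial_value :: "real vec \<Rightarrow> frac \<times> nat list \<Rightarrow> real" where
  "monomial_value v t = frac_val (fst t) * (\<Prod>l\<leftarrow>snd t. v $ l)"

definition entry_value :: "real vec \<Rightarrow> nat \<Rightarrow> nat \<Rightarrow> nat \<Rightarrow> frac \<Rightarrow> real" where
  "entry_value v k i j c = (if i = j then frac_val c / 2 else frac_val c) *
     v $ x_index k * v $ y_index i * v $ y_index j - (v $ y_index i)\<^sup>2"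

lemma sum_entry_monomials: "(\<Sum>t\<leftarrow>entry_monomials k i j c. monomial_value v t) = entry_value v k i j c"
  by (simp add: entry_monomials_def monomial_value_def entry_value_def frac_val_def power2_eq_square)

lemma sum_row_monomials:
  "(\<Sum>t\<leftarrow>row_monomials k i j cs. monomial_value v t) = (\<Sum>l<length cs. entry_value v k i (j + l) (cs ! l))"
  by (induction cs arbitrary: j) (simp_all add: sum_entry_monomials sum.lessThan_Suc_shift del: sum.lessThan_Suc)

lemma sum_mat_monomials:
  "(\<Sum>t\<leftarrow>mat_monomials k i A. monomial_value v t) =
     (\<Sum>r<length A. \<Sum>l<length (A ! r). entry_value v k (i + r) l (A ! r ! l))"
  by (induction A arbitrary: i) (simp_all add: sum_row_monomials sum.lessThan_Suc_shift del: sum.lessThan_Suc)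

lemma sum_all_monomials:
  "(\<Sum>t\<leftarrow>all_monomials k As. monomial_value v t) =
     (\<Sum>p<length As. \<Sum>r<length (As ! p). \<Sum>l<length (As ! p ! r). entry_value v (k + p) r l (As ! p ! r ! l))"
  by (induction As arbitrary: k) (simp_all add: sum_mat_monomials sum.lessThan_Suc_shift del: sum.lessThan_Suc)

text \<open>The square contains an off-diagonal pair twice and the triangle once; halving the
  diagonal gives it the same ratio.\<close>

lemma sum_triangle:
  fixes s :: "nat \<Rightarrow> nat \<Rightarrow> real"
  assumes "\<And>i j. s i j = s j i"
  shows "(\<Sum>i<m. \<Sum>j<Suc i. if i = j then s i j / 2 else s i j) = (\<Sum>i<m. \<Sum>j<m. s i j) / 2"
proof (induction m)
  case (Suc m)
  have "(\<Sum>j<m. if m = j then s m j / 2 else s m j) = (\<Sum>j<m. s m j)"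
    by (rule sum.cong) auto
  then have 1: "(\<Sum>j<Suc m. if m = j then s m j / 2 else s m j) = (\<Sum>j<m. s m j) + s m m / 2"
    by simp
  have "(\<Sum>i<m. s i m) = (\<Sum>j<m. s m j)"
    by (rule sum.cong[OF refl]) (rule assms)
  then have "(\<Sum>i<Suc m. \<Sum>j<Suc m. s i j) = (\<Sum>i<m. \<Sum>j<m. s i j) + 2 * (\<Sum>j<m. s m j) + s m m"
    by (simp add: sum.distrib)
  with 1 Suc show ?case by (simp only: sum.lessThan_Suc[of _ m]) simp
qed simp

abbreviation coeff_fun :: "sdp_inst \<Rightarrow> nat \<Rightarrow> nat \<Rightarrow> nat \<Rightarrow> real" where
  "coeff_fun As \<equiv> \<lambda>k i j. sym_mat (As ! k) $$ (i, j)"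

lemma sym_mat_sym: "i < length A \<Longrightarrow> j < length A \<Longrightarrow> sym_mat A $$ (i, j) = sym_mat A $$ (j, i)"
  by (auto simp: sym_mat_def)

lemma cubic_eval_form:
  assumes v: "valid_sdp m n As"
  shows "cubic_eval (cubic_of N As) x = cubic_form m (Suc n) (coeff_fun As) (\<lambda>i. (n + 1) * (i + 1))
    (\<lambda>k. x $ x_index k) (x $ 0) (\<lambda>i. x $ y_index i)"
proof -
  let ?X = "\<lambda>k. x $ x_index k" and ?Y = "\<lambda>i. x $ y_index i"
  have len: "length As = Suc n" using v by (simp add: valid_sdp_def)
  have A: "length (As ! k) = m \<and> (\<forall>i<m. length (As ! k ! i) = Suc i)" if "k < Suc n" for k
    using v that len by (auto simp: valid_sdp_def valid_sym_def)
  have mat: "(\<Sum>i<m. \<Sum>j<Suc i. entry_value x k i j (As ! k ! i ! j)) =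
      ?X k * quad m (coeff_fun As k) ?Y / 2 - (\<Sum>i<m. (i + 1) * (?Y i)\<^sup>2)" if k: "k < Suc n" for k
  proof -
    \<comment> \<open>\<open>sum_triangle\<close> asks for symmetry at all indices, but matrix
      entries out of range are unspecified, hence the cut-off.\<close>
    define s where "s = (\<lambda>i j. if i < m \<and> j < m then ?X k * coeff_fun As k i j * ?Y i * ?Y j else 0)"
    have "entry_value x k i j (As ! k ! i ! j) = (if i = j then s i j / 2 else s i j) - (?Y i)\<^sup>2"
      if "i < m" "j < Suc i" for i j
      using that A[OF k] by (auto simp: entry_value_def s_def sym_mat_def)
    then have "(\<Sum>i<m. \<Sum>j<Suc i. entry_value x k i j (As ! k ! i ! j)) =
        (\<Sum>i<m. \<Sum>j<Suc i. (if i = j then s i j / 2 else s i j) - (?Y i)\<^sup>2)"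
      by (intro sum.cong refl) (simp only: lessThan_iff)
    \<comment> \<open>The inner sum over \<open>j < Suc i\<close> repeats the square
      \<open>i + 1\<close> times, the source of this factor in the weights.\<close>
    also have "\<dots> = (\<Sum>i<m. \<Sum>j<Suc i. if i = j then s i j / 2 else s i j) - (\<Sum>i<m. (i + 1) * (?Y i)\<^sup>2)"
      by (simp only: sum_subtractf sum_constant card_lessThan) simp
    also have "(\<Sum>i<m. \<Sum>j<Suc i. if i = j then s i j / 2 else s i j) = (\<Sum>i<m. \<Sum>j<m. s i j) / 2"
      by (rule sum_triangle) (use sym_mat_sym[of _ "As ! k"] A[OF k] in \<open>auto simp: s_def\<close>)
    also have "(\<Sum>i<m. \<Sum>j<m. s i j) = ?X k * quad m (coeff_fun As k) ?Y"
      by (simp add: s_def quad_def sum_distrib_left mult.assoc)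
    finally show ?thesis .
  qed
  have "cubic_eval (cubic_of N As) x = (?X 0 - 1) * (x $ 0)\<^sup>2 + (\<Sum>t\<leftarrow>all_monomials 0 As. monomial_value x t)"
    by (simp add: cubic_eval_def cubic_of_def monomial_value_def[abs_def] case_prod_unfold frac_val_def
        power2_eq_square algebra_simps)
  also have "(\<Sum>t\<leftarrow>all_monomials 0 As. monomial_value x t) =
      (\<Sum>k<Suc n. \<Sum>i<m. \<Sum>j<Suc i. entry_value x k i j (As ! k ! i ! j))"
    unfolding sum_all_monomials len using A by (intro sum.cong refl) simp_all
  also have "\<dots> = (\<Sum>k<Suc n. ?X k * quad m (coeff_fun As k) ?Y / 2 - (\<Sum>i<m. (i + 1) * (?Y i)\<^sup>2))"
    by (intro sum.cong refl mat) (simp only: lessThan_iff)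
  also have "\<dots> = (\<Sum>k<Suc n. ?X k * quad m (coeff_fun As k) ?Y) / 2 - (\<Sum>i<m. (n + 1) * (i + 1) * (?Y i)\<^sup>2)"
    by (simp only: sum_subtractf sum_constant card_lessThan sum_divide_distrib[symmetric])
      (simp only: sum_distrib_left of_nat_mult mult.assoc Suc_eq_plus1)
  finally show ?thesis by (simp only: cubic_form_def of_nat_mult)
qed

lemma cubic_form_cong:
  assumes "\<And>k. k < N \<Longrightarrow> x k = x' k" "z = z'" "\<And>i. i < m \<Longrightarrow> y i = y' i" "0 < N"
  shows "cubic_form m N a d x z y = cubic_form m N a d x' z' y'"
proof -
  have "quad m (a k) y = quad m (a k) y'" for k using assms(3) by (rule quad_cong)
  then show ?thesis using assms by (simp add: cubic_form_def)
qed

section \<open>Homogenisation, definiteness and local minima\<close>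

definition homogenize :: "real vec \<Rightarrow> nat \<Rightarrow> real" where
  "homogenize x k = (if k = 0 then 1 else x $ (k - 1))"

lemma pencil_quad:
  assumes "v \<in> carrier_vec m"
  shows "v \<bullet> (pencil m n A x *\<^sub>v v) =
    (\<Sum>k<Suc n. homogenize x k * quad m (\<lambda>i j. A k $$ (i, j)) (\<lambda>i. v $ i))"
proof -
  have "(\<Sum>k=1..n. x $ (k - 1) * A k $$ (i, j)) = (\<Sum>k<n. x $ k * A (Suc k) $$ (i, j))" for i j
    by (rule sum.reindex_bij_witness[of _ Suc "\<lambda>k. k - 1"]) auto
  then have entry: "A 0 $$ (i, j) + (\<Sum>k=1..n. x $ (k - 1) * A k $$ (i, j)) =
      (\<Sum>k<Suc n. homogenize x k * A k $$ (i, j))" for i j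
    by (simp add: sum.lessThan_Suc_shift homogenize_def del: sum.lessThan_Suc)
  have "v \<bullet> (pencil m n A x *\<^sub>v v) = (\<Sum>i<m. v $ i * (\<Sum>j<m. pencil m n A x $$ (i, j) * v $ j))"
    using assms by (auto simp: scalar_prod_def pencil_def lessThan_atLeast0 intro!: sum.cong)
  also have "\<dots> = quad m (\<lambda>i j. \<Sum>k<Suc n. homogenize x k * A k $$ (i, j)) (\<lambda>i. v $ i)"
    unfolding quad_def using entry
    by (intro sum.cong refl) (simp add: pencil_def sum_distrib_left mult_ac del: sum.lessThan_Suc)
  finally show ?thesis by (simp only: quad_sum)
qed

lemma pos_definite_pencil_iff:
  assumes v: "valid_sdp m n As"
  shows "pos_definite m (pencil m n (\<lambda>k. sym_mat (As ! k)) x) \<longleftrightarrow>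
    (\<forall>u. (\<exists>i<m. u i \<noteq> 0) \<longrightarrow> 0 < (\<Sum>k<Suc n. homogenize x k * quad m (coeff_fun As k) u))"
proof -
  let ?M = "pencil m n (\<lambda>k. sym_mat (As ! k)) x"
  have A: "length (As ! k) = m" if "k \<le> n" for k
    using v that by (auto simp: valid_sdp_def valid_sym_def)
  have "transpose_mat ?M = ?M"
  proof (rule eq_matI)
    fix i j assume "i < dim_row ?M" "j < dim_col ?M"
    then show "transpose_mat ?M $$ (i, j) = ?M $$ (i, j)"
      using sym_mat_sym[of i _ j] A by (auto simp: pencil_def intro!: sum.cong)
  qed (simp_all add: pencil_def)
  moreover have "?M \<in> carrier_mat m m" by (simp add: pencil_def)
  ultimately have "pos_definite m ?M \<longleftrightarrow> (\<forall>u \<in> carrier_vec m. u \<noteq> 0\<^sub>v m \<longrightarrow>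
      0 < (\<Sum>k<Suc n. homogenize x k * quad m (coeff_fun As k) (\<lambda>i. u $ i)))"
    unfolding pos_definite_def using pencil_quad by auto
  also have "\<dots> \<longleftrightarrow> (\<forall>u. (\<exists>i<m. u i \<noteq> 0) \<longrightarrow>
      0 < (\<Sum>k<Suc n. homogenize x k * quad m (coeff_fun As k) u))"
  proof (intro iffI allI ballI impI)
    fix u :: "nat \<Rightarrow> real" assume *: "\<forall>u \<in> carrier_vec m. u \<noteq> 0\<^sub>v m \<longrightarrow>
      0 < (\<Sum>k<Suc n. homogenize x k * quad m (coeff_fun As k) (\<lambda>i. u $ i))" and u: "\<exists>i<m. u i \<noteq> 0"
    have "vec m u \<noteq> 0\<^sub>v m" using u by (auto simp: vec_eq_iff)
    then have "0 < (\<Sum>k<Suc n. homogenize x k * quad m (coeff_fun As k) (\<lambda>i. vec m u $ i))"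
      using * by simp
    moreover have "quad m a (\<lambda>i. vec m u $ i) = quad m a u" for a by (rule quad_cong) simp
    ultimately show "0 < (\<Sum>k<Suc n. homogenize x k * quad m (coeff_fun As k) u)" by simp
  next
    fix u :: "real vec" assume *: "\<forall>u. (\<exists>i<m. u i \<noteq> 0) \<longrightarrow>
      0 < (\<Sum>k<Suc n. homogenize x k * quad m (coeff_fun As k) u)" and u: "u \<in> carrier_vec m" "u \<noteq> 0\<^sub>v m"
    have "\<exists>i<m. u $ i \<noteq> 0" using u by (auto simp: vec_eq_iff)
    then show "0 < (\<Sum>k<Suc n. homogenize x k * quad m (coeff_fun As k) (\<lambda>i. u $ i))" using * by blast
  qed
  finally show ?thesis .
qed

lemma abs_index_le_norm:
  assumes "v \<in> carrier_vec N" "l < N"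
  shows "\<bar>v $ l\<bar> \<le> euclidean_norm v"
proof -
  have "(v $ l)\<^sup>2 \<le> (\<Sum>i<N. (v $ i)\<^sup>2)" using assms(2) by (intro member_le_sum) auto
  also have "\<dots> = v \<bullet> v" using assms(1) by (auto simp: scalar_prod_def power2_eq_square lessThan_atLeast0)
  finally show ?thesis unfolding euclidean_norm_def by (rule real_le_rsqrt[of "\<bar>_\<bar>", simplified])
qed

lemma norm_smult_vec:
  assumes "w \<in> carrier_vec N"
  shows "euclidean_norm (s \<cdot>\<^sub>v w) = \<bar>s\<bar> * euclidean_norm w"
proof -
  have "(s \<cdot>\<^sub>v w) \<bullet> (s \<cdot>\<^sub>v w) = s\<^sup>2 * (w \<bullet> w)" using assms by (simp add: power2_eq_square)
  then show ?thesis by (simp add: euclidean_norm_def real_sqrt_mult)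
qed

lemma local_minimum_iff:
  assumes v: "valid_sdp m n As" and N: "N = length (serialize (enc_sdp As))"
  shows "(\<exists>x. local_minimum N (cubic_eval (cubic_of N As)) x) \<longleftrightarrow>
    (\<exists>x \<in> carrier_vec n. pos_definite m (pencil m n (\<lambda>k. sym_mat (As ! k)) x))"
proof
  let ?d = "\<lambda>i. real ((n + 1) * (i + 1))" and ?p = "cubic_eval (cubic_of N As)"
  let ?F = "cubic_form m (Suc n) (coeff_fun As) ?d"
  note eval = cubic_eval_form[OF v, of N]
  note idx = index_bounds[OF v N]
  assume "\<exists>x. local_minimum N ?p x"
  then obtain x \<epsilon> where x: "x \<in> carrier_vec N" and \<epsilon>: "0 < \<epsilon>"
    and min: "\<And>y. y \<in> carrier_vec N \<Longrightarrow> euclidean_norm (y - x) \<le> \<epsilon> \<Longrightarrow> ?p x \<le> ?p y"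
    unfolding local_minimum_def by blast
  let ?X = "\<lambda>k. x $ x_index k"
  have "0 \<le> ?F ?X z u" for z u
  proof -
    \<comment> \<open>The direction changes only \<open>z\<close> and the \<open>y\<close>
      variables, so \<open>x\<close> stays fixed and the polynomial is quadratic along it.\<close>
    define w where "w = vec N (\<lambda>l. if l = 0 then z else if odd l then u (l div 2) else 0)"
    define s where "s = \<epsilon> / (1 + euclidean_norm w)"
    have w: "w \<in> carrier_vec N" by (simp add: w_def)
    have nw: "0 \<le> euclidean_norm w" by (simp add: euclidean_norm_def w_def scalar_prod_def sum_nonneg)
    then have s: "0 < s" "s * euclidean_norm w \<le> \<epsilon>" using \<epsilon> by (simp_all add: s_def field_simps)
    have "?p x \<le> ?p (x + c \<cdot>\<^sub>v w)" if "\<bar>c\<bar> = s" for c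
    proof (rule min)
      have "x + c \<cdot>\<^sub>v w - x = c \<cdot>\<^sub>v w" using x w by (auto simp: vec_eq_iff)
      then show "euclidean_norm (x + c \<cdot>\<^sub>v w - x) \<le> \<epsilon>" using s that norm_smult_vec[OF w] by simp
    qed (use x w in simp)
    moreover have "?p (x + c \<cdot>\<^sub>v w) = ?F ?X (x $ 0 + c * z) (\<lambda>i. x $ y_index i + c * u i)" for c
    proof -
      have "0 < N" using idx(1)[of 0] by simp
      moreover have "w $ x_index k = 0" if "k \<le> n" for k
        using idx(1)[OF that] by (simp add: w_def x_index_def)
      moreover have "w $ y_index i = u i" if "i < m" for i
        using idx(2)[OF that] by (simp add: w_def y_index_def)
      ultimately show ?thesis
        unfolding eval using x w idx by (intro cubic_form_cong) (auto simp: w_def)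
    qed
    ultimately have "?F ?X (x $ 0) (\<lambda>i. x $ y_index i) \<le> ?F ?X (x $ 0 + c * z) (\<lambda>i. x $ y_index i + c * u i)"
      if "\<bar>c\<bar> = s" for c using that eval by simp
    \<comment> \<open>The two shifted values sum to at least twice the central value, so the
      remaining term of the parallelogram law is nonnegative.\<close>
    from this[of s] this[of "- s"] have "0 \<le> 2 * s\<^sup>2 * ?F ?X z u"
      using cubic_form_parallelogram[of m "Suc n" "coeff_fun As" ?d ?X "x $ 0" s z "\<lambda>i. x $ y_index i" u] s(1)
      by simp
    then show ?thesis using s(1) by (simp add: zero_le_mult_iff)
  qed
  then have feas: "1 \<le> ?X 0 \<and> (\<forall>u :: nat \<Rightarrow> real. (\<exists>i<m. u i \<noteq> 0) \<longrightarrow>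
      0 < (\<Sum>k<Suc n. ?X k * quad m (coeff_fun As k) u))"
    by (rule feasible_if_cubic_form_nonneg) (simp only: of_nat_0_less_iff, simp)
  \<comment> \<open>Division by the homogenising coordinate is possible and preserves signs since it
    is at least 1.\<close>
  define x' where "x' = vec n (\<lambda>k. ?X (Suc k) / ?X 0)"
  have hom: "homogenize x' k = ?X k / ?X 0" if "k < Suc n" for k
    using that feas by (auto simp: homogenize_def x'_def)
  have "(\<Sum>k<Suc n. homogenize x' k * quad m (coeff_fun As k) u) =
      (\<Sum>k<Suc n. ?X k * quad m (coeff_fun As k) u) / ?X 0" for u
    unfolding sum_divide_distrib using hom by (intro sum.cong) auto
  then have "pos_definite m (pencil m n (\<lambda>k. sym_mat (As ! k)) x')"
    unfolding pos_definite_pencil_iff[OF v] using feas by simp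
  then show "\<exists>x \<in> carrier_vec n. pos_definite m (pencil m n (\<lambda>k. sym_mat (As ! k)) x)"
    by (intro bexI[of _ x']) (simp_all add: x'_def)
next
  let ?d = "\<lambda>i. real ((n + 1) * (i + 1))" and ?p = "cubic_eval (cubic_of N As)"
  let ?F = "cubic_form m (Suc n) (coeff_fun As) ?d"
  note eval = cubic_eval_form[OF v, of N]
  note idx = index_bounds[OF v N]
  assume "\<exists>x \<in> carrier_vec n. pos_definite m (pencil m n (\<lambda>k. sym_mat (As ! k)) x)"
  then obtain x where "pos_definite m (pencil m n (\<lambda>k. sym_mat (As ! k)) x)" by blast
  then have pos: "0 < (\<Sum>k<Suc n. homogenize x k * quad m (coeff_fun As k) u)" if "\<exists>i<m. u i \<noteq> 0" for u
    using pos_definite_pencil_iff[OF v] that by blast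
  have "\<exists>t \<epsilon>. 0 < \<epsilon> \<and> (\<forall>x' z y. (\<forall>k<Suc n. \<bar>x' k - t * homogenize x k\<bar> \<le> \<epsilon>) \<longrightarrow> 0 \<le> ?F x' z y)"
    by (rule cubic_form_nonneg_near[OF pos]) (simp_all add: homogenize_def)
  then obtain t \<epsilon> where \<epsilon>: "0 < \<epsilon>"
    and near: "\<And>x' z y. \<forall>k<Suc n. \<bar>x' k - t * homogenize x k\<bar> \<le> \<epsilon> \<Longrightarrow> 0 \<le> ?F x' z y"
    by blast
  \<comment> \<open>\<open>z\<close> and all \<open>y\<close> are 0. Even coordinates beyond those
    of \<open>x\<close> receive unspecified values, which is harmless as the polynomial does not
    contain them.\<close>
  define c where "c = vec N (\<lambda>l. if even l \<and> l \<noteq> 0 then t * homogenize x (l div 2 - 1) else 0)"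
  have cx: "c $ x_index k = t * homogenize x k" if "k < Suc n" for k
    using idx(1)[of k] that by (simp add: c_def x_index_def)
  \<comment> \<open>Every monomial has two factors among \<open>z\<close> and the \<open>y\<close>
    variables. With the value 0 at \<open>c\<close>, minimality reduces to nonnegativity
    nearby.\<close>
  have "?p c = 0"
  proof -
    have "c $ 0 = 0" using idx(1)[of 0] by (simp add: c_def)
    moreover have "c $ y_index i = 0" if "i < m" for i
      using idx(2)[OF that] by (simp add: c_def y_index_def)
    ultimately show ?thesis by (simp add: eval cubic_form_def quad_def)
  qed
  moreover have "0 \<le> ?p y" if y: "y \<in> carrier_vec N" "euclidean_norm (y - c) \<le> \<epsilon>" for y
    unfolding eval
  proof (rule near, intro allI impI)
    fix k assume k: "k < Suc n"
    have "\<bar>(y - c) $ x_index k\<bar> \<le> euclidean_norm (y - c)"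
      using y idx(1)[of k] k by (intro abs_index_le_norm[of _ N]) (auto simp: c_def)
    then show "\<bar>y $ x_index k - t * homogenize x k\<bar> \<le> \<epsilon>"
      using y(2) cx[OF k] idx(1)[of k] k y(1) by (simp add: c_def)
  qed
  ultimately have "local_minimum N ?p c"
    unfolding local_minimum_def using \<epsilon> by (auto simp: c_def)
  then show "\<exists>x. local_minimum N ?p x" by blast
qed

text \<open>Malformed inputs are excluded in two ways: a wrong shape gives \<open>None\<close>, and
  an invalid fraction gives an output that encodes no valid polynomial.\<close>

lemma SDPSF_iff: "w \<in> SDPSF \<longleftrightarrow> (\<exists>u. reduction_fun w = Some u \<and> u \<in> CUBIC_LOCAL_MIN)"
proof
  assume "w \<in> SDPSF"
  then obtain As m n where v: "valid_sdp m n As" and w: "w = serialize (enc_sdp As)"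
    and feas: "\<exists>x \<in> carrier_vec n. pos_definite m (pencil m n (\<lambda>k. sym_mat (As ! k)) x)"
    unfolding SDPSF_def by blast
  have "out_tree (length w) (map (map (map raw)) As) = enc_cubic (cubic_of (length w) As)"
    using valid_sdp_iff v by (intro out_tree_eq) blast
  then have "reduction_fun w = Some (serialize (enc_cubic (cubic_of (length w) As)))"
    using reduction_fun_eq[OF parsed_sdp[OF v]] w by simp
  moreover have "serialize (enc_cubic (cubic_of (length w) As)) \<in> CUBIC_LOCAL_MIN"
  proof -
    have "valid_cubic (cubic_of (length w) As)" using valid_cubic_of[OF v] w by simp
    moreover have "\<exists>x. local_minimum (length w) (cubic_eval (cubic_of (length w) As)) x"
      using local_minimum_iff[OF v] w feas by blast
    moreover have "fst (cubic_of (length w) As) = length w" by (simp add: cubic_of_def)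
    ultimately show ?thesis
      unfolding CUBIC_LOCAL_MIN_def mem_Collect_eq by (intro exI[of _ "cubic_of (length w) As"]) simp
  qed
  ultimately show "\<exists>u. reduction_fun w = Some u \<and> u \<in> CUBIC_LOCAL_MIN" by blast
next
  assume "\<exists>u. reduction_fun w = Some u \<and> u \<in> CUBIC_LOCAL_MIN"
  then obtain u where u: "reduction_fun w = Some u" "u \<in> CUBIC_LOCAL_MIN" by blast
  obtain L where L: "parsed w L" using u(1) unfolding reduction_fun_def by (auto split: if_splits)
  obtain I where I: "u = serialize (enc_cubic I)" "valid_cubic I" "\<exists>x. local_minimum (fst I) (cubic_eval I) x"
    using u(2) unfolding CUBIC_LOCAL_MIN_def by blast
  have "out_tree (length w) L = enc_cubic I"
    using reduction_fun_eq[OF L] u(1) I(1) injD[OF inj_serialize] by simp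
  then obtain As m n where v: "valid_sdp m n As" "w = serialize (enc_sdp As)" "I = cubic_of (length w) As"
    using SDPSF_parsed[OF L _ I(2)] by blast
  have "\<exists>x. local_minimum (length w) (cubic_eval (cubic_of (length w) As)) x"
    using I(3) unfolding v(3) by (simp add: cubic_of_def)
  then have "\<exists>x \<in> carrier_vec n. pos_definite m (pencil m n (\<lambda>k. sym_mat (As ! k)) x)"
    using local_minimum_iff[OF v(1), of "length w"] v(2) by blast
  then show "w \<in> SDPSF" unfolding SDPSF_def using v(1,2) by blast
qed

theorem theorem5p4:
  shows "(CUBIC_LOCAL_MIN \<in> class_P \<longrightarrow> SDPSF \<in> class_P) \<and>
         (CUBIC_LOCAL_MIN \<in> class_NP \<longrightarrow> SDPSF \<in> class_NP)"
proof -
  have "computes reduction 5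
      (poly ([:card (insert [] (stacks reduction [])):] * ([:2, 1:] * [:2, 1:] ^ 5)) (length w)) w (reduction_fun w)"
    for w
    by (rule wp_computes[OF wp_reduction])
  note red = many_one_reduction[OF this SDPSF_iff]
  show ?thesis using red by blast
qed

end
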